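(* Let $\Gamma$ be a lattice in $\mathbb{R}^n$, let $w:\Gamma\to\mathbb{C}$ be a bounded function, and let $\omega=\sum_{t\in\Gamma}w(t)\,\delta_t$ be the corresponding weighted Dirac comb. Let $\gamma_\omega$ be any of its autocorrelations, i.e. any vague limit point, as $r\to\infty$, of the family $\{\gamma^{(r)}_\omega\mid r>0\}$, where $\gamma^{(r)}_\omega=\frac{\omega_r*\tilde\omega_r}{\mathrm{vol}(B_r(0))}$. Then the following holds. (1) The autocorrelation $\gamma_\omega$ can be represented as $$\gamma_\omega=\Phi\cdot\delta_\Gamma=\sum_{x\in\Gamma}\Phi(x)\,\delta_x ,$$ where $\Phi:\mathbb{R}^n\to\mathbb{C}$ is a bounded continuous positive definite function that interpolates the autocorrelation coefficients $\nu(x)$, $x\in\Gamma$. Moreover, there exists such a $\Phi$ which extends to an entire function $\Phi:\mathbb{C}^n\to\mathbb{C}$ with the additional growth restriction that there are constants $C,R\ge 0$ and $N\in\mathbb{Z}$ such that $|\Phi(z)|\le C(1+|z|)^N\exp(R\,|\mathrm{Im}(z)|)$ for all $z\in\mathbb{C}^n$. (2) The Fourier transform $\hat\gamma_\omega$ (a diffraction measure of $\omega$) is a translation bounded positive measure that is periodic with the dual lattice $\Gamma^*=\{u\in\mathbb{R}^n\mid uv\in\mathbb{Z}\text{ for all }v\in\Gamma\}$ as lattice of periods. Furthermore, $\hat\gamma_\omega$ has a representation as a convolution $$\hat\gamma_\omega=\varrho*\delta_{\Gamma^*},$$ in which $\varrho$ is a finite positive measure supported on a fundamental domain of $\Gamma^*$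 that is contained in the ball of radius $R$ around the origin (with $R$ the constant of part (1)).
   Context: A lattice in $\mathbb{R}^n$ is the integer span of $n$ vectors linearly independent over $\mathbb{R}$. Measures are regular complex Borel measures, identified with linear functionals on the space of continuous functions of compact support; the topology on measures is the vague topology. $\delta_t$ is the unit point measure at $t$, and $\delta_A=\sum_{t\in A}\delta_t$ for a lattice $A$. A measure $\mu$ is translation bounded if $\sup_{x}|\mu|(x+K)<\infty$ for every compact $K$. $B_r(a)$ is the open ball of radius $r$ around $a$; $\omega_r$ is the restriction of $\omega$ to $B_r(0)$; for a measure $\mu$, $\tilde\mu(\varphi)=\overline{\mu(\tilde\varphi)}$ with $\tilde\varphi(x)=\overline{\varphi(-x)}$, and $\tilde\omega_r$ means $(\omega_r)\tilde{\ }$. A vague limit point $\gamma_\omega$ as $r\to\infty$ means: there is an increasing unbounded sequence of radii $(r_i)_{i\in\mathbb{N}}$ with $\gamma^{(r_i)}_\omega\to\gamma_\omega$ vaguely. The corresponding autocorrelation coefficients are $\nu(z)=\lim_{i\to\infty}\frac{1}{\mathrm{vol}(B_{r_i}(0))}\sum_{t,t'\in\Gamma\cap B_{r_i}(0),\ t-t'=z}w(t)\overline{w(t')}$ for $z\in\Gamma$, so that $\gamma_\omega=\sum_{z\in\Gamma}\nu(z)\delta_z$. The Fourier transform of a Schwartz function is $\hat\varphi(x)=\int_{\mathbb{R}^n}e^{-2\pi i xy}\varphi(y)\,dy$, where $xy$ is the Euclidean scalar product; it is extended to measures that are tempered distributions by duality, $\hat\mu(\varphi)=\mu(\hat\varphi)$.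 A measure is periodic with lattice of periods $\Gamma^*$ if it is invariant under translation by every element of $\Gamma^*$. A fundamental domain of $\Gamma^*$ is a Borel set $E$ whose translates $t+E$, $t\in\Gamma^*$, form a partition of $\mathbb{R}^n$. A measure $\mu$ is supported on a Borel set $A$ if $\mu$ equals its restriction $\mu|_A$. *)

theory Defs
  imports "HOL-Probability.Probability"
begin

section \<open>Lattices\<close>

definition is_lattice :: "(real ^ 'n) set \<Rightarrow> bool" where
  "is_lattice \<Gamma> \<longleftrightarrow>
     (\<exists>B. independent B \<and> card B = CARD('n) \<and>
          \<Gamma> = range (\<lambda>c :: real ^ 'n \<Rightarrow> int. \<Sum>v\<in>B. of_int (c v) *\<^sub>R v))"

definition dual_lattice :: "(real ^ 'n) set \<Rightarrow> (real ^ 'n) set" where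
  "dual_lattice \<Gamma> = {u. \<forall>v\<in>\<Gamma>. u \<bullet> v \<in> \<int>}"

definition fundamental_domain :: "(real ^ 'n) set \<Rightarrow> (real ^ 'n) set \<Rightarrow> bool" where
  "fundamental_domain L E \<longleftrightarrow>
     E \<in> sets borel \<and>
     (\<Union>t\<in>L. (+) t ` E) = UNIV \<and>
     disjoint_family_on (\<lambda>t. (+) t ` E) L"

section \<open>Complex measures as linear functionals\<close>

text \<open>
  A regular complex Borel measure, possibly of infinite total variation, is a linear functional
  on the continuous functions of compact support that is bounded on the functions supported
  in a fixed compact set. The carrier type consists of total functionals, whose values outside
  \<open>C_c\<close> are not constrained: two functionals denote the same measure iff they agree on \<open>C_c\<close>.
\<close>

definition compactly_supported :: "('a::euclidean_space \<Rightarrow> complex) \<Rightarrow> bool" where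
  "compactly_supported \<phi> \<longleftrightarrow> compact (closure (support_on UNIV \<phi>))"

definition C_c :: "('a::euclidean_space \<Rightarrow> complex) set" where
  "C_c = {\<phi>. continuous_on UNIV \<phi> \<and> compactly_supported \<phi>}"

type_synonym 'a functional = "('a \<Rightarrow> complex) \<Rightarrow> complex"

definition complex_measure :: "('a::euclidean_space) functional \<Rightarrow> bool" where
  "complex_measure \<mu> \<longleftrightarrow>
     (\<forall>\<phi>\<in>C_c. \<forall>\<psi>\<in>C_c. \<mu> (\<lambda>x. \<phi> x + \<psi> x) = \<mu> \<phi> + \<mu> \<psi>) \<and>
     (\<forall>\<phi>\<in>C_c. \<forall>c. \<mu> (\<lambda>x. c * \<phi> x) = c * \<mu> \<phi>) \<and>
     (\<forall>K. compact K \<longrightarrow>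
        (\<exists>C. \<forall>\<phi>\<in>C_c. support_on UNIV \<phi> \<subseteq> K \<longrightarrow> norm (\<mu> \<phi>) \<le> C * (SUP x. norm (\<phi> x))))"

definition same_measure :: "('a::euclidean_space) functional \<Rightarrow> 'a functional \<Rightarrow> bool" where
  "same_measure \<mu> \<nu> \<longleftrightarrow> (\<forall>\<phi>\<in>C_c. \<mu> \<phi> = \<nu> \<phi>)"

definition vaguely_converges ::
    "(nat \<Rightarrow> ('a::euclidean_space) functional) \<Rightarrow> 'a functional \<Rightarrow> bool" where
  "vaguely_converges \<mu>s \<mu> \<longleftrightarrow> (\<forall>\<phi>\<in>C_c. (\<lambda>i. \<mu>s i \<phi>) \<longlonglongrightarrow> \<mu> \<phi>)"

text \<open>
  The functional of \<open>\<Sum>t\<in>A. w t \<delta>\<^sub>t\<close>. For locally finite \<open>A\<close> and \<open>\<phi>\<close> of compact support, only finitely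
  many summands are nonzero. The same formula gives the integral of a compactly supported
  function that is merely bounded and Borel, which is what restriction to a Borel set needs.
\<close>

definition dirac_comb :: "'a set \<Rightarrow> ('a \<Rightarrow> complex) \<Rightarrow> ('a::euclidean_space) functional" where
  "dirac_comb A w = (\<lambda>\<phi>. \<Sum>\<^sub>\<infinity>t\<in>A. w t * \<phi> t)"

definition restrict_functional :: "'a set \<Rightarrow> ('a::euclidean_space) functional \<Rightarrow> 'a functional" where
  "restrict_functional A \<mu> = (\<lambda>\<phi>. \<mu> (\<lambda>x. indicator A x * \<phi> x))"

definition tilde :: "('a::euclidean_space) functional \<Rightarrow> 'a functional" where
  "tilde \<mu> = (\<lambda>\<phi>. cnj (\<mu> (\<lambda>x. cnj (\<phi> (- x)))))"

definition convolve :: "('a::euclidean_space) functional \<Rightarrow> 'a functional \<Rightarrow> 'a functional" where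
  "convolve \<mu> \<nu> = (\<lambda>\<phi>. \<mu> (\<lambda>x. \<nu> (\<lambda>y. \<phi> (x + y))))"

section \<open>Autocorrelation\<close>

definition ball_autocorrelation ::
    "('a::euclidean_space) functional \<Rightarrow> real \<Rightarrow> 'a functional" where
  "ball_autocorrelation \<omega> r =
     (\<lambda>\<phi>. convolve (restrict_functional (ball 0 r) \<omega>) (tilde (restrict_functional (ball 0 r) \<omega>)) \<phi>
           / of_real (measure lborel (ball 0 r :: 'a set)))"

definition autocorrelation_along ::
    "('a::euclidean_space) functional \<Rightarrow> (nat \<Rightarrow> real) \<Rightarrow> 'a functional \<Rightarrow> bool" where
  "autocorrelation_along \<omega> r \<gamma> \<longleftrightarrow>
     (\<forall>i. 0 < r i) \<and> incseq r \<and> filterlim r at_top sequentially \<and>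
     complex_measure \<gamma> \<and>
     vaguely_converges (\<lambda>i. ball_autocorrelation \<omega> (r i)) \<gamma>"

definition autocorrelation_coeff ::
    "('a::euclidean_space) set \<Rightarrow> ('a \<Rightarrow> complex) \<Rightarrow> (nat \<Rightarrow> real) \<Rightarrow> 'a \<Rightarrow> complex \<Rightarrow> bool" where
  "autocorrelation_coeff \<Gamma> w r z \<nu> \<longleftrightarrow>
     (\<lambda>i. (\<Sum>(t, t') \<in> {(t, t'). t \<in> \<Gamma> \<inter> ball 0 (r i) \<and> t' \<in> \<Gamma> \<inter> ball 0 (r i) \<and> t - t' = z}.
              w t * cnj (w t'))
           / of_real (measure lborel (ball 0 (r i) :: 'a set)))
     \<longlonglongrightarrow> \<nu>"

section \<open>Positive definite and entire functions\<close>

definition positive_definite :: "('a::real_vector \<Rightarrow> complex) \<Rightarrow> bool" where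
  "positive_definite f \<longleftrightarrow>
     (\<forall>X c. finite X \<longrightarrow> (\<Sum>x\<in>X. \<Sum>y\<in>X. c x * cnj (c y) * f (x - y)) \<in> \<real>\<^sub>\<ge>\<^sub>0)"

text \<open>Holomorphy in several variables: the real Frechet derivative is complex linear everywhere.\<close>

definition entire :: "(complex ^ 'n \<Rightarrow> complex) \<Rightarrow> bool" where
  "entire F \<longleftrightarrow>
     (\<forall>z. \<exists>D. (F has_derivative D) (at z) \<and> (\<forall>c v. D (c *s v) = c * D v))"

definition complex_vec :: "real ^ 'n \<Rightarrow> complex ^ 'n" where
  "complex_vec x = (\<chi> i. of_real (x $ i))"

definition Im_vec :: "complex ^ 'n \<Rightarrow> real ^ 'n" where
  "Im_vec z = (\<chi> i. Im (z $ i))"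

section \<open>Tempered distributions and the Fourier transform\<close>

fun iterated_pderiv ::
    "'a list \<Rightarrow> ('a::euclidean_space \<Rightarrow> complex) \<Rightarrow> 'a \<Rightarrow> complex" where
  "iterated_pderiv [] f = f"
| "iterated_pderiv (b # bs) f =
     (\<lambda>x. vector_derivative (\<lambda>t. iterated_pderiv bs f (x + t *\<^sub>R b)) (at 0))"

definition smooth :: "('a::euclidean_space \<Rightarrow> complex) \<Rightarrow> bool" where
  "smooth f \<longleftrightarrow> (\<forall>bs. set bs \<subseteq> Basis \<longrightarrow> iterated_pderiv bs f differentiable_on UNIV)"

definition schwartz :: "('a::euclidean_space \<Rightarrow> complex) set" where
  "schwartz = {f. smooth f \<and>
     (\<forall>bs m. set bs \<subseteq> Basis \<longrightarrow>
        bounded (range (\<lambda>x. (1 + norm x) ^ m *\<^sub>R iterated_pderiv bs f x)))}"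

definition schwartz_seminorm :: "nat \<Rightarrow> ('a::euclidean_space \<Rightarrow> complex) \<Rightarrow> real" where
  "schwartz_seminorm m f =
     (SUP (bs, x) \<in> {bs. set bs \<subseteq> Basis \<and> length bs \<le> m} \<times> UNIV.
        (1 + norm x) ^ m * norm (iterated_pderiv bs f x))"

definition tempered_distribution :: "('a::euclidean_space) functional \<Rightarrow> bool" where
  "tempered_distribution T \<longleftrightarrow>
     (\<forall>\<phi>\<in>schwartz. \<forall>\<psi>\<in>schwartz. T (\<lambda>x. \<phi> x + \<psi> x) = T \<phi> + T \<psi>) \<and>
     (\<forall>\<phi>\<in>schwartz. \<forall>c. T (\<lambda>x. c * \<phi> x) = c * T \<phi>) \<and>
     (\<exists>C m. \<forall>\<phi>\<in>schwartz. norm (T \<phi>) \<le> C * schwartz_seminorm m \<phi>)"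

text \<open>
  A measure is a tempered distribution if its restriction to the test functions extends to one;
  the extension is unique because the test functions are dense in the Schwartz space.
\<close>

definition tempered_extension :: "('a::euclidean_space) functional \<Rightarrow> 'a functional \<Rightarrow> bool" where
  "tempered_extension \<mu> T \<longleftrightarrow>
     tempered_distribution T \<and> (\<forall>\<phi>. smooth \<phi> \<and> compactly_supported \<phi> \<longrightarrow> T \<phi> = \<mu> \<phi>)"

definition fourier :: "('a::euclidean_space \<Rightarrow> complex) \<Rightarrow> 'a \<Rightarrow> complex" where
  "fourier \<phi> x = (\<integral>y. exp (- 2 * of_real pi * \<i> * of_real (x \<bullet> y)) * \<phi> y \<partial>lborel)"

text \<open>
  The tempered distribution \<open>\<phi> \<mapsto> \<mu> (fourier \<phi>)\<close> is given by the measure \<open>\<mu>h\<close>.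
\<close>

definition fourier_transform_of ::
    "('a::euclidean_space) functional \<Rightarrow> 'a functional \<Rightarrow> bool" where
  "fourier_transform_of \<mu> \<mu>h \<longleftrightarrow>
     (\<exists>T. tempered_extension \<mu> T \<and> tempered_extension \<mu>h (\<lambda>\<phi>. T (fourier \<phi>)))"

section \<open>Positive measures\<close>

text \<open>
  Positive measures are Borel measures that are finite on compact sets. They are regular
  automatically, and coincide with their own total variation.
\<close>

definition positive_measure :: "('a::euclidean_space) measure \<Rightarrow> bool" where
  "positive_measure M \<longleftrightarrow> sets M = sets borel \<and> (\<forall>K. compact K \<longrightarrow> emeasure M K < \<infinity>)"

definition functional_of :: "('a::euclidean_space) measure \<Rightarrow> 'a functional" where
  "functional_of M = (\<lambda>\<phi>. \<integral>x. \<phi> x \<partial>M)"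

definition translation_bounded :: "('a::euclidean_space) measure \<Rightarrow> bool" where
  "translation_bounded M \<longleftrightarrow> (\<forall>K. compact K \<longrightarrow> (SUP x. emeasure M ((+) x ` K)) < \<infinity>)"

definition periodic :: "('a::euclidean_space) measure \<Rightarrow> 'a set \<Rightarrow> bool" where
  "periodic M L \<longleftrightarrow> (\<forall>u\<in>L. distr M borel ((+) u) = M)"

definition delta_set :: "('a::euclidean_space) set \<Rightarrow> 'a measure" where
  "delta_set A = distr (count_space A) borel (\<lambda>x. x)"

definition supported_on :: "('a::euclidean_space) measure \<Rightarrow> 'a set \<Rightarrow> bool" where
  "supported_on M A \<longleftrightarrow> density M (indicator A) = M"

section \<open>Interpolation of the autocorrelation\<close>

definition autocorrelation_interpolation ::
    "('a::euclidean_space) set \<Rightarrow> ('a \<Rightarrow> complex) \<Rightarrow> (nat \<Rightarrow> real) \<Rightarrow> 'a functional \<Rightarrow>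
     ('a \<Rightarrow> complex) \<Rightarrow> bool" where
  "autocorrelation_interpolation \<Gamma> w r \<gamma> \<Phi> \<longleftrightarrow>
     same_measure \<gamma> (dirac_comb \<Gamma> \<Phi>) \<and>
     bounded (range \<Phi>) \<and> continuous_on UNIV \<Phi> \<and> positive_definite \<Phi> \<and>
     (\<forall>z\<in>\<Gamma>. autocorrelation_coeff \<Gamma> w r z (\<Phi> z))"

definition entire_extension_with_growth ::
    "(real ^ 'n \<Rightarrow> complex) \<Rightarrow> (complex ^ 'n \<Rightarrow> complex) \<Rightarrow> real \<Rightarrow> real \<Rightarrow> int \<Rightarrow> bool" where
  "entire_extension_with_growth \<Phi> F C R N \<longleftrightarrow>
     entire F \<and> (\<forall>x. F (complex_vec x) = \<Phi> x) \<and>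
     (\<forall>z. norm (F z) \<le> C * (1 + norm z) powi N * exp (R * norm (Im_vec z)))"

end

theory Submission
  imports Defs
begin

text \<open>
  The finite correlations of \<open>\<omega>\<^sub>r\<close> are the Fourier coefficients of the nonnegative,
  \<open>\<Gamma>\<^sup>*\<close>-periodic density \<open>|\<Sum>\<^bsub>t\<in>B\<^sub>r\<^esub> w(t) e\<^bsup>-2\<pi>ikt\<^esup>|\<^sup>2 / vol B\<^sub>r\<close>. Restricted to a fundamental domain \<open>E\<close>
  of \<open>\<Gamma>\<^sup>*\<close>, these densities are finite measures of convergent mass, so a subsequence converges,
  against continuous periodic functions, to a finite measure \<open>\<rho>\<close> on \<open>E\<close>. Testing with characters
  shows that the inverse Fourier transform of \<open>\<rho> / vol E\<close> interpolates the autocorrelation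
  coefficients; it is entire of exponential type because \<open>E\<close> is bounded. Testing with
  periodizations of Schwartz functions gives \<open>\<rho> * \<delta>\<close> as the Fourier transform of the
  autocorrelation. Neither Bochner's theorem nor Poisson summation is needed.
\<close>

section \<open>Lattices and their fundamental cells\<close>

text \<open>The autocorrelation is given only through its values on test functions. A bump function
  that isolates one lattice point extracts a single correlation coefficient, which therefore
  converges along the whole given sequence. The coefficient at 0 times the cell volume V is the
  total mass of the densities, whence the convergent mass; and limits computed along the subsequence
  agree with limits already known to exist.

  Compactness belongs to the torus and not to the half-open cell, since mass may drift to the
  missing faces. Continuous periodic test functions do not notice when such mass is moved back into
  the cell.

  Two normalisations occur. Characters integrated over the cell produce a factor V, so \<Phi> is the
  transform of \<rho> / V, whereas unfolding a periodization produces none, so the diffraction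
  measure is built from \<rho> itself. The constant R of the statement is 2 pi times a norm bound
  for the cell: the factor comes from the characters, and the enlarged ball still contains the
  cell.\<close>

definition int_lattice :: "(real ^ 'n \<Rightarrow> real ^ 'n) \<Rightarrow> (real ^ 'n) set" where
  "int_lattice D = {x. \<forall>i. D x $ i \<in> \<int>}"

definition cell :: "(real ^ 'n \<Rightarrow> real ^ 'n) \<Rightarrow> (real ^ 'n) set" where
  "cell D = {x. \<forall>i. 0 \<le> D x $ i \<and> D x $ i < 1}"

definition cell_shift :: "(real ^ 'n \<Rightarrow> real ^ 'n) \<Rightarrow> real ^ 'n \<Rightarrow> real ^ 'n" where
  "cell_shift D x = inv D (\<chi> i. of_int \<lfloor>D x $ i\<rfloor>)"

text \<open>A linear injection has a linear left inverse, and bijectivity forces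
  \<open>inv D\<close> to be that map.\<close>

lemma linear_inv:
  fixes D :: "'a::euclidean_space \<Rightarrow> 'a"
  assumes "linear D" "bij D"
  shows "linear (inv D)" "bij (inv D)"
proof -
  obtain D' where "linear D'" "D' \<circ> D = id"
    using linear_injective_left_inverse[OF assms(1) bij_is_inj[OF assms(2)]] by auto
  moreover have "D' = inv D"
    using calculation(2) assms(2) by (metis bij_is_surj comp_assoc comp_id id_comp surj_iff)
  ultimately show "linear (inv D)" by simp
  show "bij (inv D)" using assms(2) by (rule bij_imp_bij_inv)
qed

text \<open>\<open>A\<close> sends the standard basis to a lattice basis, so the lattice is the
  image of the integer vectors. Describing a lattice by the coordinate map that must take integer
  values gives \<open>\<Gamma>\<close> (with the inverse of \<open>A\<close>) and its dual (with the
  transpose of \<open>A\<close>) the same form, so lemmas on \<open>int_lattice\<close> serve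
  both.\<close>

lemma is_latticeE:
  fixes \<Gamma> :: "(real ^ 'n) set"
  assumes "is_lattice \<Gamma>"
  obtains A where "linear A" "bij A" "\<Gamma> = int_lattice (inv A)"
    "dual_lattice \<Gamma> = int_lattice (adjoint A)"
proof -
  obtain B where B: "independent B" "card B = CARD('n)"
     "\<Gamma> = range (\<lambda>c :: real ^ 'n \<Rightarrow> int. \<Sum>v\<in>B. of_int (c v) *\<^sub>R v)"
    using assms unfolding is_lattice_def by auto
  have finB: "finite B" using B(1) by (rule independent_imp_finite)
  obtain e :: "'n \<Rightarrow> real ^ 'n" where e: "bij_betw e UNIV B"
    using finite_same_card_bij[of "UNIV :: 'n set" B] finB B(2) by auto
  have inj_e: "inj e" using e by (rule bij_betw_imp_inj_on)
  have rng_e: "range e = B" using e by (rule bij_betw_imp_surj_on)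
  define A :: "real ^ 'n \<Rightarrow> real ^ 'n" where "A x = (\<Sum>i\<in>UNIV. x $ i *\<^sub>R e i)" for x
  have lin: "linear A" unfolding A_def
    by (intro linearI) (simp_all add: algebra_simps sum.distrib scaleR_sum_right)
  have axis: "A (axis i 1) = e i" for i
  proof -
    have "A (axis i 1) = (\<Sum>j\<in>UNIV. if j = i then e i else 0)"
      unfolding A_def by (intro sum.cong) (auto simp: axis_def)
    then show ?thesis by simp
  qed
  have "B \<subseteq> range A" using rng_e axis by (metis image_subset_iff rangeI)
  then have "span B \<subseteq> range A"
    using linear_subspace_image[OF lin subspace_UNIV] by (intro span_minimal)
  moreover have "span B = UNIV"
    using B by (intro dim_eq_full[THEN iffD1]) (simp add: dim_eq_card_independent dim_span)
  ultimately have surj: "surj A" by auto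
  have bij: "bij A" using surj lin by (simp add: bij_def linear_surjective_imp_injective)
  have sum_c: "(\<Sum>v\<in>B. of_int (c v) *\<^sub>R v) = A (\<chi> i. of_int (c (e i)))" for c :: "real ^ 'n \<Rightarrow> int"
    unfolding A_def using sum.reindex_bij_betw[OF e, of "\<lambda>v. of_int (c v) *\<^sub>R v"] by simp
  have \<Gamma>: "\<Gamma> = A ` {x. \<forall>i. x $ i \<in> \<int>}"
  proof
    show "\<Gamma> \<subseteq> A ` {x. \<forall>i. x $ i \<in> \<int>}" unfolding B(3) sum_c by auto
    show "A ` {x. \<forall>i. x $ i \<in> \<int>} \<subseteq> \<Gamma>"
    proof
      fix y assume "y \<in> A ` {x. \<forall>i. x $ i \<in> \<int>}"
      then obtain x where x: "y = A x" "\<And>i. x $ i \<in> \<int>" by auto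
      define c where "c v = \<lfloor>x $ (inv e v)\<rfloor>" for v
      have "A (\<chi> i. of_int (c (e i))) = A x"
        using x(2) by (intro arg_cong[of _ _ A]) (auto simp: vec_eq_iff c_def inj_e)
      then show "y \<in> \<Gamma>" unfolding B(3) sum_c using x(1) by (metis rangeI)
    qed
  qed
  have g1: "\<Gamma> = int_lattice (inv A)"
    unfolding \<Gamma> int_lattice_def using bij
    by (auto simp: bij_is_inj inv_f_f image_iff) (metis bij_inv_eq_iff)
  \<comment> \<open>Coordinates of the transpose are pairings with the basis vectors, so integrality
    on the whole lattice reduces to integrality on the basis.\<close>
  have adj: "adjoint A u $ i = u \<bullet> e i" for u i
    using adjoint_works[OF lin, of "axis i 1" u] axis[of i]
    by (metis inner_axis inner_commute inner_real_def mult.right_neutral)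
  have g2: "dual_lattice \<Gamma> = int_lattice (adjoint A)"
  proof -
    have "(\<forall>v\<in>\<Gamma>. u \<bullet> v \<in> \<int>) \<longleftrightarrow> (\<forall>i. u \<bullet> e i \<in> \<int>)" for u
    proof
      assume "\<forall>v\<in>\<Gamma>. u \<bullet> v \<in> \<int>"
      moreover have "e i \<in> \<Gamma>" for i unfolding \<Gamma> axis[symmetric]
        by (rule imageI) (auto simp: axis_def)
      ultimately show "\<forall>i. u \<bullet> e i \<in> \<int>" by blast
    next
      assume *: "\<forall>i. u \<bullet> e i \<in> \<int>"
      show "\<forall>v\<in>\<Gamma>. u \<bullet> v \<in> \<int>"
        unfolding \<Gamma> A_def using * by (auto simp: inner_sum_right)
    qed
    then show ?thesis unfolding dual_lattice_def int_lattice_def adj by simp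
  qed
  show ?thesis using that[OF lin bij g1 g2] .
qed

text \<open>The kernel of the transpose is orthogonal to the range of \<open>A\<close>, which is the
  whole space.\<close>

lemma bij_adjoint:
  fixes A :: "real ^ 'n \<Rightarrow> real ^ 'n"
  assumes "linear A" "bij A"
  shows "linear (adjoint A)" "bij (adjoint A)"
proof -
  show l: "linear (adjoint A)" using assms(1) by (rule adjoint_linear)
  have "inj (adjoint A)"
    unfolding linear_injective_0[OF l]
  proof (intro allI impI)
    fix x assume "adjoint A x = 0"
    then have "x \<bullet> A y = 0" for y using adjoint_works[OF assms(1), of y x] by (simp add: inner_commute)
    then have "x \<bullet> x = 0" using assms(2) by (metis bij_pointE)
    then show "x = 0" by simp
  qed
  then show "bij (adjoint A)" using l by (simp add: bij_def linear_injective_imp_surjective)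
qed

lemma int_lattice_add: "linear D \<Longrightarrow> x \<in> int_lattice D \<Longrightarrow> y \<in> int_lattice D \<Longrightarrow> x + y \<in> int_lattice D"
  by (auto simp: int_lattice_def linear_add)

lemma int_lattice_diff: "linear D \<Longrightarrow> x \<in> int_lattice D \<Longrightarrow> y \<in> int_lattice D \<Longrightarrow> x - y \<in> int_lattice D"
  by (auto simp: int_lattice_def linear_diff)

lemma int_lattice_0: "linear D \<Longrightarrow> 0 \<in> int_lattice D"
  by (auto simp: int_lattice_def linear_0)

text \<open>The index set is written as a \<open>PiE\<close> so that the product rules for
  countability and for absolute summability apply to the lattice.\<close>

lemma bij_betw_int_lattice:
  fixes D :: "real ^ 'n \<Rightarrow> real ^ 'n"
  assumes "linear D" "bij D"
  shows "bij_betw (\<lambda>c. inv D (\<chi> i. of_int (c i))) (PiE UNIV (\<lambda>_. UNIV)) (int_lattice D)"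
proof (rule bij_betw_imageI)
  show "inj_on (\<lambda>c. inv D (\<chi> i. of_int (c i))) (UNIV \<rightarrow>\<^sub>E UNIV)"
  proof (rule inj_onI)
    fix c d :: "'n \<Rightarrow> int"
    assume "inv D (\<chi> i. of_int (c i)) = inv D (\<chi> i. of_int (d i))"
    then have "((\<chi> i. of_int (c i)) :: real ^ 'n) = (\<chi> i. of_int (d i))"
      using assms(2) by (metis bij_inv_eq_iff)
    then show "c = d" by (auto simp: vec_eq_iff)
  qed
  show "(\<lambda>c. inv D (\<chi> i. of_int (c i))) ` (UNIV \<rightarrow>\<^sub>E UNIV) = int_lattice D"
  proof safe
    fix c show "inv D (\<chi> i. of_int (c i)) \<in> int_lattice D"
      using assms(2) by (simp add: int_lattice_def bij_is_surj surj_f_inv_f)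
  next
    fix x assume "x \<in> int_lattice D"
    then have "x = inv D (\<chi> i. of_int \<lfloor>D x $ i\<rfloor>)"
      using assms(2) by (simp add: int_lattice_def bij_is_inj)
    then show "x \<in> (\<lambda>c. inv D (\<chi> i. of_int (c i))) ` (UNIV \<rightarrow>\<^sub>E UNIV)"
      by (intro image_eqI[where x = "\<lambda>i. \<lfloor>D x $ i\<rfloor>"]) auto
  qed
qed

lemma countable_int_lattice:
  fixes D :: "real ^ 'n \<Rightarrow> real ^ 'n"
  assumes "linear D" "bij D"
  shows "countable (int_lattice D)"
proof -
  have "countable (PiE (UNIV :: 'n set) (\<lambda>_. UNIV :: int set))"
    by (intro countable_PiE) auto
  then show ?thesis using bij_betw_int_lattice[OF assms] by (metis bij_betw_imp_surj_on countable_image)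
qed

lemma cell_shift_in: "bij D \<Longrightarrow> cell_shift D x \<in> int_lattice D"
  by (simp add: int_lattice_def cell_shift_def bij_is_surj surj_f_inv_f)

text \<open>Each coordinate of \<open>D u\<close> is an integer k, and 0 \<le> y - k < 1 singles out
  the floor of y. Together with \<open>cell_shift_in\<close> this is the tiling property on which
  all unfolding arguments rest.\<close>

lemma cell_shift_iff:
  assumes "linear D" "bij D" "u \<in> int_lattice D"
  shows "x - u \<in> cell D \<longleftrightarrow> u = cell_shift D x"
proof -
  have "x - u \<in> cell D \<longleftrightarrow> (\<forall>i. D u $ i = of_int \<lfloor>D x $ i\<rfloor>)"
  proof -
    have "0 \<le> D x $ i - D u $ i \<and> D x $ i - D u $ i < 1 \<longleftrightarrow> D u $ i = of_int \<lfloor>D x $ i\<rfloor>" for i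
    proof -
      obtain k where "D u $ i = of_int k" using assms(3) by (auto simp: int_lattice_def elim: Ints_cases)
      then show ?thesis by simp linarith
    qed
    then show ?thesis by (simp add: cell_def linear_diff[OF assms(1)])
  qed
  also have "\<dots> \<longleftrightarrow> D u = (\<chi> i. of_int \<lfloor>D x $ i\<rfloor>)" by (simp add: vec_eq_iff)
  also have "\<dots> \<longleftrightarrow> u = cell_shift D x"
    using assms(2) by (metis cell_shift_def bij_inv_eq_iff)
  finally show ?thesis .
qed

lemma cell_measurable [measurable]:
  assumes "linear (D :: real ^ 'n \<Rightarrow> real ^ 'n)"
  shows "cell D \<in> sets borel"
proof -
  have [measurable]: "D \<in> borel_measurable borel"
    using assms by (intro borel_measurable_continuous_onI linear_continuous_on) (simp add: linear_conv_bounded_linear)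
  have [measurable]: "(\<lambda>x. D x $ i) \<in> borel_measurable borel" for i
    unfolding cart_eq_inner_axis by measurable
  have "cell D = {x \<in> space borel. \<forall>i. 0 \<le> D x $ i \<and> D x $ i < 1}" by (simp add: cell_def)
  also have "\<dots> \<in> sets borel" by measurable
  finally show ?thesis .
qed

lemma cell_shift_measurable [measurable]:
  assumes "linear (D :: real ^ 'n \<Rightarrow> real ^ 'n)" "bij D"
  shows "cell_shift D \<in> borel_measurable borel"
proof -
  have l: "linear D \<Longrightarrow> D \<in> borel_measurable borel" for D :: "real ^ 'n \<Rightarrow> real ^ 'n"
    by (intro borel_measurable_continuous_onI linear_continuous_on) (simp add: linear_conv_bounded_linear)
  note [measurable] = l[OF assms(1)] l[OF linear_inv(1)[OF assms]]
  have [measurable]: "(\<lambda>x. D x $ i) \<in> borel_measurable borel" for i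
    unfolding cart_eq_inner_axis by measurable
  \<comment> \<open>As a finite sum of multiples of axis vectors, the integer vector falls under the
    measurability rules for sums.\<close>
  have "(\<lambda>x. inv D (\<Sum>i\<in>UNIV. of_int \<lfloor>D x $ i\<rfloor> *\<^sub>R axis i 1)) \<in> borel_measurable borel"
    by measurable
  moreover have "(\<chi> i. of_int \<lfloor>D x $ i\<rfloor>) = (\<Sum>i\<in>UNIV. of_int \<lfloor>D x $ i\<rfloor> *\<^sub>R axis i (1::real))" for x
    by (simp add: vec_eq_iff axis_def if_distrib cong: if_cong)
  ultimately show ?thesis by (simp add: cell_shift_def[abs_def])
qed

lemma bounded_cell:
  assumes "linear (D :: real ^ 'n \<Rightarrow> real ^ 'n)" "bij D"
  shows "bounded (cell D)"
proof -
  have "cell D \<subseteq> inv D ` cbox 0 (\<chi> i. 1)"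
  proof
    fix x assume "x \<in> cell D"
    then have "D x \<in> cbox 0 (\<chi> i. 1)" by (auto simp: cell_def mem_box_cart less_imp_le)
    then show "x \<in> inv D ` cbox 0 (\<chi> i. 1)" using assms(2) by (metis bij_inv_eq_iff image_eqI)
  qed
  moreover have "bounded (inv D ` cbox 0 (\<chi> i. 1))"
    using linear_inv[OF assms] by (intro bounded_linear_image) (auto simp: linear_conv_bounded_linear)
  ultimately show ?thesis by (rule bounded_subset[rotated])
qed

lemma fundamental_domain_cell:
  assumes "linear (D :: real ^ 'n \<Rightarrow> real ^ 'n)" "bij D"
  shows "fundamental_domain (int_lattice D) (cell D)"
  unfolding fundamental_domain_def
proof (intro conjI)
  show "cell D \<in> sets borel" using assms by simp
  have *: "x \<in> (+) t ` cell D \<longleftrightarrow> t = cell_shift D x" if "t \<in> int_lattice D" for t x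
    using cell_shift_iff[OF assms that, of x] by (auto simp: image_iff) (metis add.commute diff_add_cancel)
  show "(\<Union>t\<in>int_lattice D. (+) t ` cell D) = UNIV"
    using * cell_shift_in[OF assms(2)] by blast
  show "disjoint_family_on (\<lambda>t. (+) t ` cell D) (int_lattice D)"
    unfolding disjoint_family_on_def
  proof (intro ballI impI equals0I)
    fix s t x assume "s \<in> int_lattice D" "t \<in> int_lattice D" "s \<noteq> t"
      "x \<in> (+) s ` cell D \<inter> (+) t ` cell D"
    then show False using *[of s x] *[of t x] by (metis IntE)
  qed
qed

text \<open>The translated indicators of the cell form a partition of unity. Insert it, exchange sum
  and integral, translate each summand, and exchange back; nonnegativity justifies both
  exchanges.\<close>

lemma nn_integral_tiling:
  fixes f :: "real ^ 'n \<Rightarrow> ennreal"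
  assumes "linear D" "bij D" and [measurable]: "f \<in> borel_measurable borel"
  shows "(\<integral>\<^sup>+x. f x \<partial>lborel) =
    (\<integral>\<^sup>+x. indicator (cell D) x * (\<integral>\<^sup>+u. f (x + u) \<partial>count_space (int_lattice D)) \<partial>lborel)"
proof -
  note [measurable] = cell_measurable[OF assms(1)]
  have cnt: "countable (int_lattice D)" by (rule countable_int_lattice[OF assms(1,2)])
  have one: "f x = (\<integral>\<^sup>+u. indicator (cell D) (x - u) * f x \<partial>count_space (int_lattice D))" for x
  proof -
    have "(\<integral>\<^sup>+u. indicator (cell D) (x - u) * f x \<partial>count_space (int_lattice D)) =
          (\<integral>\<^sup>+u. f x * indicator {cell_shift D x} u \<partial>count_space (int_lattice D))"
      by (intro nn_integral_cong) (auto simp: cell_shift_iff[OF assms(1,2)] indicator_def)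
    also have "\<dots> = f x"
      using cell_shift_in[OF assms(2), of x] by (subst nn_integral_cmult_indicator) auto
    finally show ?thesis by simp
  qed
  have "(\<integral>\<^sup>+x. f x \<partial>lborel) = (\<integral>\<^sup>+x. (\<integral>\<^sup>+u. indicator (cell D) (x - u) * f x \<partial>count_space (int_lattice D)) \<partial>lborel)"
    using one by simp
  also have "\<dots> = (\<integral>\<^sup>+u. (\<integral>\<^sup>+x. indicator (cell D) (x - u) * f x \<partial>lborel) \<partial>count_space (int_lattice D))"
    using cnt by (intro nn_integral_count_space_nn_integral) auto
  also have "\<dots> = (\<integral>\<^sup>+u. (\<integral>\<^sup>+x. indicator (cell D) x * f (x + u) \<partial>lborel) \<partial>count_space (int_lattice D))"
  proof (rule nn_integral_cong)
    fix u
    have "(\<integral>\<^sup>+x. indicator (cell D) (x - u) * f x \<partial>lborel) =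
          (\<integral>\<^sup>+x. indicator (cell D) (x - u) * f x \<partial>distr lborel borel ((+) u))"
      by (simp only: lborel_distr_plus)
    also have "\<dots> = (\<integral>\<^sup>+x. indicator (cell D) x * f (x + u) \<partial>lborel)"
      by (subst nn_integral_distr) (auto simp: add.commute)
    finally show "(\<integral>\<^sup>+x. indicator (cell D) (x - u) * f x \<partial>lborel) =
      (\<integral>\<^sup>+x. indicator (cell D) x * f (x + u) \<partial>lborel)" .
  qed
  also have "\<dots> = (\<integral>\<^sup>+x. (\<integral>\<^sup>+u. indicator (cell D) x * f (x + u) \<partial>count_space (int_lattice D)) \<partial>lborel)"
    using cnt by (intro nn_integral_count_space_nn_integral[symmetric]) auto
  also have "\<dots> = (\<integral>\<^sup>+x. indicator (cell D) x * (\<integral>\<^sup>+u. f (x + u) \<partial>count_space (int_lattice D)) \<partial>lborel)"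
    by (intro nn_integral_cong nn_integral_cmult) auto
  finally show ?thesis .
qed

section \<open>Convolution with the Dirac comb of a lattice\<close>

text \<open>Points of \<open>L\<close> have finite mass and the complement of \<open>L\<close> is
  null. Sigma-finiteness is what Fubini requires of the second factor of a convolution.\<close>

lemma sigma_finite_delta_set:
  assumes "countable L"
  shows "sigma_finite_measure (delta_set L)"
proof
  have L: "L \<in> sets borel" using assms by (rule sets.countable[rotated]) auto
  let ?A = "insert (- L) ((\<lambda>u. {u}) ` L)"
  have "emeasure (delta_set L) {u} \<noteq> \<infinity>" if "u \<in> L" for u
    using that unfolding delta_set_def
    by (subst emeasure_distr) (auto simp: emeasure_count_space_finite vimage_def)
  moreover have "emeasure (delta_set L) (- L) = 0"
    using L unfolding delta_set_def by (subst emeasure_distr) (auto simp: Compl_in_sets_lebesgue)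
  ultimately show "\<exists>A. countable A \<and> A \<subseteq> sets (delta_set L) \<and> \<Union> A = space (delta_set L) \<and>
      (\<forall>a\<in>A. emeasure (delta_set L) a \<noteq> \<infinity>)"
    using assms L by (intro exI[of _ ?A]) (auto simp: delta_set_def)
qed

lemma sets_delta_set [simp, measurable_cong]: "sets (delta_set L) = sets borel"
  by (simp add: delta_set_def)

lemma nn_integral_convolution_delta_set:
  fixes \<rho> :: "(real ^ 'n) measure"
  assumes L: "countable L" and [measurable_cong]: "sets \<rho> = sets borel"
    and [measurable]: "f \<in> borel_measurable borel"
  shows "(\<integral>\<^sup>+x. f x \<partial>convolution \<rho> (delta_set L)) = (\<integral>\<^sup>+x. \<integral>\<^sup>+u. f (x + u) \<partial>count_space L \<partial>\<rho>)"
proof -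
  interpret N: sigma_finite_measure "delta_set L" using L by (rule sigma_finite_delta_set)
  have "(\<integral>\<^sup>+x. f x \<partial>convolution \<rho> (delta_set L)) = (\<integral>\<^sup>+x. \<integral>\<^sup>+u. f (x + u) \<partial>delta_set L \<partial>\<rho>)"
    unfolding convolution_def by (simp add: nn_integral_distr N.nn_integral_fst[symmetric])
  also have "\<dots> = (\<integral>\<^sup>+x. \<integral>\<^sup>+u. f (x + u) \<partial>count_space L \<partial>\<rho>)"
    unfolding delta_set_def by (intro nn_integral_cong) (simp add: nn_integral_distr)
  finally show ?thesis .
qed

lemma emeasure_convolution_delta_set:
  fixes \<rho> :: "(real ^ 'n) measure"
  assumes "countable L" and [measurable_cong]: "sets \<rho> = sets borel" and [measurable]: "A \<in> sets borel"
  shows "emeasure (convolution \<rho> (delta_set L)) A = (\<integral>\<^sup>+x. emeasure (count_space L) {u \<in> L. x + u \<in> A} \<partial>\<rho>)"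
proof -
  have "emeasure (convolution \<rho> (delta_set L)) A = (\<integral>\<^sup>+x. \<integral>\<^sup>+u. indicator A (x + u) \<partial>count_space L \<partial>\<rho>)"
    using assms by (subst nn_integral_convolution_delta_set[symmetric]) auto
  also have "\<dots> = (\<integral>\<^sup>+x. emeasure (count_space L) {u \<in> L. x + u \<in> A} \<partial>\<rho>)"
  proof (intro nn_integral_cong)
    fix x
    have "(\<integral>\<^sup>+u. indicator A (x + u) \<partial>count_space L) = (\<integral>\<^sup>+u. indicator {u \<in> L. x + u \<in> A} u \<partial>count_space L)"
      by (intro nn_integral_cong) (auto simp: indicator_def)
    then show "(\<integral>\<^sup>+u. indicator A (x + u) \<partial>count_space L) = emeasure (count_space L) {u \<in> L. x + u \<in> A}"
      by simp
  qed
  finally show ?thesis .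
qed

lemma integral_convolution_delta_set:
  fixes \<rho> :: "(real ^ 'n) measure" and f :: "real ^ 'n \<Rightarrow> complex"
  assumes L: "countable L" and [measurable_cong]: "sets \<rho> = sets borel" and "finite_measure \<rho>"
    and int: "integrable (convolution \<rho> (delta_set L)) f"
  shows "(\<integral>x. f x \<partial>convolution \<rho> (delta_set L)) = (\<integral>x. \<integral>u. f (x + u) \<partial>count_space L \<partial>\<rho>)"
proof -
  interpret N: sigma_finite_measure "delta_set L" using L by (rule sigma_finite_delta_set)
  interpret finite_measure \<rho> by fact
  interpret pair_sigma_finite \<rho> "delta_set L" ..
  have [measurable]: "f \<in> borel_measurable borel"
    using borel_measurable_integrable[OF int] by (simp add: convolution_def)
  have int': "integrable (\<rho> \<Otimes>\<^sub>M delta_set L) (\<lambda>(x, y). f (x + y))"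
    using int unfolding convolution_def by (subst (asm) integrable_distr_eq) (auto simp: case_prod_unfold)
  have "(\<integral>x. f x \<partial>convolution \<rho> (delta_set L)) = (\<integral>z. (case z of (x, y) \<Rightarrow> f (x + y)) \<partial>(\<rho> \<Otimes>\<^sub>M delta_set L))"
    unfolding convolution_def by (subst integral_distr) (auto simp: case_prod_unfold)
  also have "\<dots> = (\<integral>x. \<integral>u. f (x + u) \<partial>delta_set L \<partial>\<rho>)"
    using integral_fst'[OF int'] by simp
  also have "\<dots> = (\<integral>x. \<integral>u. f (x + u) \<partial>count_space L \<partial>\<rho>)"
    unfolding delta_set_def by (intro Bochner_Integration.integral_cong refl integral_distr) auto
  finally show ?thesis .
qed

lemma bij_betw_translate_int_lattice:
  assumes "linear D" "v \<in> int_lattice D"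
  shows "bij_betw (\<lambda>u. u + v) (int_lattice D) (int_lattice D)"
  by (rule bij_betw_byWitness[where f' = "\<lambda>u. u - v"])
     (use assms int_lattice_add int_lattice_diff in auto)

text \<open>The tiling identity for \<open>F\<close> times an indicator, with the periodic factor
  pulled out of the lattice sum. For \<open>F = 1\<close> it exhibits Lebesgue measure as a
  convolution, so lemmas on convolutions with a comb cover Lebesgue measure and diffraction measures
  alike.\<close>

lemma density_lborel_eq_convolution:
  fixes F :: "real ^ 'n \<Rightarrow> ennreal"
  assumes D: "linear D" "bij D" and [measurable]: "F \<in> borel_measurable borel"
    and per: "\<And>x u. u \<in> int_lattice D \<Longrightarrow> F (x + u) = F x"
  shows "density lborel F = convolution (density lborel (\<lambda>x. indicator (cell D) x * F x)) (delta_set (int_lattice D))"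
    (is "_ = convolution ?\<rho> _")
proof (rule measure_eqI)
  note [measurable] = cell_measurable[OF D(1)]
  fix A assume "A \<in> sets (density lborel F)"
  then have [measurable]: "A \<in> sets borel" by simp
  have meas: "(\<lambda>x. \<integral>\<^sup>+u. f (x + u) \<partial>count_space (int_lattice D)) \<in> borel_measurable borel"
    if [measurable]: "f \<in> borel_measurable borel" for f :: "real ^ 'n \<Rightarrow> ennreal"
  proof -
    interpret sigma_finite_measure "count_space (int_lattice D)"
      by (rule sigma_finite_measure_count_space_countable[OF countable_int_lattice[OF D]])
    have [measurable]: "(\<lambda>u. u) \<in> measurable (count_space (int_lattice D)) borel" by simp
    show ?thesis by measurable
  qed
  have "emeasure (density lborel F) A = (\<integral>\<^sup>+x. F x * indicator A x \<partial>lborel)"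
    by (simp add: emeasure_density)
  also have "\<dots> = (\<integral>\<^sup>+x. indicator (cell D) x * (\<integral>\<^sup>+u. F (x + u) * indicator A (x + u) \<partial>count_space (int_lattice D)) \<partial>lborel)"
    by (rule nn_integral_tiling[OF D]) simp
  also have "\<dots> = (\<integral>\<^sup>+x. (indicator (cell D) x * F x) * (\<integral>\<^sup>+u. indicator A (x + u) \<partial>count_space (int_lattice D)) \<partial>lborel)"
  proof (intro nn_integral_cong)
    fix x
    have "(\<integral>\<^sup>+u. F (x + u) * indicator A (x + u) \<partial>count_space (int_lattice D)) =
      (\<integral>\<^sup>+u. F x * indicator A (x + u) \<partial>count_space (int_lattice D))"
      by (intro nn_integral_cong) (simp add: per)
    then show "indicator (cell D) x * (\<integral>\<^sup>+u. F (x + u) * indicator A (x + u) \<partial>count_space (int_lattice D)) =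
      (indicator (cell D) x * F x) * (\<integral>\<^sup>+u. indicator A (x + u) \<partial>count_space (int_lattice D))"
      by (simp add: nn_integral_cmult ac_simps)
  qed
  also have "\<dots> = (\<integral>\<^sup>+x. (\<integral>\<^sup>+u. indicator A (x + u) \<partial>count_space (int_lattice D)) \<partial>?\<rho>)"
    by (subst nn_integral_density) (auto intro!: meas)
  also have "\<dots> = emeasure (convolution ?\<rho> (delta_set (int_lattice D))) A"
    using countable_int_lattice[OF D] by (subst nn_integral_convolution_delta_set[symmetric]) auto
  finally show "emeasure (density lborel F) A = emeasure (convolution ?\<rho> (delta_set (int_lattice D))) A" .
qed simp

lemma lborel_eq_convolution:
  fixes D :: "real ^ 'n \<Rightarrow> real ^ 'n"
  assumes D: "linear D" "bij D"
  shows "lborel = convolution (density lborel (indicator (cell D))) (delta_set (int_lattice D))"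
  using density_lborel_eq_convolution[OF D, of "\<lambda>_. 1"] by (simp add: density_1)

lemma emeasure_cell:
  fixes D :: "real ^ 'n \<Rightarrow> real ^ 'n"
  assumes D: "linear D" "bij D"
  shows "0 < measure lborel (cell D)" "emeasure lborel (cell D) = ennreal (measure lborel (cell D))"
    "emeasure lborel (cell D) < \<infinity>"
proof -
  note [measurable] = cell_measurable[OF D(1)]
  show *: "emeasure lborel (cell D) < \<infinity>"
    using bounded_cell[OF D] emeasure_bounded_finite by blast
  then show **: "emeasure lborel (cell D) = ennreal (measure lborel (cell D))"
    by (intro emeasure_eq_ennreal_measure) auto
  \<comment> \<open>If the cell were null, the tiling identity would make the whole space
    null.\<close>
  have "emeasure lborel (cell D) \<noteq> 0"
  proof
    assume "emeasure lborel (cell D) = 0"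
    then have "cell D \<in> null_sets lborel" by (auto intro: null_setsI)
    then have "AE x in lborel. x \<notin> cell D" by (rule AE_not_in)
    then have "(\<integral>\<^sup>+x. indicator (cell D) x * (\<integral>\<^sup>+u. 1 \<partial>count_space (int_lattice D)) \<partial>lborel) = (\<integral>\<^sup>+x. 0 \<partial>(lborel :: (real ^ 'n) measure))"
      by (intro nn_integral_cong_AE) (auto elim!: eventually_mono simp del: nn_integral_const)
    then show False using nn_integral_tiling[OF D, of "\<lambda>_. 1"] by simp
  qed
  then show "0 < measure lborel (cell D)" using ** by (metis ennreal_0 measure_nonneg order_le_less)
qed

section \<open>A polynomial weight that dominates the integrands\<close>

definition decay :: "real ^ 'n \<Rightarrow> real" where
  "decay x = 1 / (1 + norm x) ^ (2 * CARD('n))"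

lemma decay_pos: "0 < decay x"
  unfolding decay_def by (auto intro!: divide_pos_pos zero_less_power simp: add_pos_nonneg)

lemma decay_nonneg [simp]: "0 \<le> decay x" "\<bar>decay x\<bar> = decay x"
  using decay_pos[of x] by auto

lemma continuous_decay: "continuous_on S (decay :: real ^ 'n \<Rightarrow> real)"
proof -
  have "1 + norm x \<noteq> 0" for x :: "real ^ 'n" by (metis add_pos_nonneg norm_ge_zero less_irrefl zero_less_one)
  then show ?thesis unfolding decay_def[abs_def] by (intro continuous_intros) auto
qed
lemma measurable_decay [measurable]: "decay \<in> borel_measurable borel"
  by (intro borel_measurable_continuous_onI continuous_decay)

text \<open>Peetre's inequality: the triangle inequality yields 1 + |x| \<le> (1 + |y|) (1 + |x +
  y|). A bounded translation thus costs only a constant factor.\<close>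

lemma decay_shift: "decay (x + y) \<le> (1 + norm y) ^ (2 * CARD('n)) * decay (x :: real ^ 'n)"
proof -
  have "norm x \<le> norm (x + y) + norm y" by (metis add_diff_cancel norm_triangle_ineq4)
  then have "1 + norm x \<le> (1 + norm y) * (1 + norm (x + y))"
    by (simp add: algebra_simps) (smt (verit) norm_ge_zero mult_nonneg_nonneg)
  then have "(1 + norm x) ^ (2 * CARD('n)) \<le> ((1 + norm y) * (1 + norm (x + y))) ^ (2 * CARD('n))"
    by (intro power_mono) auto
  then have "(1 + norm x) ^ (2 * CARD('n)) \<le> (1 + norm y) ^ (2 * CARD('n)) * (1 + norm (x + y)) ^ (2 * CARD('n))"
    by (simp only: power_mult_distrib)
  moreover have "0 < (1 + norm x) ^ (2 * CARD('n))" "0 < (1 + norm (x + y)) ^ (2 * CARD('n))"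
    by (auto intro!: zero_less_power simp: add_pos_nonneg)
  moreover have "1 / b \<le> c * (1 / a)" if "a \<le> c * b" "0 < a" "0 < b" for a b c :: real
    using that by (simp add: field_simps)
  ultimately show ?thesis unfolding decay_def by blast
qed

lemma abs_summable_on_int_inverse_square: "Infinite_Set_Sum.abs_summable_on (\<lambda>k::int. 1 / (1 + \<bar>real_of_int k\<bar>)\<^sup>2) UNIV"
proof -
  have s: "summable (\<lambda>n. 1 / (1 + real n)\<^sup>2)"
    using inverse_squares_sums by (auto simp: sums_iff algebra_simps)
  have a: "Infinite_Set_Sum.abs_summable_on (\<lambda>n::nat. 1 / (1 + real n)\<^sup>2) UNIV"
    using s by (subst abs_summable_on_nat_iff') (simp add: norm_divide norm_power)
  have 1: "Infinite_Set_Sum.abs_summable_on (\<lambda>k::int. 1 / (1 + \<bar>real_of_int k\<bar>)\<^sup>2) (range int)"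
    using a by (subst Infinite_Set_Sum.abs_summable_on_reindex_iff[symmetric]) auto
  have 2: "Infinite_Set_Sum.abs_summable_on (\<lambda>k::int. 1 / (1 + \<bar>real_of_int k\<bar>)\<^sup>2) (range (\<lambda>n. - int n))"
    using a by (subst Infinite_Set_Sum.abs_summable_on_reindex_iff[symmetric]) (auto simp: inj_on_def)
  have "(UNIV :: int set) = range int \<union> range (\<lambda>n. - int n)"
    by (auto simp: image_iff) (metis int_cases2)
  then show ?thesis using 1 2 by (metis Infinite_Set_Sum.abs_summable_on_union)
qed

text \<open>The exponent 2n of the weight has its origin here: it leaves an exponent 2 for each of
  the n integer coordinates, and the majorant factors into one-dimensional sums of 1 / (1 +
  |k|)^2.\<close>

lemma abs_summable_on_decay:
  fixes D :: "real ^ 'n \<Rightarrow> real ^ 'n"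
  assumes D: "linear D" "bij D"
  shows "Infinite_Set_Sum.abs_summable_on decay (int_lattice D)"
proof -
  let ?z = "\<lambda>c. inv D (\<chi> i. of_int (c i))"
  obtain K where K: "K > 0" "\<And>x. norm (D x) \<le> K * norm x"
    using linear_bounded_pos[OF D(1)] by (metis mult.commute)
  have s: "Infinite_Set_Sum.abs_summable_on (\<lambda>c. \<Prod>i\<in>UNIV. 1 / (1 + \<bar>real_of_int (c i)\<bar>)\<^sup>2) (PiE (UNIV :: 'n set) (\<lambda>_. UNIV))"
    by (intro Infinite_Set_Sum.abs_summable_on_prod_PiE) (auto intro: abs_summable_on_int_inverse_square)
  have le: "decay (?z c) \<le> (1 + K) ^ (2 * CARD('n)) * (\<Prod>i\<in>UNIV. 1 / (1 + \<bar>real_of_int (c i)\<bar>)\<^sup>2)" for c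
  proof -
    have ci: "1 + \<bar>real_of_int (c i)\<bar> \<le> (1 + K) * (1 + norm (?z c))" for i
    proof -
      have "\<bar>real_of_int (c i)\<bar> = \<bar>D (?z c) $ i\<bar>" using D by (simp add: bij_is_surj surj_f_inv_f)
      also have "\<dots> \<le> norm (D (?z c))" by (rule component_le_norm_cart)
      also have "\<dots> \<le> K * norm (?z c)" by (rule K)
      finally show ?thesis using K(1) by (simp add: algebra_simps) (smt (verit) norm_ge_zero)
    qed
    have "(\<Prod>i\<in>(UNIV::'n set). (1 + \<bar>real_of_int (c i)\<bar>)\<^sup>2) \<le> (\<Prod>i\<in>(UNIV::'n set). ((1 + K) * (1 + norm (?z c)))\<^sup>2)"
      using ci by (intro prod_mono conjI power_mono) auto
    also have "\<dots> = (1 + K) ^ (2 * CARD('n)) * (1 + norm (?z c)) ^ (2 * CARD('n))"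
      by (simp add: power_mult_distrib power_mult)
    finally have "(\<Prod>i\<in>(UNIV::'n set). (1 + \<bar>real_of_int (c i)\<bar>)\<^sup>2) \<le> (1 + K) ^ (2 * CARD('n)) * (1 + norm (?z c)) ^ (2 * CARD('n))" .
    moreover have "0 < (\<Prod>i\<in>(UNIV::'n set). (1 + \<bar>real_of_int (c i)\<bar>)\<^sup>2)"
      by (intro prod_pos) (auto intro!: zero_less_power simp: add_pos_nonneg)
    moreover have "0 < (1 + norm (?z c)) ^ (2 * CARD('n))"
      by (auto intro!: zero_less_power simp: add_pos_nonneg)
    ultimately show ?thesis by (simp add: decay_def prod_dividef field_simps)
  qed
  have "Infinite_Set_Sum.abs_summable_on (\<lambda>c. decay (?z c)) (PiE (UNIV :: 'n set) (\<lambda>_. UNIV))"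
    by (rule abs_summable_on_comparison_test'[OF Infinite_Set_Sum.abs_summable_on_cmult_right[OF s, of "(1 + K) ^ (2 * CARD('n))"]])
       (use le in auto)
  then show ?thesis
    using Infinite_Set_Sum.abs_summable_on_reindex_bij_betw[OF bij_betw_int_lattice[OF D], of decay] by simp
qed

text \<open>By the translation estimate, the lattice sum of the weight around a point of norm at
  most \<open>R\<close> is bounded independently of the point, and \<open>\<rho>\<close> is
  finite.\<close>

lemma integrable_decay_convolution:
  fixes D :: "real ^ 'n \<Rightarrow> real ^ 'n" and \<rho> :: "(real ^ 'n) measure"
  assumes D: "linear D" "bij D" and [measurable_cong]: "sets \<rho> = sets borel" and "finite_measure \<rho>"
    and AE: "AE x in \<rho>. norm x \<le> R"
  shows "integrable (convolution \<rho> (delta_set (int_lattice D))) decay"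
proof (rule integrableI_nonneg)
  interpret finite_measure \<rho> by fact
  let ?S = "\<integral>\<^sup>+u. decay u \<partial>count_space (int_lattice D)"
  have S: "?S < \<infinity>"
    using abs_summable_on_decay[OF D] unfolding Infinite_Set_Sum.abs_summable_on_def
    by (subst (asm) integrable_iff_bounded) simp
  have "(\<integral>\<^sup>+x. decay x \<partial>convolution \<rho> (delta_set (int_lattice D))) =
    (\<integral>\<^sup>+x. \<integral>\<^sup>+u. decay (x + u) \<partial>count_space (int_lattice D) \<partial>\<rho>)"
    using countable_int_lattice[OF D] assms(3) by (rule nn_integral_convolution_delta_set) simp
  also have "\<dots> \<le> (\<integral>\<^sup>+x. ennreal ((1 + R) ^ (2 * CARD('n))) * ?S \<partial>\<rho>)"
  proof (rule nn_integral_mono_AE, use AE in eventually_elim)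
    fix x :: "real ^ 'n" assume x: "norm x \<le> R"
    have "(\<integral>\<^sup>+u. decay (x + u) \<partial>count_space (int_lattice D)) \<le>
      (\<integral>\<^sup>+u. ennreal ((1 + R) ^ (2 * CARD('n))) * ennreal (decay u) \<partial>count_space (int_lattice D))"
    proof (intro nn_integral_mono)
      fix u :: "real ^ 'n"
      have "decay (x + u) \<le> (1 + norm x) ^ (2 * CARD('n)) * decay u"
        using decay_shift[of u x] by (simp add: add.commute)
      also have "\<dots> \<le> (1 + R) ^ (2 * CARD('n)) * decay u"
        using x by (intro mult_right_mono power_mono) auto
      finally show "ennreal (decay (x + u)) \<le> ennreal ((1 + R) ^ (2 * CARD('n))) * ennreal (decay u)"
        using x by (subst ennreal_mult[symmetric]) (auto intro: order_trans[OF norm_ge_zero])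
    qed
    also have "\<dots> = ennreal ((1 + R) ^ (2 * CARD('n))) * ?S" by (rule nn_integral_cmult) simp
    finally show "(\<integral>\<^sup>+u. decay (x + u) \<partial>count_space (int_lattice D)) \<le> ennreal ((1 + R) ^ (2 * CARD('n))) * ?S" .
  qed
  also have "\<dots> < \<infinity>" using S by (auto simp: ennreal_mult_less_top emeasure_eq_measure)
  finally show "(\<integral>\<^sup>+x. decay x \<partial>convolution \<rho> (delta_set (int_lattice D))) < \<infinity>" .
qed auto

lemma finite_lborel_cell:
  fixes D :: "real ^ 'n \<Rightarrow> real ^ 'n"
  assumes D: "linear D" "bij D"
  shows "finite_measure (density lborel (indicator (cell D)))"
proof
  show "emeasure (density lborel (indicator (cell D))) (space (density lborel (indicator (cell D)))) \<noteq> \<infinity>"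
    using emeasure_cell(3)[OF D] cell_measurable[OF D(1)] by (simp add: emeasure_density)
qed

lemma AE_density_cell:
  fixes D :: "real ^ 'n \<Rightarrow> real ^ 'n"
  assumes D: "linear D" and [measurable]: "f \<in> borel_measurable borel"
  shows "AE x in density lborel (\<lambda>x. indicator (cell D) x * f x). x \<in> cell D"
  using cell_measurable[OF D] by (subst AE_density) (auto simp: indicator_def)

lemma AE_lborel_cell:
  fixes D :: "real ^ 'n \<Rightarrow> real ^ 'n"
  assumes D: "linear D"
  shows "AE x in density lborel (indicator (cell D)). x \<in> cell D"
  using cell_measurable[OF D] by (subst AE_density) (auto simp: indicator_def)

lemma cell_norm_bound:
  fixes D :: "real ^ 'n \<Rightarrow> real ^ 'n"
  assumes "linear D" "bij D"
  obtains R where "0 < R" "\<And>x. x \<in> cell D \<Longrightarrow> norm x < R"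
  using bounded_cell[OF assms] by (metis bounded_pos_less)

text \<open>Lebesgue measure is the convolution of the unit cube with the comb of the integer
  lattice, so summability over that lattice already implies integrability over the space.\<close>

lemma integrable_decay: "integrable lborel (decay :: real ^ 'n \<Rightarrow> real)"
proof -
  define D :: "real ^ 'n \<Rightarrow> real ^ 'n" where "D = id"
  have D: "linear D" "bij D" by (auto simp: D_def linear_id)
  obtain R where R: "\<And>x. x \<in> cell D \<Longrightarrow> norm x < R" using cell_norm_bound[OF D] by metis
  have "AE x in density lborel (indicator (cell D)). norm x \<le> R"
    using AE_lborel_cell[OF D(1)] by eventually_elim (simp add: R less_imp_le)
  then show ?thesis
    using integrable_decay_convolution[OF D _ finite_lborel_cell[OF D]] lborel_eq_convolution[OF D]
    by (metis sets_density sets_lborel)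
qed

text \<open>Volume comparison: the cells attached to the lattice points in a ball of radius
  \<open>s\<close> are disjoint and stay in the concentric ball of radius \<open>R + s\<close>. The
  quotient of volumes bounds the count, and translation invariance makes it independent of the
  centre.\<close>

lemma count_int_lattice_bound:
  fixes D :: "real ^ 'n \<Rightarrow> real ^ 'n"
  assumes D: "linear D" "bij D"
  obtains C where "C < \<infinity>"
    "\<And>y. emeasure (count_space (int_lattice D)) (int_lattice D \<inter> cball y s) \<le> C"
proof -
  let ?L = "int_lattice D"
  obtain R where R: "0 < R" "\<And>x. x \<in> cell D \<Longrightarrow> norm x < R" using cell_norm_bound[OF D] by metis
  define V where "V = emeasure lborel (cell D)"
  have V: "0 < V" "V < \<infinity>" using emeasure_cell[OF D] by (auto simp: V_def)
  define B where "B = emeasure lborel (cball (0 :: real ^ 'n) (R + s))"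
  have B: "B < \<infinity>" unfolding B_def using emeasure_bounded_finite[OF bounded_cball] by blast
  have "emeasure (count_space ?L) (?L \<inter> cball y s) \<le> B / V" for y
  proof -
    have "V * emeasure (count_space ?L) (?L \<inter> cball y s) =
       (\<integral>\<^sup>+x. emeasure (count_space ?L) (?L \<inter> cball y s) \<partial>density lborel (indicator (cell D)))"
      using cell_measurable[OF D(1)] by (simp add: emeasure_density V_def mult.commute)
    also have "\<dots> \<le> (\<integral>\<^sup>+x. emeasure (count_space ?L) {u \<in> ?L. x + u \<in> cball y (R + s)} \<partial>density lborel (indicator (cell D)))"
    proof (rule nn_integral_mono_AE)
      show "AE x in density lborel (indicator (cell D)). emeasure (count_space ?L) (?L \<inter> cball y s) \<le> emeasure (count_space ?L) {u \<in> ?L. x + u \<in> cball y (R + s)}"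
        using AE_lborel_cell[OF D(1)]
      proof eventually_elim
        fix x assume "x \<in> cell D"
        then have "norm x < R" by (rule R)
        then show "emeasure (count_space ?L) (?L \<inter> cball y s) \<le> emeasure (count_space ?L) {u \<in> ?L. x + u \<in> cball y (R + s)}"
        proof (intro emeasure_mono)
          show "?L \<inter> cball y s \<subseteq> {u \<in> ?L. x + u \<in> cball y (R + s)}"
          proof safe
            fix u assume "u \<in> cball y s"
            then have "norm (y - u) \<le> s" by (simp add: dist_norm)
            moreover have "norm (y - (x + u)) \<le> norm (y - u) + norm x"
              using norm_triangle_ineq4[of "y - u" x] by (simp add: algebra_simps)
            ultimately show "x + u \<in> cball y (R + s)" using \<open>norm x < R\<close> by (simp add: dist_norm)
          qed
        qed auto
      qed
    qed
    \<comment> \<open>Reading the Lebesgue measure of the larger ball as a convolution turns the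
      average of the counts over the cell into a volume.\<close>
    also have "\<dots> = emeasure (lborel :: (real ^ 'n) measure) (cball y (R + s))"
      by (subst (2) lborel_eq_convolution[OF D], subst emeasure_convolution_delta_set)
         (auto simp: countable_int_lattice[OF D])
    also have "\<dots> = emeasure (distr lborel borel ((+) y)) (cball y (R + s))"
      by (simp add: lborel_distr_plus)
    also have "\<dots> = B"
      unfolding B_def by (subst emeasure_distr) (auto intro!: arg_cong[where f = "emeasure lborel"] simp: dist_norm)
    finally have "V * emeasure (count_space ?L) (?L \<inter> cball y s) \<le> B" .
    then show ?thesis using V
      by (metis divide_right_mono_ennreal ennreal_mult_divide_eq infinity_ennreal_def less_irrefl mult.commute)
  qed
  moreover have "B / V < \<infinity>" using B V by (auto simp: less_top[symmetric] ennreal_divide_eq_top_iff)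
  ultimately show ?thesis using that by blast
qed

lemma finite_int_lattice_cball:
  fixes D :: "real ^ 'n \<Rightarrow> real ^ 'n"
  assumes D: "linear D" "bij D"
  shows "finite (int_lattice D \<inter> cball y s)"
proof (rule ccontr)
  assume "infinite (int_lattice D \<inter> cball y s)"
  then have "emeasure (count_space (int_lattice D)) (int_lattice D \<inter> cball y s) = \<infinity>"
    by (subst emeasure_count_space_infinite) auto
  then show False using count_int_lattice_bound[OF D, of s] by (metis less_le_not_le)
qed

text \<open>The comb shifted by k meets \<open>x + K\<close> in no more points than the lattice has
  in a ball around x - k, and that count has a bound independent of the centre.\<close>

lemma translation_bounded_convolution:
  fixes D :: "real ^ 'n \<Rightarrow> real ^ 'n" and \<rho> :: "(real ^ 'n) measure"
  assumes D: "linear D" "bij D" and [measurable_cong]: "sets \<rho> = sets borel" and "finite_measure \<rho>"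
  shows "translation_bounded (convolution \<rho> (delta_set (int_lattice D)))"
  unfolding translation_bounded_def
proof (intro allI impI)
  fix K :: "(real ^ 'n) set" assume K: "compact K"
  let ?L = "int_lattice D"
  interpret finite_measure \<rho> by fact
  obtain s where s: "K \<subseteq> cball 0 s"
    using compact_imp_bounded[OF K] by (auto simp: bounded_iff subset_iff)
  obtain C where C: "C < \<infinity>" "\<And>y. emeasure (count_space ?L) (?L \<inter> cball y s) \<le> C"
    using count_int_lattice_bound[OF D, of s] by metis
  have "emeasure (convolution \<rho> (delta_set ?L)) ((+) x ` K) \<le> C * emeasure \<rho> (space \<rho>)" for x
  proof -
    have [measurable]: "(+) x ` K \<in> sets borel"
      using compact_translation[OF K, of x] by (simp add: borel_compact)
    have "emeasure (convolution \<rho> (delta_set ?L)) ((+) x ` K) =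
      (\<integral>\<^sup>+k. emeasure (count_space ?L) {u \<in> ?L. k + u \<in> (+) x ` K} \<partial>\<rho>)"
      by (intro emeasure_convolution_delta_set countable_int_lattice[OF D] assms(3)) auto
    also have "\<dots> \<le> (\<integral>\<^sup>+k. C \<partial>\<rho>)"
    proof (intro nn_integral_mono)
      fix k
      have "emeasure (count_space ?L) {u \<in> ?L. k + u \<in> (+) x ` K} \<le> emeasure (count_space ?L) (?L \<inter> cball (x - k) s)"
      proof (intro emeasure_mono)
        show "{u \<in> ?L. k + u \<in> (+) x ` K} \<subseteq> ?L \<inter> cball (x - k) s"
        proof safe
          fix u y assume "y \<in> K" "k + u = x + y"
          then have "u = x - k + y" "norm y \<le> s" using s by (auto simp: algebra_simps eq_diff_eq)
          then show "u \<in> cball (x - k) s" by (simp add: dist_norm)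
        qed
      qed auto
      also have "\<dots> \<le> C" by (rule C)
      finally show "emeasure (count_space ?L) {u \<in> ?L. k + u \<in> (+) x ` K} \<le> C" .
    qed
    finally show ?thesis by simp
  qed
  then have "(SUP x. emeasure (convolution \<rho> (delta_set ?L)) ((+) x ` K)) \<le> C * emeasure \<rho> (space \<rho>)"
    by (intro SUP_least)
  also have "\<dots> < \<infinity>" using C(1) by (simp add: ennreal_mult_less_top emeasure_eq_measure)
  finally show "(SUP x. emeasure (convolution \<rho> (delta_set ?L)) ((+) x ` K)) < \<infinity>" .
qed

lemma positive_measure_if_translation_bounded:
  assumes "translation_bounded M" "sets M = sets borel"
  shows "positive_measure M"
  unfolding positive_measure_def
proof (intro conjI allI impI)
  fix K :: "'a set" assume "compact K"
  then have "(SUP x. emeasure M ((+) x ` K)) < \<infinity>" using assms(1) by (simp add: translation_bounded_def)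
  moreover have "emeasure M K \<le> (SUP x. emeasure M ((+) x ` K))"
    by (rule SUP_upper2[of 0]) auto
  ultimately show "emeasure M K < \<infinity>" by (rule le_less_trans[rotated])
qed (rule assms(2))

text \<open>Translation by a lattice vector permutes the points of the comb.\<close>

lemma periodic_convolution:
  fixes D :: "real ^ 'n \<Rightarrow> real ^ 'n" and \<rho> :: "(real ^ 'n) measure"
  assumes D: "linear D" "bij D" and [measurable_cong]: "sets \<rho> = sets borel"
  shows "periodic (convolution \<rho> (delta_set (int_lattice D))) (int_lattice D)"
  unfolding periodic_def
proof
  let ?L = "int_lattice D"
  fix v assume v: "v \<in> ?L"
  note nn = nn_integral_convolution_delta_set[OF countable_int_lattice[OF D] assms(3)]
  show "distr (convolution \<rho> (delta_set ?L)) borel ((+) v) = convolution \<rho> (delta_set ?L)"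
  proof (rule measure_eqI)
    fix A assume "A \<in> sets (distr (convolution \<rho> (delta_set ?L)) borel ((+) v))"
    then have [measurable]: "A \<in> sets borel" by simp
    have "emeasure (distr (convolution \<rho> (delta_set ?L)) borel ((+) v)) A =
      (\<integral>\<^sup>+x. indicator A (v + x) \<partial>convolution \<rho> (delta_set ?L))"
      by (subst nn_integral_indicator[symmetric]) (simp, subst nn_integral_distr, auto)
    also have "\<dots> = (\<integral>\<^sup>+x. \<integral>\<^sup>+u. indicator A (v + (x + u)) \<partial>count_space ?L \<partial>\<rho>)"
      by (rule nn) simp
    also have "\<dots> = (\<integral>\<^sup>+x. \<integral>\<^sup>+u. indicator A (x + (u + v)) \<partial>count_space ?L \<partial>\<rho>)"
      by (simp add: ac_simps)
    also have "\<dots> = (\<integral>\<^sup>+x. \<integral>\<^sup>+u. indicator A (x + u) \<partial>count_space ?L \<partial>\<rho>)"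
      by (intro nn_integral_cong nn_integral_bij_count_space bij_betw_translate_int_lattice D v)
    also have "\<dots> = (\<integral>\<^sup>+x. indicator A x \<partial>convolution \<rho> (delta_set ?L))"
      by (rule nn[symmetric]) simp
    also have "\<dots> = emeasure (convolution \<rho> (delta_set ?L)) A" by simp
    finally show "emeasure (distr (convolution \<rho> (delta_set ?L)) borel ((+) v)) A = emeasure (convolution \<rho> (delta_set ?L)) A" .
  qed simp
qed

section \<open>Weak compactness on the torus\<close>

text \<open>A continuous function of period 2 that is 0 on [0, 1/3] and 1 on [2/3, 1]. Clipping a
  cosine provides continuity and periodicity at once.\<close>

definition tent :: "real \<Rightarrow> real" where
  "tent y = max 0 (min 1 (1 / 2 - cos (pi * y)))"

lemma tent_range: "0 \<le> tent y" "tent y \<le> 1"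
  by (auto simp: tent_def)

lemma tent_periodic: "tent (y + 2 * real n) = tent y"
proof -
  have "cos (pi * (y + 2 * real n)) = cos (pi * y + 2 * real n * pi)" by (simp add: algebra_simps)
  also have "\<dots> = cos (pi * y)" by (simp add: cos_add)
  finally show ?thesis by (simp add: tent_def)
qed

lemma tent_0: "0 \<le> y \<Longrightarrow> y \<le> 1 / 3 \<Longrightarrow> tent y = 0"
  using cos_monotone_0_pi_le[of "pi * y" "pi / 3"] by (simp add: tent_def cos_60)

lemma tent_1:
  assumes "2 / 3 \<le> y" "y \<le> 1"
  shows "tent y = 1"
proof -
  have "cos (pi - pi / 3) = - 1 / 2" by (simp only: cos_pi_minus cos_60)
  moreover have "cos (pi * y) \<le> cos (pi - pi / 3)"
    using assms mult_left_mono[of "2 / 3" y pi] by (intro cos_monotone_0_pi_le) (auto simp: algebra_simps)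
  ultimately show ?thesis by (simp add: tent_def)
qed

text \<open>For a sequence of zeros and ones this is a point of the Cantor set. Its ternary digits
  are 0 or 2, and the gap left by the digit 1 is where \<open>tent\<close> passes continuously from
  0 to 1.\<close>

definition ternary :: "(nat \<Rightarrow> real) \<Rightarrow> real" where
  "ternary a = (\<Sum>m. 2 * a m / 3 ^ Suc m)"

lemma ternary_sums: "(\<lambda>m. 2 / 3 ^ Suc m :: real) sums 1"
  using sums_mult[OF geometric_sums[of "1 / 3 :: real"], of "2 / 3"] by (simp add: field_simps)

lemma ternary_summable:
  assumes "\<And>m. a m \<in> {0, 1 :: real}"
  shows "summable (\<lambda>m. 2 * a m / 3 ^ Suc m)"
proof (rule summable_comparison_test'[OF sums_summable[OF ternary_sums]])
  fix m show "norm (2 * a m / 3 ^ Suc m) \<le> 2 / 3 ^ Suc m" using assms[of m] by auto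
qed

lemma ternary_range:
  assumes "\<And>m. a m \<in> {0, 1 :: real}"
  shows "0 \<le> ternary a" "ternary a \<le> 1"
proof -
  show "0 \<le> ternary a" unfolding ternary_def
  proof (rule suminf_nonneg[OF ternary_summable[OF assms]])
    fix m show "0 \<le> 2 * a m / 3 ^ Suc m" using assms[of m] by auto
  qed
  have "ternary a \<le> (\<Sum>m. 2 / 3 ^ Suc m)" unfolding ternary_def
  proof (rule suminf_le[OF _ ternary_summable[OF assms] sums_summable[OF ternary_sums]])
    fix m show "2 * a m / 3 ^ Suc m \<le> 2 / 3 ^ Suc m" using assms[of m] by auto
  qed
  then show "ternary a \<le> 1" using ternary_sums by (simp add: sums_iff)
qed

text \<open>Multiplication by 3 shifts the digits by one place. The digit that leaves the fraction
  is 0 or 2, a multiple of the period of \<open>tent\<close>.\<close>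

lemma ternary_Suc:
  assumes "\<And>m. a m \<in> {0, 1 :: real}"
  shows "3 * ternary a = 2 * a 0 + ternary (\<lambda>m. a (Suc m))"
proof -
  have "ternary a = 2 * a 0 / 3 + (\<Sum>m. 2 * a (Suc m) / 3 ^ Suc (Suc m))"
    unfolding ternary_def using suminf_split_head[OF ternary_summable[of a]] assms by simp
  also have "(\<Sum>m. 2 * a (Suc m) / 3 ^ Suc (Suc m)) = (\<Sum>m. (1 / 3) * (2 * a (Suc m) / 3 ^ Suc m))"
    by simp
  also have "\<dots> = ternary (\<lambda>m. a (Suc m)) / 3"
    unfolding ternary_def using suminf_mult[OF ternary_summable[of "\<lambda>m. a (Suc m)"], of "1 / 3"] assms by simp
  finally show ?thesis by simp
qed

text \<open>Schoenberg's decoding: the tent function reads off the ternary digits of a Cantor point.\<close>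

lemma tent_ternary:
  assumes "\<And>m. a m \<in> {0, 1 :: real}"
  shows "tent (3 ^ m * ternary a) = a m"
  using assms
proof (induction m arbitrary: a)
  case 0
  have "0 \<le> ternary (\<lambda>m. a (Suc m))" "ternary (\<lambda>m. a (Suc m)) \<le> 1"
    using ternary_range[of "\<lambda>m. a (Suc m)"] 0 by auto
  moreover have "3 * ternary a = 2 * a 0 + ternary (\<lambda>m. a (Suc m))" using 0 by (rule ternary_Suc)
  moreover have "a 0 = 0 \<or> a 0 = 1" using 0[of 0] by auto
  ultimately show ?case by (auto intro!: tent_0 tent_1)
next
  case (Suc m)
  have "3 ^ Suc m * ternary a = 3 ^ m * (2 * a 0 + ternary (\<lambda>m. a (Suc m)))"
    using ternary_Suc[of a] Suc.prems by simp
  moreover have "a 0 = 0 \<or> a 0 = 1" using Suc.prems[of 0] by auto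
  \<comment> \<open>The integer part 3^m * 2 * a 0 that is dropped here is either 0 or 3^m whole
    periods.\<close>
  ultimately have "tent (3 ^ Suc m * ternary a) = tent (3 ^ m * ternary (\<lambda>m. a (Suc m)))"
    using tent_periodic[of "3 ^ m * ternary (\<lambda>m. a (Suc m))" "3 ^ m"] by (auto simp: algebra_simps)
  also have "\<dots> = a (Suc m)" using Suc.prems by (intro Suc.IH) auto
  finally show ?case .
qed

definition binary_digit :: "nat \<Rightarrow> real \<Rightarrow> real" where
  "binary_digit k x = of_int (\<lfloor>2 ^ Suc k * x\<rfloor> - 2 * \<lfloor>2 ^ k * x\<rfloor>)"

lemma binary_digit_in: "binary_digit k x \<in> {0, 1}"
proof -
  have "\<lfloor>2 * y\<rfloor> - 2 * \<lfloor>y\<rfloor> \<in> {0, 1}" for y :: real by simp linarith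
  from this[of "2 ^ k * x"] show ?thesis by (auto simp: binary_digit_def mult.assoc)
qed

lemma binary_digit_measurable [measurable]: "binary_digit k \<in> borel_measurable borel"
  unfolding binary_digit_def[abs_def] by measurable

text \<open>The partial sums telescope to the truncations floor(2^N x) / 2^N, which differ from x by
  at most 2^(-N).\<close>

lemma binary_digit_sums:
  assumes "0 \<le> x" "x < 1"
  shows "(\<lambda>k. binary_digit k x / 2 ^ Suc k) sums x"
proof -
  have part: "(\<Sum>k<N. binary_digit k x / 2 ^ Suc k) = of_int \<lfloor>2 ^ N * x\<rfloor> / 2 ^ N" for N
  proof (induction N)
    \<comment> \<open>The empty sum must equal the integer part of x; this is where 0 \<le> x < 1
      enters.\<close>
    case 0
    then show ?case using assms by (simp add: floor_eq_iff)
  next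
    case (Suc N)
    then show ?case by (simp add: binary_digit_def field_simps)
  qed
  have "(\<lambda>N. of_int \<lfloor>2 ^ N * x\<rfloor> / 2 ^ N) \<longlonglongrightarrow> x"
  proof (rule real_tendsto_sandwich[of "\<lambda>N. x - (1 / 2) ^ N" _ _ "\<lambda>N. x"])
    show "\<forall>\<^sub>F N in sequentially. x - (1 / 2) ^ N \<le> of_int \<lfloor>2 ^ N * x\<rfloor> / 2 ^ N"
    proof (rule always_eventually, rule allI)
      fix N :: nat
      have "2 ^ N * x - 1 \<le> of_int \<lfloor>2 ^ N * x\<rfloor>" by linarith
      then have "(2 ^ N * x - 1) / 2 ^ N \<le> of_int \<lfloor>2 ^ N * x\<rfloor> / 2 ^ N" by (rule divide_right_mono) simp
      then show "x - (1 / 2) ^ N \<le> of_int \<lfloor>2 ^ N * x\<rfloor> / 2 ^ N" by (simp add: diff_divide_distrib power_divide)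
    qed
    show "\<forall>\<^sub>F N in sequentially. of_int \<lfloor>2 ^ N * x\<rfloor> / 2 ^ N \<le> x"
      by (rule always_eventually, rule allI) (simp add: field_simps)
    have "(\<lambda>N. x - (1 / 2) ^ N) \<longlonglongrightarrow> x - 0" by (intro tendsto_intros LIMSEQ_power_zero) auto
    then show "(\<lambda>N. x - (1 / 2) ^ N) \<longlonglongrightarrow> x" by simp
  qed simp
  then show ?thesis unfolding sums_def part .
qed

text \<open>The binary digits of all coordinates are interleaved into the digits of one Cantor
  point. Binary digits jump, so this map is merely Borel, but \<open>cantor_decode\<close>, its left
  inverse on the half-open unit cube, is continuous, and test functions are pulled back along the
  latter.\<close>

definition cantor_encode :: "real ^ 'n \<Rightarrow> real" where
  "cantor_encode x = ternary (\<lambda>m. case from_nat m of (i :: 'n, k) \<Rightarrow> binary_digit k (x $ i))"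

definition cantor_decode :: "real \<Rightarrow> real ^ 'n" where
  "cantor_decode y = (\<chi> i. \<Sum>k. tent (3 ^ to_nat (i, k) * y) / 2 ^ Suc k)"

lemma cantor_encode_range: "0 \<le> cantor_encode x" "cantor_encode x \<le> 1"
  unfolding cantor_encode_def
  by (rule ternary_range, use binary_digit_in in \<open>auto split: prod.split\<close>)+

lemma cantor_encode_measurable [measurable]: "cantor_encode \<in> borel_measurable borel"
proof -
  have [measurable]: "(\<lambda>x :: real ^ 'n. x $ i) \<in> borel_measurable borel" for i
    unfolding cart_eq_inner_axis by measurable
  have [measurable]: "(\<lambda>x :: real ^ 'n. case from_nat m of (i :: 'n, k) \<Rightarrow> binary_digit k (x $ i)) \<in> borel_measurable borel" for m
    by (cases "from_nat m :: 'n \<times> nat") simp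
  show ?thesis unfolding cantor_encode_def[abs_def] ternary_def by measurable
qed

lemma cantor_decode_encode:
  assumes "\<And>i. 0 \<le> x $ i" "\<And>i. x $ i < 1"
  shows "cantor_decode (cantor_encode x) = x"
proof -
  have "tent (3 ^ to_nat (i, k) * cantor_encode x) = binary_digit k (x $ i)" for i k
    unfolding cantor_encode_def
    by (subst tent_ternary) (use binary_digit_in in \<open>auto split: prod.split\<close>)
  then show ?thesis
    using binary_digit_sums[OF assms] by (simp add: cantor_decode_def vec_eq_iff sums_iff)
qed

text \<open>Each summand is continuous, and the geometric majorant 2^(-k-1) makes the convergence
  uniform.\<close>

lemma continuous_cantor_decode: "continuous_on UNIV (cantor_decode :: real \<Rightarrow> real ^ 'n)"
proof -
  have "continuous_on UNIV (\<lambda>y. \<Sum>k. tent (3 ^ to_nat (i :: 'n, k) * y) / 2 ^ Suc k)" for i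
  proof (rule uniform_limit_theorem)
    have s: "summable (\<lambda>k. 1 / 2 ^ Suc k :: real)" using sums_summable[OF power_half_series] by (simp add: power_one_over divide_simps)
    show "uniform_limit UNIV (\<lambda>N y. \<Sum>k<N. tent (3 ^ to_nat (i, k) * y) / 2 ^ Suc k)
      (\<lambda>y. \<Sum>k. tent (3 ^ to_nat (i, k) * y) / 2 ^ Suc k) sequentially"
      using tent_range by (intro Weierstrass_m_test[OF _ s]) (auto intro!: divide_right_mono)
    show "\<forall>\<^sub>F N in sequentially. continuous_on UNIV (\<lambda>y. \<Sum>k<N. tent (3 ^ to_nat (i, k) * y) / 2 ^ Suc k)"
      unfolding tent_def by (intro always_eventually allI continuous_intros) auto
  qed auto
  then show ?thesis unfolding cantor_decode_def by (intro continuous_on_vec_lambda)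
qed

definition cell_rep :: "(real ^ 'n \<Rightarrow> real ^ 'n) \<Rightarrow> real ^ 'n \<Rightarrow> real ^ 'n" where
  "cell_rep D x = x - cell_shift D x"

lemma cell_rep_in_cell: "linear D \<Longrightarrow> bij D \<Longrightarrow> cell_rep D x \<in> cell D"
  by (simp add: cell_rep_def cell_shift_iff cell_shift_in)

lemma periodic_cell_rep:
  assumes "bij D" "\<And>x u. u \<in> int_lattice D \<Longrightarrow> F (x + u) = F x"
  shows "F (cell_rep D x) = F x"
  using assms(2)[OF cell_shift_in[OF assms(1), of x], of "cell_rep D x"] by (simp add: cell_rep_def)

text \<open>Every value is already taken on the compact closure of one cell.\<close>

lemma periodic_continuous_bounded:
  fixes F :: "real ^ 'n \<Rightarrow> complex"
  assumes D: "linear D" "bij D" and F: "continuous_on UNIV F"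
    and per: "\<And>x u. u \<in> int_lattice D \<Longrightarrow> F (x + u) = F x"
  obtains B where "\<And>x. norm (F x) \<le> B"
proof -
  have "compact (closure (cell D))" using bounded_cell[OF D] by simp
  then have "compact (F ` closure (cell D))"
    by (rule compact_continuous_image[OF continuous_on_subset[OF F subset_UNIV]])
  then obtain B where B: "\<And>x. x \<in> closure (cell D) \<Longrightarrow> norm (F x) \<le> B"
    using compact_imp_bounded by (force simp: bounded_iff)
  have "norm (F x) \<le> B" for x
    using B[of "cell_rep D x"] cell_rep_in_cell[OF D, of x] closure_subset[of "cell D"]
      periodic_cell_rep[of D F, OF D(2) per] by auto
  then show ?thesis using that by blast
qed

text \<open>
  A bounded sequence of measures on the torus has a weakly convergent subsequence. Encoding the
  torus Borel-measurably into the Cantor set, with a continuous left inverse, reduces this to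
  Helly's selection theorem on the real line.
\<close>

lemma weak_compactness_cell:
  fixes M :: "nat \<Rightarrow> (real ^ 'n) measure"
  assumes D: "linear D" "bij D"
    and fin: "\<And>i. finite_measure (M i)" and sets: "\<And>i. sets (M i) = sets borel"
    and AE: "\<And>i. AE x in M i. x \<in> cell D"
    and mass: "(\<lambda>i. measure (M i) UNIV) \<longlonglongrightarrow> m"
  obtains s \<rho> where "strict_mono (s :: nat \<Rightarrow> nat)" "finite_measure \<rho>" "sets \<rho> = sets borel"
    "AE x in \<rho>. x \<in> cell D"
    "\<And>F :: real ^ 'n \<Rightarrow> complex. continuous_on UNIV F \<Longrightarrow> (\<And>x u. u \<in> int_lattice D \<Longrightarrow> F (x + u) = F x) \<Longrightarrow>
      (\<lambda>i. \<integral>x. F x \<partial>M (s i)) \<longlonglongrightarrow> (\<integral>x. F x \<partial>\<rho>)"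
proof (cases "m = 0")
  \<comment> \<open>Limit mass 0 rules out normalisation to probability measures. Here all integrals
    tend to 0, so the null measure is the limit.\<close>
  case True
  show ?thesis
  proof (rule that[of id "null_measure borel"])
    show "finite_measure (null_measure borel :: (real ^ 'n) measure)" by (intro finite_measureI) simp
    show "AE x in null_measure borel. x \<in> cell D" by (auto simp: ae_filter_def null_sets_def eventually_ae_filter)
    fix F :: "real ^ 'n \<Rightarrow> complex" assume F: "continuous_on UNIV F" "\<And>x u. u \<in> int_lattice D \<Longrightarrow> F (x + u) = F x"
    obtain B where B: "\<And>x. norm (F x) \<le> B" using periodic_continuous_bounded[OF D F] by metis
    have "norm (\<integral>x. F x \<partial>M i) \<le> measure (M i) UNIV * B" for i
    proof -
      interpret finite_measure "M i" by (rule fin)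
      have "integrable (M i) F" using borel_measurable_continuous_onI[OF F(1)] B sets[of i]
        by (intro integrable_const_bound[of _ B]) (auto cong: measurable_cong_sets)
      then have "norm (\<integral>x. F x \<partial>M i) \<le> (\<integral>x. B \<partial>M i)"
        using B by (intro Bochner_Integration.integral_norm_bound_integral) auto
      then show ?thesis using sets_eq_imp_space_eq[OF sets[of i]] by simp
    qed
    moreover have "(\<lambda>i. measure (M i) UNIV * B) \<longlonglongrightarrow> 0"
      using tendsto_mult_right[OF mass, of B] True by simp
    ultimately have "(\<lambda>i. \<integral>x. F x \<partial>M i) \<longlonglongrightarrow> 0"
      by (rule Lim_null_comparison[OF always_eventually, OF allI])
    then show "(\<lambda>i. \<integral>x. F x \<partial>M (id i)) \<longlonglongrightarrow> (\<integral>x. F x \<partial>null_measure borel)" by simp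
  qed (auto simp: strict_mono_def)
next
  case False
  have "0 \<le> m" by (rule LIMSEQ_le_const[OF mass]) auto
  then have m: "0 < m" using False by simp
  \<comment> \<open>Finitely many initial measures may vanish; they are skipped so that the
    remaining ones can be normalised.\<close>
  obtain N where N: "\<And>i. i \<ge> N \<Longrightarrow> 0 < measure (M i) UNIV"
    using order_tendstoD(1)[OF mass m] by (auto simp: eventually_sequentially)
  have [measurable]: "D \<in> borel_measurable borel"
    using D(1) by (intro borel_measurable_continuous_onI linear_continuous_on) (simp add: linear_conv_bounded_linear)
  have cont_inv: "continuous_on UNIV (inv D)"
    using linear_inv(1)[OF D] by (intro linear_continuous_on) (simp add: linear_conv_bounded_linear)
  define c where "c i = 1 / measure (M (i + N)) UNIV" for i
  have c: "0 < c i" for i using N[of "i + N"] by (simp add: c_def)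
  define E where "E x = cantor_encode (D x)" for x
  have [measurable]: "E \<in> borel_measurable borel" unfolding E_def[abs_def] by measurable
  define \<mu> where "\<mu> i = distr (density (M (i + N)) (\<lambda>_. ennreal (c i))) borel E" for i
  note [measurable_cong] = sets
  have sp: "space (M i) = UNIV" for i using sets_eq_imp_space_eq[OF sets[of i]] by simp
  have \<mu>_space: "emeasure (\<mu> i) A = 1" if "{0..1} \<subseteq> A" "A \<in> sets borel" for i A
  proof -
    interpret finite_measure "M (i + N)" by (rule fin)
    have "E -` A = UNIV" using that(1) by (auto simp: E_def subset_iff cantor_encode_range)
    then have "emeasure (\<mu> i) A = ennreal (c i) * emeasure (M (i + N)) UNIV"
      using that(2) sets.top[of "M (i + N)"]
      by (simp add: \<mu>_def emeasure_distr emeasure_density sp nn_integral_cmult)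
    also have "\<dots> = ennreal (c i * measure (M (i + N)) UNIV)"
      using c[of i] by (simp add: emeasure_eq_measure ennreal_mult'')
    also have "c i * measure (M (i + N)) UNIV = 1" using N[of "i + N"] by (simp add: c_def)
    finally show ?thesis by simp
  qed
  have rd: "real_distribution (\<mu> i)" for i
    by (intro real_distribution.intro prob_spaceI real_distribution_axioms.intro) (auto simp: \<mu>_def[of i, THEN arg_cong[where f = space]] \<mu>_def[of i, THEN arg_cong[where f = sets]] \<mu>_space)
  \<comment> \<open>Tightness is automatic, since all the image measures live on [0, 1].\<close>
  have "tight \<mu>" unfolding tight_def
  proof (intro conjI allI impI rd)
    fix \<epsilon> :: real assume "0 < \<epsilon>"
    then show "\<exists>a b. a < b \<and> (\<forall>n. 1 - \<epsilon> < measure (\<mu> n) {a<..b})"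
      by (intro exI[of _ "-1"] exI[of _ 1]) (auto simp: measure_def \<mu>_space subset_iff)
  qed
  then obtain s \<nu> where s: "strict_mono (s :: nat \<Rightarrow> nat)" "real_distribution \<nu>" "weak_conv_m (\<mu> \<circ> id \<circ> s) \<nu>"
    using tight_imp_convergent_subsubsequence[of \<mu> id] by (auto simp: strict_mono_def)
  interpret \<nu>: real_distribution \<nu> by fact
  \<comment> \<open>The limit law may charge the faces missing from the half-open cell, and
    \<open>cell_rep\<close> moves that mass back. \<open>S\<close> need not be continuous, but a
    periodic \<open>F\<close> takes the same value at \<open>S y\<close> as at
    \<open>inv D (cantor_decode y)\<close>, which depends continuously on \<open>y\<close>.\<close>
  define S where "S y = cell_rep D (inv D (cantor_decode y))" for y
  have [measurable]: "(\<lambda>y. inv D (cantor_decode y)) \<in> borel_measurable borel"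
    by (intro borel_measurable_continuous_onI continuous_on_compose2[OF cont_inv] continuous_cantor_decode) auto
  have [measurable]: "S \<in> borel_measurable borel"
    using cell_shift_measurable[OF D] unfolding S_def[abs_def] cell_rep_def by measurable
  define \<rho> where "\<rho> = distr (density \<nu> (\<lambda>_. ennreal m)) borel S"
  show ?thesis
  proof (rule that[of "\<lambda>i. s i + N" \<rho>])
    show "strict_mono (\<lambda>i. s i + N)" using s(1) by (auto simp: strict_mono_def)
    show "finite_measure \<rho>" unfolding \<rho>_def
      by (intro finite_measure.finite_measure_distr finite_measureI) (auto simp: emeasure_density nn_integral_cmult ennreal_mult_eq_top_iff)
    show "sets \<rho> = sets borel" by (simp add: \<rho>_def)
    show "AE x in \<rho>. x \<in> cell D"
      unfolding \<rho>_def using cell_measurable[OF D(1)] cell_rep_in_cell[OF D]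
      by (subst AE_distr_iff) (auto simp: S_def)
    fix F :: "real ^ 'n \<Rightarrow> complex" assume F: "continuous_on UNIV F" "\<And>x u. u \<in> int_lattice D \<Longrightarrow> F (x + u) = F x"
    obtain B where B: "\<And>x. norm (F x) \<le> B" using periodic_continuous_bounded[OF D F] by metis
    have [measurable]: "F \<in> borel_measurable borel" using F(1) by (rule borel_measurable_continuous_onI)
    define f where "f y = F (inv D (cantor_decode y))" for y
    have fB: "norm (f y) \<le> B" for y by (simp add: f_def B)
    have f_cont: "continuous_on UNIV f" unfolding f_def[abs_def]
      by (intro continuous_on_compose2[OF F(1)] continuous_on_compose2[OF cont_inv] continuous_cantor_decode) auto
    have [measurable]: "f \<in> borel_measurable borel" using f_cont by (rule borel_measurable_continuous_onI)
    have "(\<lambda>i. integral\<^sup>L ((\<mu> \<circ> id \<circ> s) i) f) \<longlonglongrightarrow> integral\<^sup>L \<nu> f"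
      by (rule weak_conv_imp_integral_bdd_continuous_conv[OF _ s(2,3), of f B])
         (use rd f_cont fB in \<open>auto simp: continuous_on_eq_continuous_at\<close>)
    moreover have "integral\<^sup>L (\<mu> i) f = c i *\<^sub>R (\<integral>x. F x \<partial>M (i + N))" for i
    proof -
      have "integral\<^sup>L (\<mu> i) f = (\<integral>x. c i *\<^sub>R f (E x) \<partial>M (i + N))"
        unfolding \<mu>_def using c[of i] by (subst integral_distr, simp, simp) (subst integral_density, auto)
      also have "\<dots> = (\<integral>x. c i *\<^sub>R F x \<partial>M (i + N))"
      proof (rule integral_cong_AE)
        show "AE x in M (i + N). c i *\<^sub>R f (E x) = c i *\<^sub>R F x"
          using AE[of "i + N"]
        proof eventually_elim
          fix x assume "x \<in> cell D"
          then have "cantor_decode (E x) = D x" unfolding E_def cell_def by (intro cantor_decode_encode) auto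
          then show "c i *\<^sub>R f (E x) = c i *\<^sub>R F x" using D(2) by (simp add: f_def bij_is_inj)
        qed
      qed auto
      finally show ?thesis by simp
    qed
    ultimately have "(\<lambda>i. c (s i) *\<^sub>R (\<integral>x. F x \<partial>M (s i + N))) \<longlonglongrightarrow> integral\<^sup>L \<nu> f" by simp
    moreover have "(\<lambda>i. measure (M (s i + N)) UNIV) \<longlonglongrightarrow> m"
      using LIMSEQ_subseq_LIMSEQ[OF mass, of "\<lambda>i. s i + N"] s(1) by (simp add: strict_mono_def o_def)
    ultimately have "(\<lambda>i. measure (M (s i + N)) UNIV *\<^sub>R c (s i) *\<^sub>R (\<integral>x. F x \<partial>M (s i + N))) \<longlonglongrightarrow> m *\<^sub>R integral\<^sup>L \<nu> f"
      by (intro tendsto_scaleR)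
    moreover have "measure (M (s i + N)) UNIV *\<^sub>R c (s i) *\<^sub>R (\<integral>x. F x \<partial>M (s i + N)) = (\<integral>x. F x \<partial>M (s i + N))" for i
      using N[of "s i + N"] by (simp add: c_def)
    moreover have "(\<integral>x. F x \<partial>\<rho>) = m *\<^sub>R integral\<^sup>L \<nu> f"
    proof -
      have "(\<integral>x. F x \<partial>\<rho>) = (\<integral>y. m *\<^sub>R F (S y) \<partial>\<nu>)"
        unfolding \<rho>_def using m by (subst integral_distr, simp, simp) (subst integral_density, auto)
      also have "\<dots> = (\<integral>y. m *\<^sub>R f y \<partial>\<nu>)"
        using periodic_cell_rep[of D F, OF D(2) F(2)] by (simp add: S_def f_def)
      finally show ?thesis by simp
    qed
    ultimately show "(\<lambda>i. \<integral>x. F x \<partial>M (s i + N)) \<longlonglongrightarrow> (\<integral>x. F x \<partial>\<rho>)" by simp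
  qed
qed

section \<open>Schwartz functions\<close>

lemma fourier_cis: "fourier \<phi> x = (\<integral>y. cis (- 2 * pi * (x \<bullet> y)) * \<phi> y \<partial>lborel)"
  unfolding fourier_def cis_conv_exp by (simp add: algebra_simps)

lemma measurable_cis [measurable]: "cis \<in> borel_measurable borel"
  by (intro borel_measurable_continuous_onI) (auto simp: cis_conv_exp intro!: continuous_intros)

lemma schwartz_iterated_pderiv_le_decay:
  fixes \<phi> :: "real ^ 'n \<Rightarrow> complex"
  assumes "\<phi> \<in> schwartz" "set bs \<subseteq> Basis"
  obtains C where "\<And>x. norm (iterated_pderiv bs \<phi> x) \<le> C * decay x"
proof -
  obtain C where C: "\<And>x. norm ((1 + norm x) ^ (2 * CARD('n)) *\<^sub>R iterated_pderiv bs \<phi> x) \<le> C"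
    using assms unfolding schwartz_def by (force simp: bounded_iff)
  have "norm (iterated_pderiv bs \<phi> x) \<le> C * decay x" for x
    using C[of x] by (simp add: decay_def field_simps zero_less_power add_pos_nonneg)
  then show ?thesis using that by blast
qed

lemma schwartz_le_decay:
  fixes \<phi> :: "real ^ 'n \<Rightarrow> complex"
  assumes "\<phi> \<in> schwartz"
  obtains C where "\<And>x. norm (\<phi> x) \<le> C * decay x"
  using schwartz_iterated_pderiv_le_decay[OF assms, of "[]"] by auto

text \<open>The empty list of derivatives contributes one family of terms to the supremum. The
  supremum is over a bounded set because there are only finitely many lists of basis vectors of
  bounded length.\<close>

lemma schwartz_le_seminorm:
  fixes \<phi> :: "real ^ 'n \<Rightarrow> complex"
  assumes "\<phi> \<in> schwartz"
  shows "norm (\<phi> x) \<le> schwartz_seminorm (2 * CARD('n)) \<phi> * decay x"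
proof -
  let ?m = "2 * CARD('n)"
  let ?g = "\<lambda>(bs, x). (1 + norm x) ^ ?m * norm (iterated_pderiv bs \<phi> x)"
  let ?A = "{bs :: (real ^ 'n) list. set bs \<subseteq> Basis \<and> length bs \<le> ?m}"
  have fin: "finite ?A" by (rule finite_lists_length_le) simp
  have "bdd_above (\<Union>bs\<in>?A. range (\<lambda>x. ?g (bs, x)))"
  proof (subst bdd_above_UN[OF fin], rule ballI)
    fix bs assume "bs \<in> ?A"
    then have "bounded (range (\<lambda>x. (1 + norm x) ^ ?m *\<^sub>R iterated_pderiv bs \<phi> x))"
      using assms by (auto simp: schwartz_def)
    then show "bdd_above (range (\<lambda>x. ?g (bs, x)))" by (force simp: bounded_iff bdd_above_def)
  qed
  moreover have "?g ` (?A \<times> UNIV) \<subseteq> (\<Union>bs\<in>?A. range (\<lambda>x. ?g (bs, x)))" by blast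
  ultimately have "bdd_above (?g ` (?A \<times> UNIV))" by (rule bdd_above_mono)
  then have "?g ([], x) \<le> schwartz_seminorm ?m \<phi>"
    unfolding schwartz_seminorm_def by (intro cSUP_upper) auto
  then show ?thesis by (simp add: decay_def field_simps zero_less_power add_pos_nonneg)
qed

lemma schwartz_continuous: "\<phi> \<in> schwartz \<Longrightarrow> continuous_on UNIV \<phi>"
  unfolding schwartz_def smooth_def
  by (auto intro!: differentiable_imp_continuous_on dest: spec[of _ "[]"])

lemma continuous_iterated_pderiv:
  "smooth \<phi> \<Longrightarrow> set bs \<subseteq> Basis \<Longrightarrow> continuous_on UNIV (iterated_pderiv bs \<phi>)"
  unfolding smooth_def by (auto intro!: differentiable_imp_continuous_on)

text \<open>The definition differentiates at parameter 0 from a moving base point; the chain rule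
  with s \<mapsto> s - t transfers this to every parameter on the line.\<close>

lemma has_vector_derivative_iterated_pderiv:
  assumes "smooth \<phi>" "set bs \<subseteq> Basis"
  shows "((\<lambda>t. iterated_pderiv bs \<phi> (x + t *\<^sub>R b)) has_vector_derivative
    iterated_pderiv (b # bs) \<phi> (x + t *\<^sub>R b)) (at t)"
proof -
  let ?f = "iterated_pderiv bs \<phi>"
  have *: "((\<lambda>s. ?f (y + s *\<^sub>R b)) has_vector_derivative iterated_pderiv (b # bs) \<phi> y) (at 0)" for y
  proof -
    have "?f differentiable at (y + 0 *\<^sub>R b)"
      using assms by (auto simp: smooth_def differentiable_on_def)
    moreover have "(\<lambda>s::real. y + s *\<^sub>R b) differentiable at 0" by (intro derivative_intros)
    ultimately have "(\<lambda>s. ?f (y + s *\<^sub>R b)) differentiable at 0"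
      using differentiable_chain_at[of "\<lambda>s::real. y + s *\<^sub>R b" 0 ?f] by (simp add: o_def)
    then show ?thesis by (simp add: vector_derivative_works)
  qed
  have "((\<lambda>s. ?f ((x + t *\<^sub>R b) + s *\<^sub>R b)) \<circ> (\<lambda>s. s - t) has_vector_derivative
      1 *\<^sub>R iterated_pderiv (b # bs) \<phi> (x + t *\<^sub>R b)) (at t)"
    by (rule vector_diff_chain_at) (use * in \<open>auto intro!: derivative_eq_intros\<close>)
  then show ?thesis by (simp add: o_def algebra_simps)
qed

text \<open>Dominated convergence works along sequences, so derivatives are read off along positive
  null sequences.\<close>

lemma has_vector_derivative_imp_quotient_tendsto:
  assumes "(f has_vector_derivative D) (at 0)" "\<And>k. 0 < t k" "t \<longlonglongrightarrow> 0"
  shows "(\<lambda>k. (f (t k) - f 0) /\<^sub>R t k) \<longlonglongrightarrow> D"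
proof -
  have "((\<lambda>y. (1 / norm (y - 0)) *\<^sub>R (f y - (f 0 + (y - 0) *\<^sub>R D))) \<longlongrightarrow> 0) (at 0)"
    using assms(1) unfolding has_vector_derivative_def has_derivative_at2 by blast
  moreover have "filterlim t (at 0) sequentially"
    using assms(2,3) by (auto simp: filterlim_at intro!: always_eventually) (metis less_irrefl)
  ultimately have "(\<lambda>k. (1 / norm (t k)) *\<^sub>R (f (t k) - (f 0 + t k *\<^sub>R D))) \<longlonglongrightarrow> 0"
    using filterlim_compose by fastforce
  moreover have "(1 / norm (t k)) *\<^sub>R (f (t k) - (f 0 + t k *\<^sub>R D)) = (f (t k) - f 0) /\<^sub>R t k - D" for k
    using assms(2)[of k] by (simp add: algebra_simps inverse_eq_divide)
  ultimately show ?thesis by (simp add: LIM_zero_iff)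
qed

section \<open>Decay of Fourier transforms of Schwartz functions\<close>

lemma integrable_le_decay:
  fixes f :: "real ^ 'n \<Rightarrow> complex"
  assumes [measurable]: "f \<in> borel_measurable borel" and "\<And>x. norm (f x) \<le> C * decay x"
  shows "integrable lborel f"
  by (rule Bochner_Integration.integrable_bound[OF integrable_mult_right[OF integrable_decay, of C]])
     (use assms in \<open>auto intro!: AE_I2 order_trans[OF _ abs_ge_self]\<close>)

lemma fourier_translate:
  fixes \<psi> :: "real ^ 'n \<Rightarrow> complex"
  assumes [measurable]: "\<psi> \<in> borel_measurable borel"
  shows "(\<integral>y. cis (- 2 * pi * (x \<bullet> y)) * \<psi> (y + s) \<partial>lborel) = cis (2 * pi * (x \<bullet> s)) * fourier \<psi> x"
proof -
  have "fourier \<psi> x = (\<integral>y. cis (- 2 * pi * (x \<bullet> y)) * \<psi> y \<partial>distr lborel borel ((+) s))"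
    by (simp only: fourier_cis lborel_distr_plus)
  also have "\<dots> = (\<integral>y. cis (- 2 * pi * (x \<bullet> (s + y))) * \<psi> (s + y) \<partial>lborel)"
    by (subst integral_distr) auto
  also have "\<dots> = (\<integral>y. cis (- 2 * pi * (x \<bullet> s)) * (cis (- 2 * pi * (x \<bullet> y)) * \<psi> (y + s)) \<partial>lborel)"
  proof (intro Bochner_Integration.integral_cong refl)
    fix y
    have "cis (- 2 * pi * (x \<bullet> (s + y))) = cis (- 2 * pi * (x \<bullet> s)) * cis (- 2 * pi * (x \<bullet> y))"
      unfolding cis_mult by (simp add: inner_add_right algebra_simps)
    then show "cis (- 2 * pi * (x \<bullet> (s + y))) * \<psi> (s + y) =
        cis (- 2 * pi * (x \<bullet> s)) * (cis (- 2 * pi * (x \<bullet> y)) * \<psi> (y + s))"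
      by (simp only: mult.assoc add.commute)
  qed
  also have "\<dots> = cis (- 2 * pi * (x \<bullet> s)) * (\<integral>y. cis (- 2 * pi * (x \<bullet> y)) * \<psi> (y + s) \<partial>lborel)"
    by simp
  finally have "cis (2 * pi * (x \<bullet> s)) * fourier \<psi> x = (cis (2 * pi * (x \<bullet> s)) * cis (- 2 * pi * (x \<bullet> s))) * (\<integral>y. cis (- 2 * pi * (x \<bullet> y)) * \<psi> (y + s) \<partial>lborel)"
    by simp
  then show ?thesis by (simp add: cis_mult)
qed

text \<open>
  Integration by parts without boundary terms: translation invariance of Lebesgue measure evaluates
  the transform of a difference quotient, and dominated convergence passes to the limit.
\<close>

lemma fourier_directional_derivative:
  fixes \<psi> \<psi>' :: "real ^ 'n \<Rightarrow> complex"
  assumes cont: "continuous_on UNIV \<psi>" "continuous_on UNIV \<psi>'"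
    and deriv: "\<And>x t. ((\<lambda>t. \<psi> (x + t *\<^sub>R b)) has_vector_derivative \<psi>' (x + t *\<^sub>R b)) (at t)"
    and decay: "\<And>x. norm (\<psi> x) \<le> C * decay x" "\<And>x. norm (\<psi>' x) \<le> C' * decay x"
    and b: "norm b = 1"
  shows "fourier \<psi>' x = 2 * pi * \<i> * (x \<bullet> b) * fourier \<psi> x"
proof -
  note [measurable] = borel_measurable_continuous_onI[OF cont(1)] borel_measurable_continuous_onI[OF cont(2)]
  have "0 \<le> norm (\<psi>' 0)" by simp
  also have "\<dots> \<le> C' * decay (0 :: real ^ 'n)" by (rule decay(2))
  finally have C': "0 \<le> C'" using decay_pos[of "0 :: real ^ 'n"] by (simp add: zero_le_mult_iff)
  define t where "t k = inverse (real (Suc k))" for k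
  have t: "0 < t k" "t k \<le> 1" for k by (auto simp: t_def inverse_le_1_iff)
  have t0: "t \<longlonglongrightarrow> 0" unfolding t_def by (rule LIMSEQ_inverse_real_of_nat)
  define q where "q k y = (\<psi> (y + t k *\<^sub>R b) - \<psi> y) /\<^sub>R t k" for k y
  have [measurable]: "q k \<in> borel_measurable borel" for k unfolding q_def[abs_def] by measurable
  have q_lim: "(\<lambda>k. q k y) \<longlonglongrightarrow> \<psi>' y" for y
    using has_vector_derivative_imp_quotient_tendsto[OF deriv[of y 0], of t] t t0 by (simp add: q_def)
  \<comment> \<open>The mean value inequality replaces the quotient by a derivative at a point less
    than 1 away; moving the weight back to y costs a factor 2^(2n). The result is an integrable
    majorant uniform in k.\<close>
  have q_bound: "norm (q k y) \<le> C' * 2 ^ (2 * CARD('n)) * decay y" for k y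
  proof -
    have "\<exists>s\<in>{0<..<t k}. norm (\<psi> (y + t k *\<^sub>R b) - \<psi> (y + 0 *\<^sub>R b)) \<le> norm ((t k - 0) *\<^sub>R \<psi>' (y + s *\<^sub>R b))"
      using t[of k] cont(1) deriv[of y]
      by (intro mvt_general[where f' = "\<lambda>s h. h *\<^sub>R \<psi>' (y + s *\<^sub>R b)"])
         (auto simp: has_vector_derivative_def intro!: continuous_intros continuous_on_compose2[OF cont(1)])
    then obtain s where s: "0 < s" "s < t k" "norm (\<psi> (y + t k *\<^sub>R b) - \<psi> y) \<le> t k * norm (\<psi>' (y + s *\<^sub>R b))"
      using t[of k] by auto
    have "norm (\<psi>' (y + s *\<^sub>R b)) \<le> C' * decay (y + s *\<^sub>R b)" by (rule decay(2))
    also have "\<dots> \<le> C' * ((1 + norm (s *\<^sub>R b)) ^ (2 * CARD('n)) * decay y)"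
      using C' by (intro mult_left_mono decay_shift)
    also have "\<dots> \<le> C' * (2 ^ (2 * CARD('n)) * decay y)"
      using C' s(1,2) t[of k] b by (intro mult_left_mono mult_right_mono power_mono) auto
    finally have "t k * norm (\<psi>' (y + s *\<^sub>R b)) \<le> t k * (C' * 2 ^ (2 * CARD('n)) * decay y)"
      using t[of k] by (intro mult_left_mono) (auto simp: mult.assoc)
    then have "norm (\<psi> (y + t k *\<^sub>R b) - \<psi> y) \<le> t k * (C' * 2 ^ (2 * CARD('n)) * decay y)"
      using s(3) by linarith
    moreover have "norm (q k y) = norm (\<psi> (y + t k *\<^sub>R b) - \<psi> y) / t k"
      using t[of k] by (simp add: q_def divide_inverse)
    ultimately show ?thesis using t[of k] by (simp add: pos_divide_le_eq mult.commute)
  qed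
  have lim1: "(\<lambda>k. \<integral>y. cis (- 2 * pi * (x \<bullet> y)) * q k y \<partial>lborel) \<longlonglongrightarrow> (\<integral>y. cis (- 2 * pi * (x \<bullet> y)) * \<psi>' y \<partial>lborel)"
    by (rule integral_dominated_convergence[where w = "\<lambda>y. C' * 2 ^ (2 * CARD('n)) * decay y"])
       (measurable, use q_lim q_bound integrable_decay in \<open>auto intro!: AE_I2 tendsto_mult simp: norm_mult\<close>)
  \<comment> \<open>Translation becomes a character under the transform, so the difference quotient
    of the function turns into one of the character.\<close>
  have quot: "(\<integral>y. cis (- 2 * pi * (x \<bullet> y)) * q k y \<partial>lborel) =
    ((cis (2 * pi * (x \<bullet> b) * t k) - cis (2 * pi * (x \<bullet> b) * 0)) /\<^sub>R t k) * fourier \<psi> x" for k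
  proof -
    have i1: "integrable lborel \<psi>" using decay(1) by (intro integrable_le_decay) auto
    have i2: "integrable lborel (\<lambda>y. \<psi> (y + t k *\<^sub>R b))"
    proof (rule integrable_le_decay)
      fix y have "norm (\<psi> (y + t k *\<^sub>R b)) \<le> C * decay (y + t k *\<^sub>R b)" by (rule decay(1))
      also have "\<dots> \<le> \<bar>C\<bar> * ((1 + norm (t k *\<^sub>R b)) ^ (2 * CARD('n)) * decay y)"
        by (intro mult_mono decay_shift) auto
      finally show "norm (\<psi> (y + t k *\<^sub>R b)) \<le> (\<bar>C\<bar> * (1 + norm (t k *\<^sub>R b)) ^ (2 * CARD('n))) * decay y"
        by (simp add: mult.assoc)
    qed auto
    have int: "integrable lborel (\<lambda>y. cis (- 2 * pi * (x \<bullet> y)) * f y)" if "integrable lborel f" for f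
      using that by (rule Bochner_Integration.integrable_bound) (use borel_measurable_integrable[OF that] in \<open>auto simp: norm_mult\<close>)
    have "(\<integral>y. cis (- 2 * pi * (x \<bullet> y)) * q k y \<partial>lborel) =
       (\<integral>y. (cis (- 2 * pi * (x \<bullet> y)) * \<psi> (y + t k *\<^sub>R b) - cis (- 2 * pi * (x \<bullet> y)) * \<psi> y) /\<^sub>R t k \<partial>lborel)"
      by (simp add: q_def algebra_simps)
    also have "\<dots> = ((\<integral>y. cis (- 2 * pi * (x \<bullet> y)) * \<psi> (y + t k *\<^sub>R b) \<partial>lborel) - fourier \<psi> x) /\<^sub>R t k"
      using int[OF i1] int[OF i2] by (simp add: fourier_cis)
    also have "\<dots> = (cis (2 * pi * (x \<bullet> b) * t k) * fourier \<psi> x - fourier \<psi> x) /\<^sub>R t k"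
      by (subst fourier_translate) (auto simp: algebra_simps)
    finally show ?thesis by (simp add: algebra_simps)
  qed
  have lim2: "(\<lambda>k. ((cis (2 * pi * (x \<bullet> b) * t k) - cis (2 * pi * (x \<bullet> b) * 0)) /\<^sub>R t k) * fourier \<psi> x)
    \<longlonglongrightarrow> (2 * pi * \<i> * (x \<bullet> b)) * fourier \<psi> x"
  proof (intro tendsto_mult tendsto_const has_vector_derivative_imp_quotient_tendsto t t0)
    show "((\<lambda>s. cis (2 * pi * (x \<bullet> b) * s)) has_vector_derivative 2 * pi * \<i> * (x \<bullet> b)) (at 0)"
    proof -
      have a: "cis (2 * pi * (x \<bullet> b) * s) = exp (s *\<^sub>R (\<i> * of_real (2 * pi * (x \<bullet> b))))" for s
        unfolding cis_conv_exp scaleR_conv_of_real of_real_mult by (simp only: mult_ac)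
      have c: "exp (0 *\<^sub>R (\<i> * of_real (2 * pi * (x \<bullet> b)))) * (\<i> * of_real (2 * pi * (x \<bullet> b))) =
          2 * pi * \<i> * (x \<bullet> b)"
        by (simp only: scaleR_zero_left exp_zero mult_1_left of_real_mult mult_ac)
      show ?thesis
        using exp_scaleR_has_vector_derivative_right[of "\<i> * of_real (2 * pi * (x \<bullet> b))" 0 UNIV]
        by (simp only: a c)
    qed
  qed
  show ?thesis unfolding fourier_cis[of \<psi>'] by (rule LIMSEQ_unique[OF lim1 lim2[folded quot]])
qed

lemma fourier_iterated_pderiv_replicate:
  fixes \<phi> :: "real ^ 'n \<Rightarrow> complex"
  assumes "\<phi> \<in> schwartz" "b \<in> Basis"
  shows "fourier (iterated_pderiv (replicate m b) \<phi>) x = (2 * pi * \<i> * (x \<bullet> b)) ^ m * fourier \<phi> x"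
proof (induction m)
  case (Suc m)
  let ?bs = "replicate m b"
  have smooth: "smooth \<phi>" and bs: "set ?bs \<subseteq> Basis" "set (b # ?bs) \<subseteq> Basis"
    using assms by (auto simp: schwartz_def)
  obtain C where C: "\<And>x. norm (iterated_pderiv ?bs \<phi> x) \<le> C * decay x"
    using schwartz_iterated_pderiv_le_decay[OF assms(1) bs(1)] by metis
  obtain C' where C': "\<And>x. norm (iterated_pderiv (b # ?bs) \<phi> x) \<le> C' * decay x"
    using schwartz_iterated_pderiv_le_decay[OF assms(1) bs(2)] by metis
  have "fourier (iterated_pderiv (b # ?bs) \<phi>) x = 2 * pi * \<i> * (x \<bullet> b) * fourier (iterated_pderiv ?bs \<phi>) x"
    by (rule fourier_directional_derivative[OF continuous_iterated_pderiv[OF smooth bs(1)]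
          continuous_iterated_pderiv[OF smooth bs(2)] has_vector_derivative_iterated_pderiv[OF smooth bs(1)] C C'])
       (use assms(2) in simp)
  then show ?case using Suc by (simp add: mult.assoc)
qed simp

text \<open>Let M be the maximum of 1 and all \<open>a b\<close>. The left-hand base is at most (1 +
  card) M, and M^m is one of the nonnegative terms on the right.\<close>

lemma power_one_plus_sum_le:
  fixes a :: "'a \<Rightarrow> real"
  assumes "finite B" "\<And>b. b \<in> B \<Longrightarrow> 0 \<le> a b"
  shows "(1 + (\<Sum>b\<in>B. a b)) ^ m \<le> (1 + real (card B)) ^ m * (1 + (\<Sum>b\<in>B. a b ^ m))"
proof -
  define M where "M = Max (insert 1 (a ` B))"
  have M: "1 \<le> M" "\<And>b. b \<in> B \<Longrightarrow> a b \<le> M" and M_in: "M \<in> insert 1 (a ` B)"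
    using assms(1) Max_in[of "insert 1 (a ` B)"] unfolding M_def by (auto intro: Max_ge simp del: Max_insert)
  have "(\<Sum>b\<in>B. a b) \<le> real (card B) * M" using M(2) by (rule sum_bounded_above)
  then have "1 + (\<Sum>b\<in>B. a b) \<le> (1 + real (card B)) * M" using M(1) by (simp add: algebra_simps)
  then have "(1 + (\<Sum>b\<in>B. a b)) ^ m \<le> ((1 + real (card B)) * M) ^ m"
    using assms by (intro power_mono) (auto intro!: add_nonneg_nonneg sum_nonneg)
  also have "\<dots> = (1 + real (card B)) ^ m * M ^ m" by (rule power_mult_distrib)
  also have "M ^ m \<le> 1 + (\<Sum>b\<in>B. a b ^ m)"
  proof (cases "M = 1")
    case True
    then show ?thesis using assms by (auto intro!: sum_nonneg)
  next
    case False
    then obtain b where b: "b \<in> B" "M = a b" using M_in by auto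
    then have "a b ^ m \<le> (\<Sum>b\<in>B. a b ^ m)" using assms by (intro member_le_sum) auto
    then show ?thesis using b by simp
  qed
  finally show ?thesis by (simp add: mult_left_mono)
qed

text \<open>A power of a coordinate times the transform is, up to powers of 2 pi, the transform of
  an iterated derivative, hence bounded by an L1 norm. The l1 bound on the norm combines the
  coordinates. This decay makes lattice sums of \<open>fourier \<phi>\<close> absolutely
  convergent.\<close>

lemma fourier_schwartz_le_decay:
  fixes \<phi> :: "real ^ 'n \<Rightarrow> complex"
  assumes "\<phi> \<in> schwartz"
  obtains C where "0 \<le> C" "\<And>x. norm (fourier \<phi> x) \<le> C * decay x"
proof -
  let ?m = "2 * CARD('n)"
  have bound: "\<exists>C\<ge>0. \<forall>x. \<bar>x \<bullet> b\<bar> ^ m * norm (fourier \<phi> x) \<le> C" if b: "b \<in> Basis" for b m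
  proof -
    let ?\<psi> = "iterated_pderiv (replicate m b) \<phi>"
    define C where "C = (\<integral>y. norm (?\<psi> y) \<partial>lborel)"
    have "\<bar>x \<bullet> b\<bar> ^ m * norm (fourier \<phi> x) \<le> C" for x
    proof -
      have "\<bar>x \<bullet> b\<bar> ^ m * norm (fourier \<phi> x) \<le> (2 * pi * \<bar>x \<bullet> b\<bar>) ^ m * norm (fourier \<phi> x)"
        using pi_ge_two mult_right_mono[of 1 "2 * pi" "\<bar>x \<bullet> b\<bar>"] by (intro mult_right_mono power_mono) auto
      also have "\<dots> = norm (fourier ?\<psi> x)"
        unfolding fourier_iterated_pderiv_replicate[OF assms b] by (simp add: norm_mult norm_power abs_mult)
      also have "\<dots> \<le> (\<integral>y. norm (cis (- 2 * pi * (x \<bullet> y)) * ?\<psi> y) \<partial>lborel)"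
        unfolding fourier_cis by (rule integral_norm_bound)
      also have "\<dots> = C" by (simp add: norm_mult C_def)
      finally show ?thesis .
    qed
    moreover have "0 \<le> C" unfolding C_def by simp
    ultimately show ?thesis by blast
  qed
  \<comment> \<open>The zeroth power, at an arbitrary basis vector, is the plain uniform
    bound.\<close>
  obtain C0 where C0: "0 \<le> C0" "\<And>x. norm (fourier \<phi> x) \<le> C0"
    using bound[of "axis undefined 1" 0] by auto
  obtain C where C: "\<And>b x. b \<in> Basis \<Longrightarrow> \<bar>x \<bullet> b\<bar> ^ ?m * norm (fourier \<phi> x) \<le> C b" "\<And>b. b \<in> Basis \<Longrightarrow> 0 \<le> C b"
    using bound[of _ ?m] by metis
  let ?n = "1 + real (card (Basis :: (real ^ 'n) set))"
  define K where "K = ?n ^ ?m * (C0 + (\<Sum>b\<in>Basis. C b))"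
  have "norm (fourier \<phi> x) \<le> K * decay x" for x
  proof -
    have "(1 + norm x) ^ ?m \<le> (1 + (\<Sum>b\<in>Basis. \<bar>x \<bullet> b\<bar>)) ^ ?m"
      by (intro power_mono add_left_mono norm_le_l1) auto
    also have "\<dots> \<le> ?n ^ ?m * (1 + (\<Sum>b\<in>Basis. \<bar>x \<bullet> b\<bar> ^ ?m))"
      by (rule power_one_plus_sum_le) auto
    finally have "(1 + norm x) ^ ?m * norm (fourier \<phi> x) \<le>
      ?n ^ ?m * (1 + (\<Sum>b\<in>Basis. \<bar>x \<bullet> b\<bar> ^ ?m)) * norm (fourier \<phi> x)"
      by (rule mult_right_mono) simp
    also have "\<dots> = ?n ^ ?m * (norm (fourier \<phi> x) + (\<Sum>b\<in>Basis. \<bar>x \<bullet> b\<bar> ^ ?m * norm (fourier \<phi> x)))"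
      by (simp add: algebra_simps sum_distrib_left sum_distrib_right)
    also have "\<dots> \<le> K" unfolding K_def
      using C0(2) C(1) by (intro mult_left_mono add_mono sum_mono) auto
    finally show ?thesis by (simp add: decay_def field_simps zero_less_power add_pos_nonneg)
  qed
  moreover have "0 \<le> K" unfolding K_def using C0(1) C(2) by (intro mult_nonneg_nonneg add_nonneg_nonneg sum_nonneg) auto
  ultimately show ?thesis using that by blast
qed

text \<open>The complement of the closed support is open, so near such a point a line derivative is
  that of the zero function.\<close>

lemma iterated_pderiv_eq_0:
  assumes "y \<notin> closure (support_on UNIV \<phi>)"
  shows "iterated_pderiv bs \<phi> y = 0"
  using assms
proof (induction bs arbitrary: y)
  case Nil
  then show ?case using closure_subset[of "support_on UNIV \<phi>"] by (auto simp: support_on_def)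
next
  case (Cons b bs)
  let ?S = "(\<lambda>t. y + t *\<^sub>R b) -` (- closure (support_on UNIV \<phi>))"
  have "open ?S" by (intro open_vimage continuous_intros) auto
  then have "((\<lambda>t. iterated_pderiv bs \<phi> (y + t *\<^sub>R b)) has_vector_derivative 0) (at 0)"
    by (rule has_vector_derivative_transform_within_open[OF has_vector_derivative_const[of 0]])
       (use Cons in auto)
  then show ?case by (simp add: vector_derivative_at)
qed

lemma smooth_compactly_supported_in_schwartz:
  assumes "smooth \<phi>" "compactly_supported \<phi>"
  shows "\<phi> \<in> schwartz"
proof -
  let ?K = "closure (support_on UNIV \<phi>)"
  have "bounded (range (\<lambda>x. (1 + norm x) ^ m *\<^sub>R iterated_pderiv bs \<phi> x))" if "set bs \<subseteq> Basis" for bs m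
  proof -
    let ?g = "\<lambda>x. (1 + norm x) ^ m *\<^sub>R iterated_pderiv bs \<phi> x"
    have "continuous_on ?K ?g"
      by (intro continuous_intros continuous_on_subset[OF continuous_iterated_pderiv[OF assms(1) that]]) auto
    then have "bounded (?g ` ?K)"
      using assms(2) by (intro compact_imp_bounded compact_continuous_image) (auto simp: compactly_supported_def)
    moreover have "range ?g \<subseteq> insert 0 (?g ` ?K)"
      using iterated_pderiv_eq_0[of _ \<phi> bs] by force
    ultimately show ?thesis by (meson bounded_insert bounded_subset)
  qed
  then show ?thesis using assms(1) by (simp add: schwartz_def)
qed

lemma smooth_compactly_supported_in_C_c: "smooth \<phi> \<Longrightarrow> compactly_supported \<phi> \<Longrightarrow> \<phi> \<in> C_c"
  using schwartz_continuous smooth_compactly_supported_in_schwartz by (auto simp: C_c_def)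

section \<open>Transforms of measures and lattice sums\<close>

definition complex_dot :: "real ^ 'n \<Rightarrow> complex ^ 'n \<Rightarrow> complex" where
  "complex_dot k z = (\<Sum>i\<in>UNIV. of_real (k $ i) * z $ i)"

lemma norm_complex_dot_le: "norm (complex_dot k z) \<le> norm k * norm z"
proof -
  have "norm (complex_dot k z) \<le> (\<Sum>i\<in>UNIV. \<bar>k $ i\<bar> * \<bar>norm (z $ i)\<bar>)"
    unfolding complex_dot_def by (rule order_trans[OF norm_sum]) (simp add: norm_mult)
  also have "\<dots> \<le> norm k * norm z"
    using L2_set_mult_ineq[of "\<lambda>i. k $ i" "\<lambda>i. norm (z $ i)" UNIV]
    by (simp add: norm_vec_def L2_set_def)
  finally show ?thesis .
qed

lemma Im_complex_dot: "Im (complex_dot k z) = k \<bullet> Im_vec z"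
  by (simp add: complex_dot_def Im_vec_def inner_vec_def)

lemma complex_dot_complex_vec: "complex_dot k (complex_vec x) = of_real (k \<bullet> x)"
  by (simp add: complex_dot_def complex_vec_def inner_vec_def)

lemma complex_dot_add: "complex_dot k (y + z) = complex_dot k y + complex_dot k z"
  by (simp add: complex_dot_def algebra_simps sum.distrib)

lemma complex_dot_scale: "complex_dot k (c *s z) = c * complex_dot k z"
  by (simp add: complex_dot_def sum_distrib_left algebra_simps)

lemma complex_dot_measurable [measurable]: "(\<lambda>k. complex_dot k z) \<in> borel_measurable borel"
  unfolding complex_dot_def
  by (intro borel_measurable_continuous_onI continuous_intros)

text \<open>The dot product involves no conjugation, so the integrand is holomorphic in z. The
  positive sign in the exponent makes this the inverse transform.\<close>

definition fourier_laplace :: "(real ^ 'n) measure \<Rightarrow> complex ^ 'n \<Rightarrow> complex" where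
  "fourier_laplace M z = (\<integral>k. exp (2 * pi * \<i> * complex_dot k z) \<partial>M)"

definition char_function :: "(real ^ 'n) measure \<Rightarrow> real ^ 'n \<Rightarrow> complex" where
  "char_function M x = (\<integral>k. cis (2 * pi * (k \<bullet> x)) \<partial>M)"

lemma fourier_laplace_complex_vec: "fourier_laplace M (complex_vec x) = char_function M x"
  by (simp add: fourier_laplace_def char_function_def complex_dot_complex_vec cis_conv_exp algebra_simps)

lemma norm_char_function_le:
  fixes M :: "(real ^ 'n) measure"
  assumes "finite_measure M"
  shows "norm (char_function M x) \<le> measure M (space M)"
proof -
  interpret finite_measure M by fact
  have "norm (char_function M x) \<le> (\<integral>k. norm (cis (2 * pi * (k \<bullet> x))) \<partial>M)"
    unfolding char_function_def by (rule integral_norm_bound)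
  then show ?thesis by simp
qed

text \<open>The modulus is the exponential of -2 pi k . Im z, and Cauchy-Schwarz bounds the
  exponent.\<close>

lemma norm_exp_complex_dot_le:
  assumes "norm k \<le> R"
  shows "norm (exp (2 * pi * \<i> * complex_dot k z)) \<le> exp (2 * pi * R * norm (Im_vec z))"
proof -
  have "- (k \<bullet> Im_vec z) \<le> norm k * norm (Im_vec z)"
    using norm_cauchy_schwarz[of "- k" "Im_vec z"] by simp
  also have "\<dots> \<le> R * norm (Im_vec z)" using assms by (rule mult_right_mono) simp
  finally have "2 * pi * - (k \<bullet> Im_vec z) \<le> 2 * pi * (R * norm (Im_vec z))"
    by (rule mult_left_mono) simp
  then have "- (2 * pi * (k \<bullet> Im_vec z)) \<le> 2 * pi * (R * norm (Im_vec z))"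
    by (simp only: mult_minus_right)
  moreover have "Re (2 * pi * \<i> * complex_dot k z) = - (2 * pi * (k \<bullet> Im_vec z))"
    by (simp add: Im_complex_dot)
  ultimately show ?thesis by (simp only: norm_exp_eq_Re exp_le_cancel_iff mult.assoc)
qed

lemma norm_fourier_laplace_le:
  fixes M :: "(real ^ 'n) measure"
  assumes "finite_measure M" and [measurable_cong]: "sets M = sets borel" and AE: "AE k in M. norm k \<le> R"
  shows "norm (fourier_laplace M z) \<le> measure M (space M) * exp (2 * pi * R * norm (Im_vec z))"
proof -
  interpret finite_measure M by fact
  have *: "AE k in M. norm (exp (2 * pi * \<i> * complex_dot k z)) \<le> exp (2 * pi * R * norm (Im_vec z))"
    using AE by eventually_elim (rule norm_exp_complex_dot_le)
  have int: "integrable M (\<lambda>k. exp (2 * pi * \<i> * complex_dot k z))"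
    by (rule integrable_const_bound[OF *]) measurable
  have "norm (fourier_laplace M z) \<le> (\<integral>k. norm (exp (2 * pi * \<i> * complex_dot k z)) \<partial>M)"
    unfolding fourier_laplace_def by (rule integral_norm_bound)
  also have "\<dots> \<le> (\<integral>k. exp (2 * pi * R * norm (Im_vec z)) \<partial>M)"
    by (rule integral_mono_AE[OF integrable_norm[OF int] _ *]) simp
  finally show ?thesis by simp
qed

lemma norm_exp_remainder_le: "norm (exp w - (1 + w :: complex)) \<le> exp (norm w) * (norm w)\<^sup>2"
  using Taylor_exp_field[of w 1] by (simp add: power2_eq_square)

text \<open>Differentiation under the integral. On a bounded set of frequencies the Taylor remainder
  of the exponential is quadratically small uniformly in k, which gives the derivative with an
  explicit error bound.\<close>

lemma entire_fourier_laplace: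
  fixes M :: "(real ^ 'n) measure"
  assumes "finite_measure M" and [measurable_cong]: "sets M = sets borel" and AE: "AE k in M. norm k \<le> R"
  shows "entire (fourier_laplace M)"
  unfolding entire_def
proof
  interpret finite_measure M by fact
  fix z :: "complex ^ 'n"
  define e where "e v k = exp (2 * pi * \<i> * complex_dot k v)" for v :: "complex ^ 'n" and k
  define l where "l v k = 2 * pi * \<i> * complex_dot k v" for v :: "complex ^ 'n" and k
  define D where "D v = (\<integral>k. l v k * e z k \<partial>M)" for v
  have [measurable]: "e v \<in> borel_measurable borel" "l v \<in> borel_measurable borel" for v
    unfolding e_def[abs_def] l_def[abs_def] by measurable
  \<comment> \<open>A negative \<open>R\<close> is possible when \<open>M\<close> is the zero
    measure; the maximum keeps \<open>R'\<close> nonnegative.\<close>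
  define R' where "R' = 2 * pi * max 0 R"
  have R': "0 \<le> R'" by (simp add: R'_def)
  define E where "E = exp (2 * pi * R * norm (Im_vec z))"
  have E: "0 \<le> E" by (simp add: E_def)
  have e_le: "AE k in M. norm (e v k) \<le> exp (2 * pi * R * norm (Im_vec v))" for v
    using AE by eventually_elim (simp only: e_def norm_exp_complex_dot_le)
  have l_le: "AE k in M. norm (l v k) \<le> R' * norm v" for v
    using AE
  proof eventually_elim
    fix k :: "real ^ 'n" assume "norm k \<le> R"
    then have "norm (complex_dot k v) \<le> max 0 R * norm v"
      using norm_complex_dot_le[of k v] by (smt (verit) mult_right_mono norm_ge_zero)
    then show "norm (l v k) \<le> R' * norm v" by (simp add: l_def R'_def norm_mult mult.assoc)
  qed
  have le_le: "AE k in M. norm (l v k * e z k) \<le> R' * norm v * E" for v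
    using l_le[of v] e_le[of z] by eventually_elim (auto simp: norm_mult E_def intro!: mult_mono mult_nonneg_nonneg R')
  have int_e: "integrable M (e v)" for v by (rule integrable_const_bound[OF e_le]) measurable
  have int_le: "integrable M (\<lambda>k. l v k * e z k)" for v by (rule integrable_const_bound[OF le_le]) measurable
  have D_add: "D (x + y) = D x + D y" for x y
    unfolding D_def using int_le[of x] int_le[of y]
    by (subst Bochner_Integration.integral_add[symmetric]) (auto simp: l_def complex_dot_add algebra_simps)
  have D_scale: "D (c *s v) = c * D v" for c v
    unfolding D_def by (subst integral_mult_right_zero[symmetric]) (simp add: l_def complex_dot_scale mult_ac)
  have D_bound: "norm (D v) \<le> norm v * (R' * E * measure M (space M))" for v
  proof -
    have "norm (D v) \<le> (\<integral>k. norm (l v k * e z k) \<partial>M)" unfolding D_def by (rule integral_norm_bound)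
    also have "\<dots> \<le> (\<integral>k. R' * norm v * E \<partial>M)"
      by (rule integral_mono_AE[OF integrable_norm[OF int_le] _ le_le]) simp
    finally show ?thesis by (simp add: mult_ac)
  qed
  have D_lin: "bounded_linear D"
  proof (rule bounded_linear_intro[OF D_add _ D_bound])
    fix r :: real and v :: "complex ^ 'n"
    have "r *\<^sub>R v = of_real r *s v" 
      unfolding vec_eq_iff vector_scaleR_component vector_smult_component by (simp add: scaleR_conv_of_real)
    then show "D (r *\<^sub>R v) = r *\<^sub>R D v" by (simp add: D_scale scaleR_conv_of_real)
  qed
  define K where "K = exp R' * R'\<^sup>2 * E * measure M (space M)"
  have K: "0 \<le> K" using E by (simp add: K_def)
  have rem: "norm (fourier_laplace M (z + v) - fourier_laplace M z - D v) \<le> K * (norm v)\<^sup>2" if v: "norm v \<le> 1" for v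
  proof -
    \<comment> \<open>The exponential at z + v factors, which leaves the second-order remainder of
      exp at \<open>l v k\<close>.\<close>
    have eq: "fourier_laplace M (z + v) - fourier_laplace M z - D v = (\<integral>k. e z k * (exp (l v k) - (1 + l v k)) \<partial>M)"
    proof -
      have "fourier_laplace M (z + v) - fourier_laplace M z - D v = (\<integral>k. e (z + v) k - e z k - l v k * e z k \<partial>M)"
        unfolding fourier_laplace_def D_def e_def[symmetric]
        using int_e[of "z + v"] int_e[of z] int_le[of v] by simp
      also have "\<dots> = (\<integral>k. e z k * (exp (l v k) - (1 + l v k)) \<partial>M)"
        by (intro Bochner_Integration.integral_cong) (auto simp: e_def l_def complex_dot_add distrib_left exp_add algebra_simps)
      finally show ?thesis .
    qed
    have b: "AE k in M. norm (e z k * (exp (l v k) - (1 + l v k))) \<le> E * (exp R' * (R' * norm v)\<^sup>2)"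
      using l_le[of v] e_le[of z]
    proof eventually_elim
      case (elim k)
      have "norm (l v k) \<le> R'" using elim(1) mult_left_mono[OF v R'] by simp
      then have "exp (norm (l v k)) * (norm (l v k))\<^sup>2 \<le> exp R' * (R' * norm v)\<^sup>2"
        using elim(1) by (intro mult_mono power_mono) auto
      then have "norm (exp (l v k) - (1 + l v k)) \<le> exp R' * (R' * norm v)\<^sup>2"
        using norm_exp_remainder_le[of "l v k"] by linarith
      then show ?case using elim(2) E by (auto simp: norm_mult E_def intro!: mult_mono)
    qed
    have "norm (\<integral>k. e z k * (exp (l v k) - (1 + l v k)) \<partial>M) \<le> (\<integral>k. norm (e z k * (exp (l v k) - (1 + l v k))) \<partial>M)"
      by (rule integral_norm_bound)
    also have "\<dots> \<le> (\<integral>k. E * (exp R' * (R' * norm v)\<^sup>2) \<partial>M)"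
      by (rule integral_mono_AE[OF integrable_norm[OF integrable_const_bound[OF b]] _ b]) simp_all
    finally show ?thesis unfolding eq by (simp add: K_def power_mult_distrib mult_ac)
  qed
  have "(fourier_laplace M has_derivative D) (at z)"
    unfolding has_derivative_within_alt
  proof (intro conjI D_lin allI impI)
    fix \<epsilon> :: real assume \<epsilon>: "0 < \<epsilon>"
    \<comment> \<open>The 1 keeps the increment within the range of the remainder estimate, and K +
      1 is a nonzero denominator.\<close>
    define d where "d = min 1 (\<epsilon> / (K + 1))"
    have d: "0 < d" using \<epsilon> K by (simp add: d_def)
    have "norm (fourier_laplace M y - fourier_laplace M z - D (y - z)) \<le> \<epsilon> * norm (y - z)" if y: "norm (y - z) < d" for y
    proof -
      have "norm (fourier_laplace M y - fourier_laplace M z - D (y - z)) \<le> K * norm (y - z) * norm (y - z)"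
        using rem[of "y - z"] y by (simp add: d_def power2_eq_square)
      also have "K * norm (y - z) \<le> \<epsilon>"
      proof -
        have "K * norm (y - z) \<le> (K + 1) * (\<epsilon> / (K + 1))"
          using y K by (intro mult_mono) (auto simp: d_def)
        then show ?thesis using K by simp
      qed
      finally show ?thesis by (simp add: mult_right_mono)
    qed
    then show "\<exists>d>0. \<forall>y\<in>UNIV. norm (y - z) < d \<longrightarrow>
        norm (fourier_laplace M y - fourier_laplace M z - D (y - z)) \<le> \<epsilon> * norm (y - z)"
      using d by blast
  qed
  then show "\<exists>D. (fourier_laplace M has_derivative D) (at z) \<and> (\<forall>c v. D (c *s v) = c * D v)"
    using D_scale by blast
qed

lemma continuous_char_function:
  fixes M :: "(real ^ 'n) measure"
  assumes "finite_measure M" "sets M = sets borel"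
  shows "continuous_on UNIV (char_function M)"
proof -
  interpret finite_measure M by fact
  note [measurable_cong] = assms(2)
  have "isCont (char_function M) x" for x
  proof (rule continuous_at_sequentiallyI)
    fix u assume u: "u \<longlonglongrightarrow> x"
    show "(\<lambda>n. char_function M (u n)) \<longlonglongrightarrow> char_function M x"
      unfolding char_function_def
    proof (rule integral_dominated_convergence[where w = "\<lambda>_. 1"])
      show "AE k in M. (\<lambda>n. cis (2 * pi * (k \<bullet> u n))) \<longlonglongrightarrow> cis (2 * pi * (k \<bullet> x))"
        unfolding cis_conv_exp using u by (intro AE_I2 tendsto_intros)
    qed auto
  qed
  then show ?thesis by (simp add: continuous_on_eq_continuous_at)
qed

text \<open>The double sum is the integral of a squared modulus: the easy direction of Bochner's
  theorem.\<close>

lemma positive_definite_char_function: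
  fixes M :: "(real ^ 'n) measure"
  assumes "finite_measure M" and [measurable_cong]: "sets M = sets borel"
  shows "positive_definite (char_function M)"
  unfolding positive_definite_def
proof (intro allI impI)
  interpret finite_measure M by fact
  fix X :: "(real ^ 'n) set" and c assume "finite X"
  let ?g = "\<lambda>k. \<Sum>x\<in>X. c x * cis (2 * pi * (k \<bullet> x))"
  have int: "integrable M (\<lambda>k. cis (2 * pi * (k \<bullet> x)))" for x
    by (rule integrable_const_bound[of _ 1]) auto
  have eq: "(\<Sum>x\<in>X. \<Sum>y\<in>X. c x * cnj (c y) * cis (2 * pi * (k \<bullet> (x - y)))) = of_real ((norm (?g k))\<^sup>2)" for k
  proof -
    have "of_real ((norm (?g k))\<^sup>2) = ?g k * cnj (?g k)" unfolding complex_norm_square[symmetric] by (simp only: of_real_power)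
    also have "\<dots> = (\<Sum>x\<in>X. \<Sum>y\<in>X. (c x * cis (2 * pi * (k \<bullet> x))) * (cnj (c y) * cis (- (2 * pi * (k \<bullet> y)))))"
      by (simp add: sum_product cis_cnj)
    also have "\<dots> = (\<Sum>x\<in>X. \<Sum>y\<in>X. c x * cnj (c y) * cis (2 * pi * (k \<bullet> (x - y))))"
    proof (intro sum.cong refl)
      fix x y
      have "cis (2 * pi * (k \<bullet> (x - y))) = cis (2 * pi * (k \<bullet> x)) * cis (- (2 * pi * (k \<bullet> y)))"
        by (simp add: cis_mult inner_diff_right algebra_simps)
      then show "(c x * cis (2 * pi * (k \<bullet> x))) * (cnj (c y) * cis (- (2 * pi * (k \<bullet> y)))) = c x * cnj (c y) * cis (2 * pi * (k \<bullet> (x - y)))"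
        by (simp add: mult_ac)
    qed
    finally show ?thesis by simp
  qed
  have "(\<Sum>x\<in>X. \<Sum>y\<in>X. c x * cnj (c y) * char_function M (x - y)) =
    (\<integral>k. (\<Sum>x\<in>X. \<Sum>y\<in>X. c x * cnj (c y) * cis (2 * pi * (k \<bullet> (x - y)))) \<partial>M)"
    unfolding char_function_def using int by simp
  also have "\<dots> = of_real (\<integral>k. (norm (?g k))\<^sup>2 \<partial>M)"
    unfolding eq by (rule integral_complex_of_real)
  finally show "(\<Sum>x\<in>X. \<Sum>y\<in>X. c x * cnj (c y) * char_function M (x - y)) \<in> \<real>\<^sub>\<ge>\<^sub>0"
    by simp
qed

text \<open>The lattice sum is encoded as an integral over counting measure so that Fubini and
  dominated convergence apply to it.\<close>

definition periodization :: "(real ^ 'n) set \<Rightarrow> (real ^ 'n \<Rightarrow> complex) \<Rightarrow> real ^ 'n \<Rightarrow> complex" where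
  "periodization L \<phi> x = (\<integral>u. \<phi> (x + u) \<partial>count_space L)"

lemma periodization_periodic:
  assumes "linear D" "v \<in> int_lattice D"
  shows "periodization (int_lattice D) \<phi> (x + v) = periodization (int_lattice D) \<phi> x"
proof -
  have "periodization (int_lattice D) \<phi> (x + v) = (\<integral>u. \<phi> (x + (u + v)) \<partial>count_space (int_lattice D))"
    by (simp add: periodization_def ac_simps)
  also have "\<dots> = periodization (int_lattice D) \<phi> x"
    unfolding periodization_def
    by (rule integral_bij_count_space[OF bij_betw_translate_int_lattice[OF assms], of "\<lambda>u. \<phi> (x + u)"])
  finally show ?thesis .
qed

lemma integrable_count_space_decay:
  fixes D :: "real ^ 'n \<Rightarrow> real ^ 'n"
  assumes "linear D" "bij D"
  shows "integrable (count_space (int_lattice D)) decay"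
  using abs_summable_on_decay[OF assms] by (simp add: Infinite_Set_Sum.abs_summable_on_def)

lemma integrable_count_space_le_decay:
  fixes D :: "real ^ 'n \<Rightarrow> real ^ 'n" and f :: "real ^ 'n \<Rightarrow> complex"
  assumes "linear D" "bij D" "\<And>x. norm (f x) \<le> C * decay x"
  shows "integrable (count_space (int_lattice D)) f"
  by (rule Bochner_Integration.integrable_bound[OF integrable_mult_right[OF integrable_count_space_decay[OF assms(1,2)], of C]])
     (use assms(3) in \<open>auto intro!: AE_I2 order_trans[OF _ abs_ge_self]\<close>)

text \<open>A convergent sequence of points is bounded, so a single multiple of the weight dominates
  all translated summands.\<close>

lemma continuous_periodization:
  fixes D :: "real ^ 'n \<Rightarrow> real ^ 'n" and \<phi> :: "real ^ 'n \<Rightarrow> complex"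
  assumes D: "linear D" "bij D" and cont: "continuous_on UNIV \<phi>" and C: "\<And>x. norm (\<phi> x) \<le> C * decay x"
  shows "continuous_on UNIV (periodization (int_lattice D) \<phi>)"
proof -
  have "0 \<le> C * decay (0 :: real ^ 'n)" using C[of 0] norm_ge_zero order_trans by blast
  then have C0: "0 \<le> C" using decay_pos[of "0 :: real ^ 'n"] by (simp add: zero_le_mult_iff)
  have "isCont (periodization (int_lattice D) \<phi>) x" for x
  proof (rule continuous_at_sequentiallyI)
    fix y assume y: "y \<longlonglongrightarrow> x"
    then have "Bseq y" by (intro convergent_imp_Bseq convergentI)
    then obtain B where B: "\<And>n. norm (y n) \<le> B" by (auto simp: Bseq_def)
    show "(\<lambda>n. periodization (int_lattice D) \<phi> (y n)) \<longlonglongrightarrow> periodization (int_lattice D) \<phi> x"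
      unfolding periodization_def
    proof (rule integral_dominated_convergence[where w = "\<lambda>u. C * (1 + B) ^ (2 * CARD('n)) * decay u"])
      show "integrable (count_space (int_lattice D)) (\<lambda>u. C * (1 + B) ^ (2 * CARD('n)) * decay u)"
        by (rule integrable_mult_right[OF integrable_count_space_decay[OF D]])
      show "AE u in count_space (int_lattice D). (\<lambda>n. \<phi> (y n + u)) \<longlonglongrightarrow> \<phi> (x + u)"
        using cont y by (intro AE_I2 isCont_tendsto_compose[of _ \<phi>] tendsto_intros) (auto simp: continuous_on_eq_continuous_at)
      show "AE u in count_space (int_lattice D). norm (\<phi> (y n + u)) \<le> C * (1 + B) ^ (2 * CARD('n)) * decay u" for n
      proof (rule AE_I2)
        fix u
        have "norm (\<phi> (y n + u)) \<le> C * decay (u + y n)" using C[of "y n + u"] by (simp add: add.commute)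
        also have "\<dots> \<le> C * ((1 + norm (y n)) ^ (2 * CARD('n)) * decay u)"
          using C0 by (intro mult_left_mono decay_shift)
        also have "\<dots> \<le> C * ((1 + B) ^ (2 * CARD('n)) * decay u)"
          using C0 B[of n] by (intro mult_left_mono mult_right_mono power_mono) auto
        finally show "norm (\<phi> (y n + u)) \<le> C * (1 + B) ^ (2 * CARD('n)) * decay u" by (simp add: mult.assoc)
      qed
    qed auto
  qed
  then show ?thesis by (simp add: continuous_on_eq_continuous_at)
qed

lemma integrable_convolution_le_decay:
  fixes D :: "real ^ 'n \<Rightarrow> real ^ 'n" and \<phi> :: "real ^ 'n \<Rightarrow> complex"
  assumes D: "linear D" "bij D" and \<rho>: "finite_measure \<rho>" "sets \<rho> = sets borel" "AE x in \<rho>. x \<in> cell D"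
    and [measurable]: "\<phi> \<in> borel_measurable borel" and C: "\<And>x. norm (\<phi> x) \<le> C * decay x"
  shows "integrable (convolution \<rho> (delta_set (int_lattice D))) \<phi>"
proof -
  obtain R where R: "\<And>x. x \<in> cell D \<Longrightarrow> norm x < R" using cell_norm_bound[OF D] by metis
  have "AE x in \<rho>. norm x \<le> R" using \<rho>(3) by eventually_elim (simp add: R less_imp_le)
  then have int: "integrable (convolution \<rho> (delta_set (int_lattice D))) decay"
    by (rule integrable_decay_convolution[OF D \<rho>(2,1)])
  show ?thesis
    by (rule Bochner_Integration.integrable_bound[OF integrable_mult_right[OF int, of C]])
       (use C in \<open>auto intro!: AE_I2 order_trans[OF _ abs_ge_self]\<close>)
qed

lemma integral_convolution_periodization:
  fixes D :: "real ^ 'n \<Rightarrow> real ^ 'n" and \<phi> :: "real ^ 'n \<Rightarrow> complex"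
  assumes D: "linear D" "bij D" and \<rho>: "finite_measure \<rho>" "sets \<rho> = sets borel" "AE x in \<rho>. x \<in> cell D"
    and \<phi>: "\<phi> \<in> borel_measurable borel" "\<And>x. norm (\<phi> x) \<le> C * decay x"
  shows "(\<integral>x. \<phi> x \<partial>convolution \<rho> (delta_set (int_lattice D))) = (\<integral>x. periodization (int_lattice D) \<phi> x \<partial>\<rho>)"
  unfolding periodization_def
  by (rule integral_convolution_delta_set[OF countable_int_lattice[OF D] \<rho>(2,1) integrable_convolution_le_decay[OF D \<rho> \<phi>]])

text \<open>A bounded weight function against a decaying one gives absolute convergence, under which
  the unordered sum is an integral over counting measure.\<close>

lemma dirac_comb_eq_integral:
  fixes D :: "real ^ 'n \<Rightarrow> real ^ 'n"
  assumes D: "linear D" "bij D" and "\<And>x. norm (\<Phi> x) \<le> B" "\<And>x. norm (\<phi> x) \<le> C * decay x"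
  shows "dirac_comb (int_lattice D) \<Phi> \<phi> = (\<integral>z. \<Phi> z * \<phi> z \<partial>count_space (int_lattice D))"
    and "integrable (count_space (int_lattice D)) (\<lambda>z. \<Phi> z * \<phi> z)"
proof -
  have "norm (\<Phi> x * \<phi> x) \<le> B * C * decay x" for x
    using mult_mono[OF assms(3,4), of x x] order_trans[OF norm_ge_zero assms(3)] by (simp add: norm_mult mult.assoc)
  then show int: "integrable (count_space (int_lattice D)) (\<lambda>z. \<Phi> z * \<phi> z)"
    by (rule integrable_count_space_le_decay[OF D])
  then show "dirac_comb (int_lattice D) \<Phi> \<phi> = (\<integral>z. \<Phi> z * \<phi> z \<partial>count_space (int_lattice D))"
    unfolding dirac_comb_def
    by (subst infsetsum_infsum[symmetric]) (auto simp: Infinite_Set_Sum.abs_summable_on_def infsetsum_def)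
qed

lemma dirac_comb_cmult:
  "dirac_comb A \<Phi> (\<lambda>x. c * \<phi> x) = c * dirac_comb A \<Phi> \<phi>"
  unfolding dirac_comb_def mult.left_commute[of _ c] by (rule infsum_cmult_right')

lemma dirac_comb_add:
  fixes D :: "real ^ 'n \<Rightarrow> real ^ 'n"
  assumes D: "linear D" "bij D" and B: "\<And>x. norm (\<Phi> x) \<le> B"
    and C: "\<And>x. norm (\<phi> x) \<le> C * decay x" and C': "\<And>x. norm (\<psi> x) \<le> C' * decay x"
  shows "dirac_comb (int_lattice D) \<Phi> (\<lambda>x. \<phi> x + \<psi> x) = dirac_comb (int_lattice D) \<Phi> \<phi> + dirac_comb (int_lattice D) \<Phi> \<psi>"
proof -
  note eq = dirac_comb_eq_integral[of D \<Phi> B, OF D B]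
  have CC': "norm (\<phi> x + \<psi> x) \<le> (C + C') * decay x" for x
    using norm_triangle_ineq[of "\<phi> x" "\<psi> x"] C[of x] C'[of x] by (simp add: distrib_right)
  show ?thesis
    using eq(2)[OF C] eq(2)[OF C'] by (simp add: eq(1)[OF CC'] eq(1)[OF C] eq(1)[OF C'] distrib_left)
qed

lemma tempered_distribution_dirac_comb:
  fixes D :: "real ^ 'n \<Rightarrow> real ^ 'n"
  assumes D: "linear D" "bij D" and B: "\<And>x. norm (\<Phi> x) \<le> B"
  shows "tempered_distribution (dirac_comb (int_lattice D) \<Phi>)"
  unfolding tempered_distribution_def
proof (intro conjI ballI allI)
  fix \<phi> \<psi> assume \<phi>: "\<phi> \<in> (schwartz :: (real ^ 'n \<Rightarrow> complex) set)" and \<psi>: "\<psi> \<in> (schwartz :: (real ^ 'n \<Rightarrow> complex) set)"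
  obtain C where C: "\<And>x. norm (\<phi> x) \<le> C * decay x" using schwartz_le_decay[OF \<phi>] by metis
  obtain C' where C': "\<And>x. norm (\<psi> x) \<le> C' * decay x" using schwartz_le_decay[OF \<psi>] by metis
  show "dirac_comb (int_lattice D) \<Phi> (\<lambda>x. \<phi> x + \<psi> x) = dirac_comb (int_lattice D) \<Phi> \<phi> + dirac_comb (int_lattice D) \<Phi> \<psi>"
    by (rule dirac_comb_add[OF D B C C'])
next
  show "dirac_comb (int_lattice D) \<Phi> (\<lambda>x. c * \<phi> x) = c * dirac_comb (int_lattice D) \<Phi> \<phi>" for \<phi> c
    by (rule dirac_comb_cmult)
next
  note eq = dirac_comb_eq_integral[of D \<Phi> B, OF D B]
  have B0: "0 \<le> B" using order_trans[OF norm_ge_zero B] .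
  show "\<exists>C m. \<forall>\<phi>\<in>schwartz. norm (dirac_comb (int_lattice D) \<Phi> \<phi>) \<le> C * schwartz_seminorm m \<phi>"
  proof (intro exI ballI)
    fix \<phi> assume \<phi>: "\<phi> \<in> (schwartz :: (real ^ 'n \<Rightarrow> complex) set)"
    let ?s = "schwartz_seminorm (2 * CARD('n)) \<phi>"
    note le = schwartz_le_seminorm[OF \<phi>]
    have "norm (dirac_comb (int_lattice D) \<Phi> \<phi>) \<le> (\<integral>z. norm (\<Phi> z * \<phi> z) \<partial>count_space (int_lattice D))"
      unfolding eq(1)[OF le] by (rule integral_norm_bound)
    also have "\<dots> \<le> (\<integral>z. B * ?s * decay z \<partial>count_space (int_lattice D))"
    proof (intro integral_mono integrable_norm eq(2)[OF le] integrable_mult_right integrable_count_space_decay[OF D])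
      fix z show "norm (\<Phi> z * \<phi> z) \<le> B * ?s * decay z"
        using mult_mono[OF B le, of z z] B0 by (simp add: norm_mult mult.assoc)
    qed
    also have "\<dots> = (B * (\<integral>z. decay z \<partial>count_space (int_lattice D))) * ?s" by simp
    finally show "norm (dirac_comb (int_lattice D) \<Phi> \<phi>) \<le> (B * (\<integral>z. decay z \<partial>count_space (int_lattice D))) * schwartz_seminorm (2 * CARD('n)) \<phi>" .
  qed
qed

text \<open>The quotient by the positive continuous weight is bounded on the compact support. Test
  functions thereby enter the same limit argument as transforms of Schwartz functions.\<close>

lemma C_c_le_decay:
  fixes \<phi> :: "real ^ 'n \<Rightarrow> complex"
  assumes "\<phi> \<in> C_c"
  obtains C where "\<And>x. norm (\<phi> x) \<le> C * decay x"
proof -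
  let ?K = "closure (support_on UNIV \<phi>)"
  have "compact ((\<lambda>x. norm (\<phi> x) / decay x) ` ?K)"
    using assms decay_pos[THEN less_imp_neq, THEN not_sym] unfolding C_c_def compactly_supported_def
    by (intro compact_continuous_image continuous_intros continuous_decay) (auto intro: continuous_on_subset)
  then obtain C where "\<And>x. x \<in> ?K \<Longrightarrow> norm (norm (\<phi> x) / decay x) \<le> C"
    using compact_imp_bounded by (force simp: bounded_iff)
  then have C: "\<And>x. x \<in> ?K \<Longrightarrow> norm (\<phi> x) \<le> C * decay x"
    using pos_divide_le_eq[OF decay_pos] by (metis abs_of_nonneg divide_nonneg_nonneg decay_nonneg(1) norm_ge_zero real_norm_def)
  \<comment> \<open>If the closed support is empty, nothing is known about the sign of
    \<open>C\<close>.\<close>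
  have "norm (\<phi> x) \<le> max 0 C * decay x" for x
  proof (cases "x \<in> ?K")
    case True
    then show ?thesis using C[of x] mult_right_mono[of C "max 0 C" "decay x"] by simp
  next
    case False
    then have "\<phi> x = 0" using closure_subset[of "support_on UNIV \<phi>"] by (auto simp: support_on_def)
    then show ?thesis by simp
  qed
  then show ?thesis using that by blast
qed

section \<open>Spectral measures of finite patches\<close>

lemma cis_dual_periodic:
  assumes "u \<bullet> z \<in> \<int>"
  shows "cis (2 * pi * ((x + u) \<bullet> z)) = cis (2 * pi * (x \<bullet> z))"
proof -
  obtain n where "u \<bullet> z = of_int n" using assms by (auto elim: Ints_cases)
  then have "cis (2 * pi * (u \<bullet> z)) = 1" by (simp add: cis_multiple_2pi)
  moreover have "cis (2 * pi * ((x + u) \<bullet> z)) = cis (2 * pi * (x \<bullet> z)) * cis (2 * pi * (u \<bullet> z))"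
    by (simp add: cis_mult inner_add_left distrib_left)
  ultimately show ?thesis by simp
qed

text \<open>
  A nonzero dual vector gives a character that some translation by \<open>s\<close> multiplies by \<open>-1\<close>,
  whereas its integral over a fundamental domain is translation invariant.
\<close>

lemma integral_cell_character_eq_0:
  fixes D :: "real ^ 'n \<Rightarrow> real ^ 'n"
  assumes D: "linear D" "bij D" and dual: "\<And>u. u \<in> int_lattice D \<Longrightarrow> u \<bullet> z \<in> \<int>" and "z \<noteq> 0"
  shows "(\<integral>x. cis (2 * pi * (x \<bullet> z)) \<partial>density lborel (indicator (cell D))) = 0"
proof -
  let ?L = "int_lattice D" and ?N = "density lborel (indicator (cell D)) :: (real ^ 'n) measure"
  note [measurable] = cell_measurable[OF D(1)]
  \<comment> \<open>Half a wavelength of the character in the direction of z.\<close>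
  define s where "s = (1 / (2 * (z \<bullet> z))) *\<^sub>R z"
  have sz: "s \<bullet> z = 1 / 2" using assms(4) by (simp add: s_def)
  have s: "cis (2 * pi * (s \<bullet> z)) = - 1" unfolding sz by simp
  \<comment> \<open>The character on the cell shifted by \<open>s\<close>; folding it back by
    lattice vectors must reproduce the integral over the cell.\<close>
  define f where "f x = indicator (cell D) (x - s) *\<^sub>R cis (2 * pi * (x \<bullet> z))" for x
  have [measurable]: "f \<in> borel_measurable borel" unfolding f_def[abs_def] by measurable
  have N: "(\<integral>x. g x \<partial>?N) = (\<integral>x. indicator (cell D) x *\<^sub>R g x \<partial>lborel)"
    if "g \<in> borel_measurable borel" for g :: "real ^ 'n \<Rightarrow> complex"
    using that by (subst integral_density[symmetric]) (auto simp: ennreal_indicator)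
  have int: "integrable lborel f"
  proof -
    have image: "(+) s ` cell D = {x \<in> space borel. x - s \<in> cell D}"
      by (auto intro!: image_eqI[of _ _ "_ - s"])
    have "(+) s ` cell D \<in> sets borel" unfolding image by measurable
    moreover have "bounded ((+) s ` cell D)" by (rule bounded_translation[OF bounded_cell[OF D]])
    ultimately have int': "integrable lborel (indicator ((+) s ` cell D) :: real ^ 'n \<Rightarrow> real)"
      using emeasure_bounded_finite by (intro integrable_real_indicator) auto
    have le: "norm (f x) \<le> norm (indicator ((+) s ` cell D) x :: real)" for x
      unfolding image by (simp add: f_def indicator_def)
    show ?thesis by (rule Bochner_Integration.integrable_bound[OF int' _ AE_I2[OF le]]) measurable
  qed
  have "- (\<integral>x. cis (2 * pi * (x \<bullet> z)) \<partial>?N) = (\<integral>x. cis (2 * pi * (s \<bullet> z)) * cis (2 * pi * (x \<bullet> z)) \<partial>?N)"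
    by (simp add: s)
  also have "\<dots> = (\<integral>x. cis (2 * pi * ((s + x) \<bullet> z)) \<partial>?N)"
    by (simp add: cis_mult inner_add_left distrib_left)
  also have "\<dots> = (\<integral>x. indicator (cell D) x *\<^sub>R cis (2 * pi * ((s + x) \<bullet> z)) \<partial>lborel)"
    by (rule N) measurable
  also have "\<dots> = (\<integral>x. f x \<partial>distr lborel borel ((+) s))"
    by (subst integral_distr) (auto simp: f_def)
  also have "\<dots> = (\<integral>x. f x \<partial>convolution ?N (delta_set ?L))"
    by (simp only: lborel_distr_plus lborel_eq_convolution[OF D, symmetric])
  also have "\<dots> = (\<integral>x. \<integral>u. f (x + u) \<partial>count_space ?L \<partial>?N)"
    using int finite_lborel_cell[OF D] lborel_eq_convolution[OF D]
    by (intro integral_convolution_delta_set countable_int_lattice[OF D]) auto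
  also have "\<dots> = (\<integral>x. cis (2 * pi * (x \<bullet> z)) \<partial>?N)"
  proof (intro Bochner_Integration.integral_cong refl)
    fix x
    \<comment> \<open>Exactly one lattice translate of x lies in the shifted cell, and the character
      has the same value there as at x.\<close>
    have shift: "- cell_shift D (x - s) \<in> ?L"
      using int_lattice_diff[OF D(1) int_lattice_0[OF D(1)] cell_shift_in[OF D(2)]] by simp
    have "(\<integral>u. f (x + u) \<partial>count_space ?L) =
      (\<integral>u. indicator {- cell_shift D (x - s)} u *\<^sub>R cis (2 * pi * (x \<bullet> z)) \<partial>count_space ?L)"
    proof (intro Bochner_Integration.integral_cong refl)
      fix u assume "u \<in> space (count_space ?L)"
      then have u: "u \<in> ?L" by simp
      have mu: "- u \<in> ?L" using int_lattice_diff[OF D(1) int_lattice_0[OF D(1)] u] by simp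
      have "x + u - s \<in> cell D \<longleftrightarrow> u = - cell_shift D (x - s)"
        using cell_shift_iff[OF D mu, of "x - s"] minus_equation_iff[of u "cell_shift D (x - s)"]
        by (simp add: algebra_simps) metis
      moreover have "cis (2 * pi * ((x + u) \<bullet> z)) = cis (2 * pi * (x \<bullet> z))"
        by (rule cis_dual_periodic[OF dual[OF u]])
      ultimately show "f (x + u) = indicator {- cell_shift D (x - s)} u *\<^sub>R cis (2 * pi * (x \<bullet> z))"
        by (auto simp: f_def indicator_def)
    qed
    also have "\<dots> = cis (2 * pi * (x \<bullet> z))"
      using shift by (subst integral_scaleR_left) (auto simp: measure_count_space)
    finally show "(\<integral>u. f (x + u) \<partial>count_space ?L) = cis (2 * pi * (x \<bullet> z))" .
  qed
  finally show ?thesis by simp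
qed

section \<open>Correlation sums and periodograms\<close>

definition correlation_sum :: "'a::ab_group_add set \<Rightarrow> ('a \<Rightarrow> complex) \<Rightarrow> ('a \<Rightarrow> complex) \<Rightarrow> complex" where
  "correlation_sum S w \<phi> = (\<Sum>t\<in>S. \<Sum>t'\<in>S. w t * cnj (w t') * \<phi> (t - t'))"

text \<open>Restriction to the ball leaves finitely many points; \<open>tilde\<close> reflects the
  second factor and conjugates its weights, so a pair (t, t') contributes at t - t'.\<close>

lemma ball_autocorrelation_eq:
  fixes \<Gamma> :: "'a::euclidean_space set"
  assumes "finite (\<Gamma> \<inter> ball 0 r)"
  shows "ball_autocorrelation (dirac_comb \<Gamma> w) r \<phi> =
    correlation_sum (\<Gamma> \<inter> ball 0 r) w \<phi> / of_real (measure lborel (ball 0 r :: 'a set))"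
proof -
  let ?S = "\<Gamma> \<inter> ball 0 r"
  have restrict: "restrict_functional (ball 0 r) (dirac_comb \<Gamma> w) \<psi> = (\<Sum>t\<in>?S. w t * \<psi> t)" for \<psi>
  proof -
    have "restrict_functional (ball 0 r) (dirac_comb \<Gamma> w) \<psi> = (\<Sum>\<^sub>\<infinity>t\<in>?S. w t * \<psi> t)"
      unfolding restrict_functional_def dirac_comb_def by (rule infsum_cong_neutral) auto
    then show ?thesis using assms by simp
  qed
  show ?thesis
    unfolding ball_autocorrelation_def convolve_def tilde_def restrict correlation_sum_def
    by (simp add: sum_distrib_left mult.assoc)
qed

lemma correlation_sum_indicator:
  assumes "finite S"
  shows "(\<Sum>(t, t') \<in> {(t, t'). t \<in> S \<and> t' \<in> S \<and> t - t' = z}. w t * cnj (w t')) = correlation_sum S w (indicator {z})"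
proof -
  have "correlation_sum S w (indicator {z}) = (\<Sum>(t, t')\<in>S \<times> S. w t * cnj (w t') * indicator {z} (t - t'))"
    unfolding correlation_sum_def by (rule sum.cartesian_product)
  also have "\<dots> = (\<Sum>(t, t') \<in> {(t, t'). t \<in> S \<and> t' \<in> S \<and> t - t' = z}. w t * cnj (w t'))"
    by (rule sum.mono_neutral_cong_right) (use assms in \<open>auto simp: indicator_def\<close>)
  finally show ?thesis by simp
qed

text \<open>Pairs are grouped by their difference. The sum over a changing patch becomes an integral
  over a fixed lattice, to which dominated convergence applies.\<close>

lemma correlation_sum_eq_integral:
  assumes "finite S" "\<And>t t'. t \<in> S \<Longrightarrow> t' \<in> S \<Longrightarrow> t - t' \<in> \<Gamma>"
  shows "correlation_sum S w \<phi> = (\<integral>z. correlation_sum S w (indicator {z}) * \<phi> z \<partial>count_space \<Gamma>)"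
proof -
  have point: "integrable (count_space \<Gamma>) (\<lambda>z. indicator {z} a * \<phi> z)"
    "(\<integral>z. indicator {z} a * \<phi> z \<partial>count_space \<Gamma>) = \<phi> a" if "a \<in> \<Gamma>" for a
  proof -
    have eq: "(\<lambda>z. indicator {z} a * \<phi> z) = (\<lambda>z. indicator {a} z *\<^sub>R \<phi> a)"
      by (auto simp: indicator_def)
    show "integrable (count_space \<Gamma>) (\<lambda>z. indicator {z} a * \<phi> z)"
      unfolding eq using that by (intro integrable_scaleR_left integrable_real_indicator) (auto simp: emeasure_count_space_finite)
    show "(\<integral>z. indicator {z} a * \<phi> z \<partial>count_space \<Gamma>) = \<phi> a"
      unfolding eq using that by (subst integral_scaleR_left) (auto simp: measure_count_space emeasure_count_space_finite intro!: integrable_real_indicator)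
  qed
  have "(\<integral>z. correlation_sum S w (indicator {z}) * \<phi> z \<partial>count_space \<Gamma>) =
    (\<integral>z. (\<Sum>t\<in>S. \<Sum>t'\<in>S. w t * cnj (w t') * (indicator {z} (t - t') * \<phi> z)) \<partial>count_space \<Gamma>)"
    by (simp add: correlation_sum_def sum_distrib_right mult.assoc)
  also have "\<dots> = (\<Sum>t\<in>S. \<Sum>t'\<in>S. w t * cnj (w t') * (\<integral>z. indicator {z} (t - t') * \<phi> z \<partial>count_space \<Gamma>))"
    using point(1) assms(2) by (simp add: Bochner_Integration.integral_sum)
  also have "\<dots> = correlation_sum S w \<phi>"
    unfolding correlation_sum_def using point(2) assms(2) by (intro sum.cong refl) simp
  finally show ?thesis by simp
qed

text \<open>The periodogram of the patch. Being a squared modulus, it is the source of positivity of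
  the diffraction measure.\<close>

definition spectral_density :: "(real ^ 'n) set \<Rightarrow> (real ^ 'n \<Rightarrow> complex) \<Rightarrow> real ^ 'n \<Rightarrow> real" where
  "spectral_density S w k = (norm (\<Sum>t\<in>S. w t * cis (- 2 * pi * (k \<bullet> t))))\<^sup>2"

lemma spectral_density_nonneg: "0 \<le> spectral_density S w k"
  by (simp add: spectral_density_def)

lemma spectral_density_measurable [measurable]: "spectral_density S w \<in> borel_measurable borel"
  unfolding spectral_density_def[abs_def] by measurable

lemma spectral_density_le: "spectral_density S w k \<le> (\<Sum>t\<in>S. norm (w t))\<^sup>2"
proof -
  have "norm (\<Sum>t\<in>S. w t * cis (- 2 * pi * (k \<bullet> t))) \<le> (\<Sum>t\<in>S. norm (w t))"
    by (rule order_trans[OF norm_sum]) (simp add: norm_mult)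
  then show ?thesis unfolding spectral_density_def by (rule power_mono) simp
qed

lemma spectral_density_eq:
  "of_real (spectral_density S w k) = correlation_sum S w (\<lambda>z. cis (- 2 * pi * (k \<bullet> z)))"
proof -
  let ?g = "\<Sum>t\<in>S. w t * cis (- 2 * pi * (k \<bullet> t))"
  have "of_real (spectral_density S w k) = ?g * cnj ?g"
    unfolding spectral_density_def by (rule complex_norm_square)
  also have "\<dots> = (\<Sum>t\<in>S. \<Sum>t'\<in>S. (w t * cis (- 2 * pi * (k \<bullet> t))) * (cnj (w t') * cis (2 * pi * (k \<bullet> t'))))"
    by (simp add: sum_product cis_cnj)
  also have "\<dots> = correlation_sum S w (\<lambda>z. cis (- 2 * pi * (k \<bullet> z)))"
    unfolding correlation_sum_def
  proof (intro sum.cong refl)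
    fix t t'
    have "cis (- 2 * pi * (k \<bullet> (t - t'))) = cis (- 2 * pi * (k \<bullet> t)) * cis (2 * pi * (k \<bullet> t'))"
      unfolding cis_mult by (simp add: inner_diff_right algebra_simps)
    then show "(w t * cis (- 2 * pi * (k \<bullet> t))) * (cnj (w t') * cis (2 * pi * (k \<bullet> t'))) =
      w t * cnj (w t') * cis (- 2 * pi * (k \<bullet> (t - t')))"
      by (simp only: mult_ac)
  qed
  finally show ?thesis .
qed

lemma spectral_density_periodic:
  assumes "\<And>t. t \<in> S \<Longrightarrow> u \<bullet> t \<in> \<int>"
  shows "spectral_density S w (k + u) = spectral_density S w k"
proof -
  have "cis (- 2 * pi * ((k + u) \<bullet> t)) = cis (- 2 * pi * (k \<bullet> t))" if "t \<in> S" for t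
    using arg_cong[OF cis_dual_periodic[OF assms[OF that], of k], of cnj] by (simp add: cis_cnj)
  then show ?thesis unfolding spectral_density_def by simp
qed

definition spectral_measure :: "(real ^ 'n \<Rightarrow> real ^ 'n) \<Rightarrow> (real ^ 'n) set \<Rightarrow> (real ^ 'n \<Rightarrow> complex) \<Rightarrow> real \<Rightarrow> (real ^ 'n) measure" where
  "spectral_measure D S w v = density lborel (\<lambda>k. indicator (cell D) k * ennreal (spectral_density S w k / v))"

lemma sets_spectral_measure [simp, measurable_cong]: "sets (spectral_measure D S w v) = sets borel"
  by (simp add: spectral_measure_def)

lemma spectral_measure_eq:
  assumes "linear D"
  shows "spectral_measure D S w v = density (density lborel (indicator (cell D))) (\<lambda>k. ennreal (spectral_density S w k / v))"
  unfolding spectral_measure_def using cell_measurable[OF assms] by (subst density_density_eq) auto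

lemma integral_spectral_measure:
  fixes g :: "real ^ 'n \<Rightarrow> complex"
  assumes "linear D" "0 < v" and [measurable]: "g \<in> borel_measurable borel"
  shows "(\<integral>k. g k \<partial>spectral_measure D S w v) =
    (\<integral>k. (spectral_density S w k / v) *\<^sub>R g k \<partial>density lborel (indicator (cell D)))"
  unfolding spectral_measure_eq[OF assms(1)]
  using assms(2) by (subst integral_density)
    (auto intro!: AE_I2 divide_nonneg_nonneg spectral_density_nonneg)

lemma finite_spectral_measure:
  fixes D :: "real ^ 'n \<Rightarrow> real ^ 'n"
  assumes D: "linear D" "bij D" and "0 < v"
  shows "finite_measure (spectral_measure D S w v)"
proof (rule finite_measureI)
  let ?N = "density lborel (indicator (cell D)) :: (real ^ 'n) measure"
  interpret finite_measure ?N by (rule finite_lborel_cell[OF D])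
  have "emeasure (spectral_measure D S w v) (space (spectral_measure D S w v)) = (\<integral>\<^sup>+k. ennreal (spectral_density S w k / v) \<partial>?N)"
    unfolding spectral_measure_eq[OF D(1)] by (simp add: emeasure_density)
  also have "\<dots> \<le> (\<integral>\<^sup>+k. ennreal ((\<Sum>t\<in>S. norm (w t))\<^sup>2 / v) \<partial>?N)"
    using assms(3) by (intro nn_integral_mono ennreal_leI divide_right_mono spectral_density_le) auto
  also have "\<dots> < \<infinity>"
    by (simp add: ennreal_mult_less_top emeasure_eq_measure del: space_density)
  finally show "emeasure (spectral_measure D S w v) (space (spectral_measure D S w v)) \<noteq> \<infinity>" by simp
qed

lemma AE_spectral_measure_cell: "linear D \<Longrightarrow> AE k in spectral_measure D S w v. k \<in> cell D"
  unfolding spectral_measure_def by (rule AE_density_cell) auto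

text \<open>After expansion of the periodogram, orthogonality of characters on the cell retains
  exactly the pairs with difference \<open>z\<close>, each with the cell volume as a factor.\<close>

lemma integral_spectral_measure_character:
  fixes D :: "real ^ 'n \<Rightarrow> real ^ 'n"
  assumes D: "linear D" "bij D" and v: "0 < v"
    and dual: "\<And>u z. u \<in> int_lattice D \<Longrightarrow> z \<in> \<Gamma> \<Longrightarrow> u \<bullet> z \<in> \<int>"
    and S: "\<And>t. t \<in> S \<Longrightarrow> t \<in> \<Gamma>" and z: "z \<in> \<Gamma>"
  shows "(\<integral>k. cis (2 * pi * (k \<bullet> z)) \<partial>spectral_measure D S w v) =
    of_real (measure lborel (cell D)) * (correlation_sum S w (indicator {z}) / of_real v)"
proof -
  let ?N = "density lborel (indicator (cell D)) :: (real ^ 'n) measure"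
  let ?V = "measure lborel (cell D)"
  interpret finite_measure ?N by (rule finite_lborel_cell[OF D])
  have int: "integrable ?N (\<lambda>k. cis (2 * pi * (k \<bullet> y)))" for y
    by (rule integrable_const_bound[of _ 1]) auto
  have orth: "(\<integral>k. cis (2 * pi * (k \<bullet> (z - (t - t')))) \<partial>?N) = of_real ?V * indicator {z} (t - t')"
    if "t \<in> S" "t' \<in> S" for t t'
  proof (cases "t - t' = z")
    case True
    then show ?thesis using cell_measurable[OF D(1)]
      by (simp add: measure_def emeasure_density scaleR_conv_of_real)
  next
    case False
    have "u \<bullet> (z - (t - t')) \<in> \<int>" if "u \<in> int_lattice D" for u
      using dual[OF that z] dual[OF that S[OF \<open>t \<in> S\<close>]] dual[OF that S[OF \<open>t' \<in> S\<close>]] by (simp add: inner_diff_right)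
    moreover have "z - (t - t') \<noteq> 0" using False by simp
    ultimately show ?thesis using False by (subst integral_cell_character_eq_0[OF D]) auto
  qed
  have pt: "(spectral_density S w k / v) *\<^sub>R cis (2 * pi * (k \<bullet> z)) =
    (\<Sum>t\<in>S. \<Sum>t'\<in>S. w t * cnj (w t') * cis (2 * pi * (k \<bullet> (z - (t - t'))))) / of_real v" for k
  proof -
    have "of_real (spectral_density S w k) * cis (2 * pi * (k \<bullet> z)) =
      (\<Sum>t\<in>S. \<Sum>t'\<in>S. w t * cnj (w t') * (cis (- 2 * pi * (k \<bullet> (t - t'))) * cis (2 * pi * (k \<bullet> z))))"
      unfolding spectral_density_eq correlation_sum_def sum_distrib_right by (simp only: mult.assoc)
    also have "\<dots> = (\<Sum>t\<in>S. \<Sum>t'\<in>S. w t * cnj (w t') * cis (2 * pi * (k \<bullet> (z - (t - t')))))"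
      unfolding cis_mult by (simp add: inner_diff_right algebra_simps)
    finally show ?thesis by (simp add: scaleR_conv_of_real)
  qed
  have "(\<integral>k. cis (2 * pi * (k \<bullet> z)) \<partial>spectral_measure D S w v) =
    (\<integral>k. (\<Sum>t\<in>S. \<Sum>t'\<in>S. w t * cnj (w t') * cis (2 * pi * (k \<bullet> (z - (t - t'))))) / of_real v \<partial>?N)"
    unfolding pt[symmetric] by (rule integral_spectral_measure[OF D(1) v]) measurable
  also have "\<dots> = (\<Sum>t\<in>S. \<Sum>t'\<in>S. w t * cnj (w t') * (\<integral>k. cis (2 * pi * (k \<bullet> (z - (t - t')))) \<partial>?N)) / of_real v"
    using int by simp
  also have "(\<Sum>t\<in>S. \<Sum>t'\<in>S. w t * cnj (w t') * (\<integral>k. cis (2 * pi * (k \<bullet> (z - (t - t')))) \<partial>?N)) =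
    of_real ?V * correlation_sum S w (indicator {z})"
    unfolding correlation_sum_def sum_distrib_left by (intro sum.cong refl) (simp add: orth)
  finally show ?thesis by simp
qed

text \<open>Unfolding the periodization against a periodic density gives an integral over the whole
  space, in which each pair (t, t') yields the transform of \<phi> at t - t'. In contrast to the
  character integrals, no cell volume appears.\<close>

lemma correlation_sum_fourier:
  fixes D :: "real ^ 'n \<Rightarrow> real ^ 'n"
  assumes D: "linear D" "bij D" and v: "0 < v"
    and dual: "\<And>u z. u \<in> int_lattice D \<Longrightarrow> z \<in> \<Gamma> \<Longrightarrow> u \<bullet> z \<in> \<int>"
    and S: "\<And>t. t \<in> S \<Longrightarrow> t \<in> \<Gamma>"
    and [measurable]: "\<phi> \<in> borel_measurable borel" and C: "\<And>x. norm (\<phi> x) \<le> C * decay x"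
  shows "correlation_sum S w (fourier \<phi>) / of_real v = (\<integral>k. periodization (int_lattice D) \<phi> k \<partial>spectral_measure D S w v)"
proof -
  let ?L = "int_lattice D"
  have "(\<integral>k. periodization ?L \<phi> k \<partial>spectral_measure D S w v) = (\<integral>k. \<phi> k \<partial>convolution (spectral_measure D S w v) (delta_set ?L))"
    using C by (intro integral_convolution_periodization[symmetric] D finite_spectral_measure v AE_spectral_measure_cell) auto
  also have "convolution (spectral_measure D S w v) (delta_set ?L) = density lborel (\<lambda>k. ennreal (spectral_density S w k / v))"
    unfolding spectral_measure_def
    by (rule density_lborel_eq_convolution[OF D, symmetric]) (use dual S in \<open>auto simp: spectral_density_periodic\<close>)
  also have "(\<integral>k. \<phi> k \<partial>density lborel (\<lambda>k. ennreal (spectral_density S w k / v))) = (\<integral>k. (spectral_density S w k / v) *\<^sub>R \<phi> k \<partial>lborel)"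
    using v by (subst integral_density)
      (auto intro!: AE_I2 divide_nonneg_nonneg spectral_density_nonneg)
  also have "\<dots> = (\<integral>k. (\<Sum>t\<in>S. \<Sum>t'\<in>S. w t * cnj (w t') * (cis (- 2 * pi * ((t - t') \<bullet> k)) * \<phi> k)) / of_real v \<partial>lborel)"
  proof (intro Bochner_Integration.integral_cong refl)
    fix k
    have "of_real (spectral_density S w k) * \<phi> k =
      (\<Sum>t\<in>S. \<Sum>t'\<in>S. w t * cnj (w t') * (cis (- 2 * pi * ((t - t') \<bullet> k)) * \<phi> k))"
      unfolding spectral_density_eq correlation_sum_def sum_distrib_right by (simp only: mult.assoc inner_commute)
    then show "(spectral_density S w k / v) *\<^sub>R \<phi> k =
      (\<Sum>t\<in>S. \<Sum>t'\<in>S. w t * cnj (w t') * (cis (- 2 * pi * ((t - t') \<bullet> k)) * \<phi> k)) / of_real v"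
      by (simp add: scaleR_conv_of_real)
  qed
  also have "\<dots> = (\<Sum>t\<in>S. \<Sum>t'\<in>S. w t * cnj (w t') * (\<integral>k. cis (- 2 * pi * ((t - t') \<bullet> k)) * \<phi> k \<partial>lborel)) / of_real v"
  proof -
    have "integrable lborel (\<lambda>k. cis (- 2 * pi * (y \<bullet> k)) * \<phi> k)" for y
      by (rule integrable_le_decay[of _ C], measurable) (use C in \<open>simp add: norm_mult\<close>)
    then show ?thesis by simp
  qed
  finally show ?thesis by (simp add: correlation_sum_def fourier_cis)
qed

text \<open>Lattice points are isolated, so a sufficiently narrow cone around \<open>z\<close>
  vanishes at all the others.\<close>

lemma isolating_test_function:
  fixes G :: "real ^ 'n \<Rightarrow> real ^ 'n"
  assumes "linear G" "bij G"
  obtains \<phi> where "\<phi> \<in> C_c" "\<And>x. x \<in> int_lattice G \<Longrightarrow> \<phi> x = indicator {z} x"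
proof -
  obtain d where d: "0 < d" "\<And>x. x \<in> int_lattice G \<inter> cball z 1 \<Longrightarrow> x \<noteq> z \<Longrightarrow> d \<le> dist z x"
    using finite_set_avoid[OF finite_int_lattice_cball[OF assms, of z 1], of z] by auto
  \<comment> \<open>\<open>d\<close> controls only the finitely many lattice points within distance
    1; the minimum with 1 takes care of the rest.\<close>
  define e where "e = min d 1"
  have e: "0 < e" using d(1) by (simp add: e_def)
  define \<phi> where "\<phi> x = complex_of_real (max 0 (1 - dist z x / e))" for x
  show ?thesis
  proof (rule that)
    have "support_on UNIV \<phi> \<subseteq> cball z e"
    proof
      fix x assume "x \<in> support_on UNIV \<phi>"
      then have "\<phi> x \<noteq> 0" by (simp add: support_on_def)
      then have "\<not> 1 - dist z x / e \<le> 0" unfolding \<phi>_def by (metis max.absorb1 of_real_0)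
      then have "dist z x / e < 1" by simp
      then have "dist z x < e" using e by (simp add: pos_divide_less_eq)
      then show "x \<in> cball z e" using e by simp
    qed
    then have "bounded (support_on UNIV \<phi>)" using bounded_cball bounded_subset by blast
    then show "\<phi> \<in> C_c"
      using e unfolding C_c_def compactly_supported_def \<phi>_def[abs_def] by (auto intro!: continuous_intros)
    fix x assume x: "x \<in> int_lattice G"
    show "\<phi> x = indicator {z} x"
    proof (cases "x = z")
      case False
      then have "e \<le> dist z x" using d(2)[of x] x by (cases "dist z x \<le> 1") (auto simp: e_def)
      then have "1 - dist z x / e \<le> 0" using e by simp
      then show ?thesis using False by (simp add: \<phi>_def max_def)
    qed (simp add: \<phi>_def)
  qed
qed

lemma supported_on_if_AE:
  assumes "AE x in M. x \<in> A" "A \<in> sets M"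
  shows "supported_on M A"
proof -
  have "density M (indicator A) = density M (\<lambda>_. 1)"
    using assms by (intro density_cong) (auto elim!: eventually_mono)
  then show ?thesis by (simp add: supported_on_def density_1)
qed

lemma norm_functional_of_convolution_le:
  fixes D :: "real ^ 'n \<Rightarrow> real ^ 'n" and \<phi> :: "real ^ 'n \<Rightarrow> complex"
  assumes D: "linear D" "bij D" and \<rho>: "finite_measure \<rho>" "sets \<rho> = sets borel" "AE x in \<rho>. x \<in> cell D"
    and \<phi>: "\<phi> \<in> schwartz"
  shows "norm (functional_of (convolution \<rho> (delta_set (int_lattice D))) \<phi>) \<le>
    (\<integral>x. decay x \<partial>convolution \<rho> (delta_set (int_lattice D))) * schwartz_seminorm (2 * CARD('n)) \<phi>"
proof -
  let ?M = "convolution \<rho> (delta_set (int_lattice D))" and ?s = "schwartz_seminorm (2 * CARD('n)) \<phi>"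
  have [measurable]: "\<phi> \<in> borel_measurable borel"
    using schwartz_continuous[OF \<phi>] by (rule borel_measurable_continuous_onI)
  note le = schwartz_le_seminorm[OF \<phi>]
  have int: "integrable ?M \<phi>" by (rule integrable_convolution_le_decay[OF D \<rho> _ le]) simp
  obtain R where R: "\<And>x. x \<in> cell D \<Longrightarrow> norm x < R" using cell_norm_bound[OF D] by metis
  have "AE x in \<rho>. norm x \<le> R" using \<rho>(3) by eventually_elim (simp add: R less_imp_le)
  then have int_decay: "integrable ?M decay" by (rule integrable_decay_convolution[OF D \<rho>(2,1)])
  have "norm (functional_of ?M \<phi>) \<le> (\<integral>x. norm (\<phi> x) \<partial>?M)" unfolding functional_of_def by (rule integral_norm_bound)
  also have "\<dots> \<le> (\<integral>x. ?s * decay x \<partial>?M)"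
    by (intro integral_mono integrable_norm int integrable_mult_right int_decay le)
  finally show ?thesis by (simp add: mult.commute)
qed

lemma fourier_add_integrable:
  fixes \<phi> \<psi> :: "real ^ 'n \<Rightarrow> complex"
  assumes "integrable lborel \<phi>" "integrable lborel \<psi>"
  shows "fourier (\<lambda>x. \<phi> x + \<psi> x) = (\<lambda>x. fourier \<phi> x + fourier \<psi> x)"
proof
  fix x :: "real ^ 'n"
  have int: "integrable lborel (\<lambda>y. cis (- 2 * pi * (x \<bullet> y)) * f y)" if "integrable lborel f" for f
    using that by (rule Bochner_Integration.integrable_bound) (use borel_measurable_integrable[OF that] in \<open>auto simp: norm_mult\<close>)
  show "fourier (\<lambda>x. \<phi> x + \<psi> x) x = fourier \<phi> x + fourier \<psi> x"
    unfolding fourier_cis distrib_left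
    by (rule Bochner_Integration.integral_add) (rule int[OF assms(1)], rule int[OF assms(2)])
qed

lemma fourier_cmult: "fourier (\<lambda>x. c * \<phi> x) = (\<lambda>x. c * fourier \<phi> x)"
  unfolding fourier_def by (simp add: mult.left_commute[of _ c])

section \<open>The diffraction measure\<close>

theorem theorem1:
  fixes \<Gamma> :: "(real ^ 'n) set"
    and w :: "real ^ 'n \<Rightarrow> complex"
    and r :: "nat \<Rightarrow> real"
    and \<gamma> :: "(real ^ 'n) functional"
  assumes lattice: "is_lattice \<Gamma>"
    and bounded: "bounded (w ` \<Gamma>)"
    and autocorrelation: "autocorrelation_along (dirac_comb \<Gamma> w) r \<gamma>"
  shows "\<exists>\<Phi> F C R N.
           C \<ge> 0 \<and> R \<ge> 0 \<and>
           autocorrelation_interpolation \<Gamma> w r \<gamma> \<Phi> \<and>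
           entire_extension_with_growth \<Phi> F C R N \<and>
           (\<exists>\<gamma>h \<rho> E.
              positive_measure \<gamma>h \<and>
              fourier_transform_of \<gamma> (functional_of \<gamma>h) \<and>
              translation_bounded \<gamma>h \<and>
              periodic \<gamma>h (dual_lattice \<Gamma>) \<and>
              \<gamma>h = convolution \<rho> (delta_set (dual_lattice \<Gamma>)) \<and>
              positive_measure \<rho> \<and> finite_measure \<rho> \<and>
              fundamental_domain (dual_lattice \<Gamma>) E \<and> E \<subseteq> ball 0 R \<and>
              supported_on \<rho> E)"
proof -
  obtain A where A: "linear A" "bij A" "\<Gamma> = int_lattice (inv A)" "dual_lattice \<Gamma> = int_lattice (adjoint A)"
    by (rule is_latticeE[OF lattice])
  define G where "G = inv A"
  define D where "D = adjoint A"
  have G: "linear G" "bij G" and D: "linear D" "bij D"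
    using linear_inv[OF A(1,2)] bij_adjoint[OF A(1,2)] by (auto simp: G_def D_def)
  have \<Gamma>: "\<Gamma> = int_lattice G" and dual: "dual_lattice \<Gamma> = int_lattice D"
    using A(3,4) by (auto simp: G_def D_def)
  have pairing: "u \<bullet> z \<in> \<int>" if "u \<in> int_lattice D" "z \<in> \<Gamma>" for u z
    using that unfolding dual[symmetric] dual_lattice_def by blast
  define v where "v i = measure lborel (ball (0 :: real ^ 'n) (r i))" for i
  have r: "0 < r i" for i using autocorrelation by (simp add: autocorrelation_along_def)
  have v: "0 < v i" for i using r[of i] by (simp add: v_def content_ball_pos)
  define S where "S i = \<Gamma> \<inter> ball 0 (r i)" for i
  have finS: "finite (S i)" for i
    unfolding S_def \<Gamma> using finite_int_lattice_cball[OF G, of 0 "r i"]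
    by (rule finite_subset[rotated]) auto
  have S: "t \<in> \<Gamma>" if "t \<in> S i" for t i using that by (simp add: S_def)
  have Sdiff: "t - t' \<in> \<Gamma>" if "t \<in> S i" "t' \<in> S i" for t t' i
    using S[OF that(1)] S[OF that(2)] unfolding \<Gamma> by (rule int_lattice_diff[OF G(1)])
  define a where "a i \<phi> = correlation_sum (S i) w \<phi> / of_real (v i)" for i \<phi>
  have a_lim: "(\<lambda>i. a i \<phi>) \<longlonglongrightarrow> \<gamma> \<phi>" if "\<phi> \<in> C_c" for \<phi>
  proof -
    have "(\<lambda>i. ball_autocorrelation (dirac_comb \<Gamma> w) (r i) \<phi>) \<longlonglongrightarrow> \<gamma> \<phi>"
      using autocorrelation that by (simp add: autocorrelation_along_def vaguely_converges_def)
    then show ?thesis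
      using finS by (simp add: ball_autocorrelation_eq a_def S_def v_def)
  qed
  \<comment> \<open>On differences of patch points the isolating function coincides with a point
    indicator, so vague convergence applies to each coefficient, along the full sequence.\<close>
  have coeff_lim: "\<exists>l. (\<lambda>i. a i (indicator {z})) \<longlonglongrightarrow> l" for z
  proof -
    obtain \<phi> where \<phi>: "\<phi> \<in> C_c" "\<And>x. x \<in> \<Gamma> \<Longrightarrow> \<phi> x = indicator {z} x"
      using isolating_test_function[OF G] unfolding \<Gamma> by metis
    have "a i \<phi> = a i (indicator {z})" for i
      unfolding a_def correlation_sum_def using \<phi>(2) Sdiff by simp
    then show ?thesis using a_lim[OF \<phi>(1)] by auto
  qed
  define V where "V = measure lborel (cell D)"
  have V: "0 < V" unfolding V_def by (rule emeasure_cell(1)[OF D])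
  define M where "M i = spectral_measure D (S i) w (v i)" for i
  have M: "finite_measure (M i)" "sets (M i) = sets borel" "AE k in M i. k \<in> cell D" for i
    unfolding M_def by (auto intro: finite_spectral_measure D v AE_spectral_measure_cell)
  have spM: "space (M i) = UNIV" for i using sets_eq_imp_space_eq[OF M(2)] by simp
  have M_char: "(\<integral>k. cis (2 * pi * (k \<bullet> z)) \<partial>M i) = of_real V * a i (indicator {z})" if "z \<in> \<Gamma>" for z i
    unfolding M_def a_def V_def
    by (rule integral_spectral_measure_character[OF D v pairing S that])
  have zero: "0 \<in> \<Gamma>" unfolding \<Gamma> by (rule int_lattice_0[OF G(1)])
  \<comment> \<open>The character at 0 is constantly 1, so the total mass is itself a
    coefficient.\<close>
  have mass: "of_real (measure (M i) UNIV) = of_real V * a i (indicator {0})" for i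
    using M_char[OF zero, of i] by (simp add: spM scaleR_conv_of_real)
  \<comment> \<open>Positivity of the spectral measures bounds every coefficient by the mass; since
    the masses converge, this is uniform in \<open>i\<close> and \<open>z\<close> and supplies the
    majorant for dominated convergence.\<close>
  have a_bound: "norm (a i (indicator {z})) \<le> measure (M i) UNIV / V" if "z \<in> \<Gamma>" for i z
  proof -
    have "V * norm (a i (indicator {z})) = norm (\<integral>k. cis (2 * pi * (k \<bullet> z)) \<partial>M i)"
      unfolding M_char[OF that] using V by (simp add: norm_mult)
    also have "\<dots> \<le> (\<integral>k. norm (cis (2 * pi * (k \<bullet> z))) \<partial>M i)" by (rule integral_norm_bound)
    also have "\<dots> = measure (M i) UNIV" by (simp add: spM)
    finally show ?thesis using V by (simp add: field_simps)
  qed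
  obtain l where "(\<lambda>i. a i (indicator {0})) \<longlonglongrightarrow> l" using coeff_lim by blast
  then have "(\<lambda>i. Re (of_real V * a i (indicator {0}))) \<longlonglongrightarrow> Re (of_real V * l)"
    by (intro tendsto_intros)
  then have mass_lim: "(\<lambda>i. measure (M i) UNIV) \<longlonglongrightarrow> Re (of_real V * l)"
    unfolding mass[symmetric] by simp
  then have "Bseq (\<lambda>i. measure (M i) UNIV)" by (intro convergent_imp_Bseq convergentI)
  then obtain B where "\<And>i. norm (measure (M i) UNIV) \<le> B" by (auto simp: Bseq_def)
  then have a_le: "norm (a i (indicator {z})) \<le> B / V" if "z \<in> \<Gamma>" for i z
    using a_bound[OF that, of i] V by (smt (verit) divide_right_mono real_norm_def abs_ge_self)
  obtain s \<rho> where s: "strict_mono s" and \<rho>: "finite_measure \<rho>" "sets \<rho> = sets borel" "AE x in \<rho>. x \<in> cell D"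
    and weak: "\<And>F :: real ^ 'n \<Rightarrow> complex. continuous_on UNIV F \<Longrightarrow> (\<And>x u. u \<in> int_lattice D \<Longrightarrow> F (x + u) = F x) \<Longrightarrow>
      (\<lambda>i. \<integral>x. F x \<partial>M (s i)) \<longlonglongrightarrow> (\<integral>x. F x \<partial>\<rho>)"
    using weak_compactness_cell[OF D M mass_lim] by metis
  note [measurable_cong] = \<rho>(2)
  have sp\<rho>: "space \<rho> = UNIV" using sets_eq_imp_space_eq[OF \<rho>(2)] by simp
  \<comment> \<open>Division by the cell volume cancels the factor from the orthogonality of
    characters.\<close>
  define \<sigma> where "\<sigma> = density \<rho> (\<lambda>_. ennreal (1 / V))"
  have \<sigma>_sets: "sets \<sigma> = sets borel" by (simp add: \<sigma>_def \<rho>(2))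
  have \<sigma>_fin: "finite_measure \<sigma>"
  proof (rule finite_measureI)
    interpret finite_measure \<rho> by fact
    show "emeasure \<sigma> (space \<sigma>) \<noteq> \<infinity>"
      unfolding \<sigma>_def by (simp add: emeasure_density nn_integral_cmult ennreal_mult_eq_top_iff)
  qed
  obtain R where R: "0 < R" "\<And>x. x \<in> cell D \<Longrightarrow> norm x < R" using cell_norm_bound[OF D] by metis
  have \<sigma>_AE: "AE x in \<sigma>. norm x \<le> R"
    unfolding \<sigma>_def using \<rho>(3) by (subst AE_density) (auto elim!: eventually_mono simp: R(2) less_imp_le)
  define \<Phi> where "\<Phi> = char_function \<sigma>"
  define K where "K = measure \<sigma> (space \<sigma>)"
  have \<Phi>_le: "norm (\<Phi> x) \<le> K" for x
    unfolding \<Phi>_def K_def by (rule norm_char_function_le[OF \<sigma>_fin])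
  have \<Phi>_eq: "\<Phi> z = (\<integral>k. cis (2 * pi * (k \<bullet> z)) \<partial>\<rho>) / of_real V" for z
    unfolding \<Phi>_def char_function_def \<sigma>_def using V
    by (subst integral_density) (auto simp: scaleR_conv_of_real)
  \<comment> \<open>Weak convergence identifies the limit along the subsequence, and uniqueness
    carries it over to the whole sequence.\<close>
  have coeff: "(\<lambda>i. a i (indicator {z})) \<longlonglongrightarrow> \<Phi> z" if z: "z \<in> \<Gamma>" for z
  proof -
    obtain l where l: "(\<lambda>i. a i (indicator {z})) \<longlonglongrightarrow> l" using coeff_lim by blast
    have "(\<lambda>i. \<integral>k. cis (2 * pi * (k \<bullet> z)) \<partial>M (s i)) \<longlonglongrightarrow> (\<integral>k. cis (2 * pi * (k \<bullet> z)) \<partial>\<rho>)"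
    proof (rule weak)
      show "continuous_on UNIV (\<lambda>x. cis (2 * pi * (x \<bullet> z)))" unfolding cis_conv_exp by (intro continuous_intros)
    qed (rule cis_dual_periodic[OF pairing[OF _ z]])
    then have "(\<lambda>i. of_real V * a (s i) (indicator {z}) / of_real V) \<longlonglongrightarrow> \<Phi> z"
      unfolding \<Phi>_eq M_char[OF z] using V by (intro tendsto_divide) auto
    then have "(\<lambda>i. a (s i) (indicator {z})) \<longlonglongrightarrow> \<Phi> z" using V by simp
    moreover have "(\<lambda>i. a (s i) (indicator {z})) \<longlonglongrightarrow> l"
      using LIMSEQ_subseq_LIMSEQ[OF l s] by (simp add: o_def)
    ultimately show ?thesis using l LIMSEQ_unique by blast
  qed
  \<comment> \<open>Stated for all functions below the weight because it is applied twice: to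
    \<open>C_c\<close>, which identifies \<gamma>, and to \<open>fourier \<phi>\<close>, whose
    support need not be compact.\<close>
  have a_dirac: "(\<lambda>i. a i \<phi>) \<longlonglongrightarrow> dirac_comb \<Gamma> \<Phi> \<phi>" if C: "\<And>x. norm (\<phi> x) \<le> C * decay x" for \<phi> C
  proof -
    have "(\<lambda>i. \<integral>z. a i (indicator {z}) * \<phi> z \<partial>count_space \<Gamma>) \<longlonglongrightarrow> (\<integral>z. \<Phi> z * \<phi> z \<partial>count_space \<Gamma>)"
    proof (rule integral_dominated_convergence[where w = "\<lambda>z. B / V * C * decay z"])
      show "integrable (count_space \<Gamma>) (\<lambda>z. B / V * C * decay z)"
        unfolding \<Gamma> by (intro integrable_mult_right integrable_count_space_decay[OF G])
      show "AE z in count_space \<Gamma>. (\<lambda>i. a i (indicator {z}) * \<phi> z) \<longlonglongrightarrow> \<Phi> z * \<phi> z"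
        by (rule AE_I2) (auto intro!: tendsto_mult coeff)
      show "AE z in count_space \<Gamma>. norm (a i (indicator {z}) * \<phi> z) \<le> B / V * C * decay z" for i
      proof (rule AE_I2)
        fix z assume "z \<in> space (count_space \<Gamma>)"
        then have "norm (a i (indicator {z})) * norm (\<phi> z) \<le> (B / V) * (C * decay z)"
          using a_le[of z i] C[of z] order_trans[OF norm_ge_zero a_le[OF zero]] by (intro mult_mono) auto
        then show "norm (a i (indicator {z}) * \<phi> z) \<le> B / V * C * decay z" by (simp add: norm_mult mult.assoc)
      qed
    qed auto
    moreover have "a i \<phi> = (\<integral>z. a i (indicator {z}) * \<phi> z \<partial>count_space \<Gamma>)" for i
      unfolding a_def by (subst correlation_sum_eq_integral[OF finS Sdiff]) auto
    moreover have "dirac_comb \<Gamma> \<Phi> \<phi> = (\<integral>z. \<Phi> z * \<phi> z \<partial>count_space \<Gamma>)"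
      unfolding \<Gamma> using \<Phi>_le C by (rule dirac_comb_eq_integral[OF G])
    ultimately show ?thesis by simp
  qed
  have \<gamma>_eq: "\<gamma> \<phi> = dirac_comb \<Gamma> \<Phi> \<phi>" if \<phi>: "\<phi> \<in> C_c" for \<phi>
  proof -
    obtain C where "\<And>x. norm (\<phi> x) \<le> C * decay x" using C_c_le_decay[OF \<phi>] by metis
    from a_dirac[OF this] show ?thesis using a_lim[OF \<phi>] LIMSEQ_unique by blast
  qed
  define \<gamma>h where "\<gamma>h = convolution \<rho> (delta_set (int_lattice D))"
  define T where "T = dirac_comb \<Gamma> \<Phi>"
  \<comment> \<open>One sequence with two limits: as integrals of the periodized \<phi> it converges
    weakly, and as correlation sums of \<open>fourier \<phi>\<close> it converges to the
    comb.\<close>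
  have T_fourier: "T (fourier \<phi>) = functional_of \<gamma>h \<phi>" if \<phi>: "\<phi> \<in> schwartz" for \<phi>
  proof -
    obtain C where C: "\<And>x. norm (\<phi> x) \<le> C * decay x" using schwartz_le_decay[OF \<phi>] by metis
    obtain C' where C': "\<And>x. norm (fourier \<phi> x) \<le> C' * decay x" using fourier_schwartz_le_decay[OF \<phi>] by metis
    note cont = schwartz_continuous[OF \<phi>]
    have meas: "\<phi> \<in> borel_measurable borel" using cont by (rule borel_measurable_continuous_onI)
    have "(\<lambda>i. \<integral>k. periodization (int_lattice D) \<phi> k \<partial>M (s i)) \<longlonglongrightarrow> (\<integral>k. periodization (int_lattice D) \<phi> k \<partial>\<rho>)"
      by (intro weak continuous_periodization[OF D cont C] periodization_periodic[OF D(1)])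
    moreover have "(\<integral>k. periodization (int_lattice D) \<phi> k \<partial>M i) = a i (fourier \<phi>)" for i
      unfolding M_def a_def by (rule correlation_sum_fourier[OF D v pairing S meas C, symmetric])
    moreover have "(\<lambda>i. a (s i) (fourier \<phi>)) \<longlonglongrightarrow> T (fourier \<phi>)"
      using LIMSEQ_subseq_LIMSEQ[OF a_dirac[OF C'] s] by (simp add: o_def T_def)
    ultimately have "T (fourier \<phi>) = (\<integral>k. periodization (int_lattice D) \<phi> k \<partial>\<rho>)"
      using LIMSEQ_unique by fastforce
    then show ?thesis
      unfolding \<gamma>h_def functional_of_def integral_convolution_periodization[OF D \<rho> meas C] .
  qed
  have T1: "tempered_extension \<gamma> T"
    unfolding tempered_extension_def T_def
  proof (intro conjI allI impI)
    show "tempered_distribution (dirac_comb \<Gamma> \<Phi>)"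
      unfolding \<Gamma> by (rule tempered_distribution_dirac_comb[OF G \<Phi>_le])
  qed (simp add: \<gamma>_eq smooth_compactly_supported_in_C_c)
  have T2: "tempered_extension (functional_of \<gamma>h) (\<lambda>\<phi>. T (fourier \<phi>))"
    unfolding tempered_extension_def tempered_distribution_def
  proof (intro conjI allI impI ballI)
    fix \<phi> \<psi> assume \<phi>: "\<phi> \<in> (schwartz :: (real ^ 'n \<Rightarrow> complex) set)" and \<psi>: "\<psi> \<in> (schwartz :: (real ^ 'n \<Rightarrow> complex) set)"
    have int: "integrable lborel f" if f: "f \<in> schwartz" for f :: "real ^ 'n \<Rightarrow> complex"
      using schwartz_le_decay[OF f] borel_measurable_continuous_onI[OF schwartz_continuous[OF f]]
      by (metis integrable_le_decay)
    obtain C where C: "\<And>x. norm (fourier \<phi> x) \<le> C * decay x" using fourier_schwartz_le_decay[OF \<phi>] by metis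
    obtain C' where C': "\<And>x. norm (fourier \<psi> x) \<le> C' * decay x" using fourier_schwartz_le_decay[OF \<psi>] by metis
    show "T (fourier (\<lambda>x. \<phi> x + \<psi> x)) = T (fourier \<phi>) + T (fourier \<psi>)"
      unfolding T_def fourier_add_integrable[OF int[OF \<phi>] int[OF \<psi>]] \<Gamma> by (rule dirac_comb_add[OF G \<Phi>_le C C'])
  next
    show "T (fourier (\<lambda>x. c * \<phi> x)) = c * T (fourier \<phi>)" for \<phi> c
      unfolding T_def fourier_cmult by (rule dirac_comb_cmult)
  next
    \<comment> \<open>The estimate is taken from the measure side, where \<phi> itself is
      integrated, so seminorms of \<open>fourier \<phi>\<close> do not enter.\<close>
    show "\<exists>C m. \<forall>\<phi>\<in>schwartz. norm (T (fourier \<phi>)) \<le> C * schwartz_seminorm m \<phi>"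
      using T_fourier norm_functional_of_convolution_le[OF D \<rho>] unfolding \<gamma>h_def by metis
  next
    show "T (fourier \<phi>) = functional_of \<gamma>h \<phi>" if "smooth \<phi> \<and> compactly_supported \<phi>" for \<phi>
      using that by (intro T_fourier smooth_compactly_supported_in_schwartz) auto
  qed
  have "autocorrelation_interpolation \<Gamma> w r \<gamma> \<Phi>"
    unfolding autocorrelation_interpolation_def
  proof (intro conjI ballI)
    show "same_measure \<gamma> (dirac_comb \<Gamma> \<Phi>)" by (simp add: same_measure_def \<gamma>_eq)
    show "Elementary_Metric_Spaces.bounded (range \<Phi>)" using \<Phi>_le by (auto simp: bounded_iff)
    show "continuous_on UNIV \<Phi>" unfolding \<Phi>_def by (rule continuous_char_function[OF \<sigma>_fin \<sigma>_sets])
    show "positive_definite \<Phi>" unfolding \<Phi>_def by (rule positive_definite_char_function[OF \<sigma>_fin \<sigma>_sets])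
    fix z assume "z \<in> \<Gamma>"
    then show "autocorrelation_coeff \<Gamma> w r z (\<Phi> z)"
      using coeff[of z] correlation_sum_indicator[OF finS, where z = z and w = w]
      by (simp add: autocorrelation_coeff_def a_def S_def v_def)
  qed
  \<comment> \<open>The bounded integrand contributes no polynomial factor, whence exponent 0; the
    exponential type is 2 pi times the norm bound of the cell.\<close>
  moreover have "entire_extension_with_growth \<Phi> (fourier_laplace \<sigma>) K (2 * pi * R) 0"
    unfolding entire_extension_with_growth_def K_def \<Phi>_def
    using norm_fourier_laplace_le[OF \<sigma>_fin \<sigma>_sets \<sigma>_AE]
    by (simp add: entire_fourier_laplace[OF \<sigma>_fin \<sigma>_sets \<sigma>_AE] fourier_laplace_complex_vec)
  moreover have "0 \<le> K" "0 \<le> 2 * pi * R" using R(1) by (simp_all add: K_def)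
  moreover have tb: "translation_bounded \<gamma>h"
    unfolding \<gamma>h_def by (rule translation_bounded_convolution[OF D \<rho>(2,1)])
  moreover have "positive_measure \<gamma>h"
    by (rule positive_measure_if_translation_bounded[OF tb]) (simp add: \<gamma>h_def)
  moreover have "fourier_transform_of \<gamma> (functional_of \<gamma>h)"
    unfolding fourier_transform_of_def using T1 T2 by blast
  moreover have "periodic \<gamma>h (dual_lattice \<Gamma>)"
    unfolding \<gamma>h_def dual by (rule periodic_convolution[OF D \<rho>(2)])
  moreover have "\<gamma>h = convolution \<rho> (delta_set (dual_lattice \<Gamma>))"
    by (simp add: \<gamma>h_def dual)
  moreover have "positive_measure \<rho>"
    using \<rho>(1,2) by (auto simp: positive_measure_def finite_measure.emeasure_eq_measure)
  moreover have "fundamental_domain (dual_lattice \<Gamma>) (cell D)"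
    unfolding dual by (rule fundamental_domain_cell[OF D])
  \<comment> \<open>The radius has to be the growth constant just chosen, which is larger than the
    norm bound because 2 pi exceeds 1.\<close>
  moreover have "cell D \<subseteq> ball 0 (2 * pi * R)"
  proof
    fix x assume "x \<in> cell D"
    then have "norm x < R" by (rule R(2))
    also have "R \<le> 2 * pi * R" using R(1) pi_ge_two by simp
    finally show "x \<in> ball 0 (2 * pi * R)" by simp
  qed
  moreover have "supported_on \<rho> (cell D)"
    by (rule supported_on_if_AE[OF \<rho>(3)]) (simp add: \<rho>(2) cell_measurable[OF D(1)])
  ultimately show ?thesis using \<rho>(1) by blast
qed

end
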